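(* Let $q\in L^1([0,R])$ for all $R>0$ be real-valued and such that $-\frac{d^2}{dx^2}+q$ is in the limit point case at $\infty$. Let $H_\alpha$, $\alpha\in[0,\pi)$, be the self-adjoint Schrödinger operators in $L^2([0,\infty);dx)$ and $m_0^W$ the Weyl-Titchmarsh $m$-function defined in the context. Let $\alpha\in[0,\pi)$. Then $$\sup_{f\in\mathrm{dom}(H_{\pi/2})}\left(\frac{|f'(0_+)|^2}{\|f\|^2_{L^2([0,\infty);dx)}+\|H_{\pi/2}f\|^2_{L^2([0,\infty);dx)}}\right)=\mathrm{Im}(m_0^W(i)),$$ $$\sup_{f\in\mathrm{dom}(H_\alpha)}\left(\frac{|f(0_+)|^2}{\|f\|^2_{L^2([0,\infty);dx)}+\|H_\alpha f\|^2_{L^2([0,\infty);dx)}}\right)=\frac{\cos^2(\alpha)}{\mathrm{Im}(m_0^W(i))}.$$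
   Context: Suprema are over $f\neq0$. For $z\in\mathbb C\setminus\mathbb R$ let $\psi_0(z,\cdot)$ be the unique solution of $-\psi''+(q-z)\psi=0$ on $(0,\infty)$ with $\psi_0(z,\cdot)\in L^2([0,\infty);dx)$ and $\psi_0(z,0_+)=1$. The Weyl-Titchmarsh function is defined by $\psi_0(z,x)=\theta_0(z,x)+m_0^W(z)\phi_0(z,x)$, where $\theta_0,\phi_0$ solve the same equation with $\theta_0(z,0_+)=\phi_0'(z,0_+)=1$, $\theta_0'(z,0_+)=\phi_0(z,0_+)=0$; i.e. $m_0^W(z)=\psi_0'(z,0_+)$. Let $\dot H$ be the densely defined closed symmetric operator $\dot Hf=-f''+qf$ with domain the set of $g\in L^2([0,\infty);dx)$ with $g,g'\in AC([0,R])$ for all $R>0$, $g(0_+)=g'(0_+)=0$, $-g''+qg\in L^2([0,\infty);dx)$; it has deficiency indices $(1,1)$. Put $u_\pm=\psi_0(\pm i,\cdot)/\|\psi_0(\pm i,\cdot)\|_{L^2([0,\infty);dx)}\in\ker(\dot H^*\mp i)$. For $\alpha\in[0,\pi)$, $H_\alpha$ is the self-adjoint extension of $\dot H$ with $$\mathrm{dom}(H_\alpha)=\{f+c(u_++e^{2i\alpha}u_-)\,|\,f\in\mathrm{dom}(\dot H),\ c\in\mathbb C\},\quad H_\alpha(f+c(u_++e^{2i\alpha}u_-))=\dot Hf+c(iu_+-ie^{2i\alpha}u_-).$$ *)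

theory Defs
  imports "HOL-Analysis.Analysis"
begin

text \<open>
  Functions on \<open>[0,\<infinity>)\<close> are total functions of type \<^typ>\<open>real \<Rightarrow> complex\<close> whose values on the
  negative axis never matter: integrals, limits and derivatives below only look at
  \<^term>\<open>{0::real..}\<close>.  Lebesgue (completed) measurability is used since second derivatives are
  only determined almost everywhere.
\<close>

definition L2 :: "real set \<Rightarrow> (real \<Rightarrow> complex) \<Rightarrow> bool" where
  "L2 S f \<longleftrightarrow> set_borel_measurable lebesgue S f \<and>
     set_integrable lebesgue S (\<lambda>x. (cmod (f x))\<^sup>2)"

definition L2_norm_half_line :: "(real \<Rightarrow> complex) \<Rightarrow> real" where
  "L2_norm_half_line f = sqrt (LINT x:{0..}|lebesgue. (cmod (f x))\<^sup>2)"

definition abs_cont_on :: "real \<Rightarrow> real \<Rightarrow> (real \<Rightarrow> complex) \<Rightarrow> bool" where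
  "abs_cont_on a b f \<longleftrightarrow> (\<forall>\<epsilon>>0. \<exists>\<delta>>0. \<forall>P :: (real \<times> real) set.
     finite P \<and> (\<forall>(s,t)\<in>P. a \<le> s \<and> s < t \<and> t \<le> b) \<and>
     disjoint_family_on (\<lambda>(s,t). {s<..<t}) P \<and> (\<Sum>(s,t)\<in>P. t - s) < \<delta>
     \<longrightarrow> (\<Sum>(s,t)\<in>P. cmod (f t - f s)) < \<epsilon>)"

text \<open>The derivative on \<open>[0,\<infinity>)\<close>: two-sided at \<open>x > 0\<close>, right-sided at \<open>0\<close>.\<close>

definition D :: "(real \<Rightarrow> complex) \<Rightarrow> real \<Rightarrow> complex" where
  "D f x = vector_derivative f (at x within {0..})"

text \<open>\<open>f, f' \<in> AC([0,R])\<close> for all \<open>R > 0\<close>.\<close>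

definition AC2 :: "(real \<Rightarrow> complex) \<Rightarrow> bool" where
  "AC2 f \<longleftrightarrow> (\<forall>x\<ge>0. f differentiable (at x within {0..})) \<and>
     (\<forall>R>0. abs_cont_on 0 R f \<and> abs_cont_on 0 R (D f))"

definition at0 :: "(real \<Rightarrow> complex) \<Rightarrow> complex" where
  "at0 f = Lim (at_right 0) f"

text \<open>For \<open>f\<close> with \<^term>\<open>AC2 f\<close>, \<^term>\<open>D (D f)\<close> is the second derivative at almost every
  \<open>x > 0\<close>; elsewhere its value is immaterial.\<close>

definition schroed :: "(real \<Rightarrow> real) \<Rightarrow> (real \<Rightarrow> complex) \<Rightarrow> real \<Rightarrow> complex" where
  "schroed q f x = - D (D f) x + of_real (q x) * f x"

definition is_solution :: "(real \<Rightarrow> real) \<Rightarrow> complex \<Rightarrow> (real \<Rightarrow> complex) \<Rightarrow> bool" where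
  "is_solution q z u \<longleftrightarrow> AC2 u \<and> (AE x in lebesgue. x > 0 \<longrightarrow> schroed q u x = z * u x)"

text \<open>By Weyl's alternative, either all solutions for every \<open>z\<close> are square integrable near
  \<open>\<infinity>\<close> (limit circle case), or for every \<open>z\<close> some solution is not (limit point case).\<close>

definition limit_point_at_infinity :: "(real \<Rightarrow> real) \<Rightarrow> bool" where
  "limit_point_at_infinity q \<longleftrightarrow>
     (\<forall>z. \<exists>u. is_solution q z u \<and> (\<forall>R\<ge>0. \<not> L2 {R..} u))"

text \<open>The next three functions are unique only on \<open>[0,\<infinity>)\<close>, hence \<open>SOME\<close> rather than \<open>THE\<close>.\<close>

definition psi0 :: "(real \<Rightarrow> real) \<Rightarrow> complex \<Rightarrow> real \<Rightarrow> complex" where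
  "psi0 q z = (SOME u. is_solution q z u \<and> L2 {0..} u \<and> at0 u = 1)"

definition theta0 :: "(real \<Rightarrow> real) \<Rightarrow> complex \<Rightarrow> real \<Rightarrow> complex" where
  "theta0 q z = (SOME u. is_solution q z u \<and> at0 u = 1 \<and> at0 (D u) = 0)"

definition phi0 :: "(real \<Rightarrow> real) \<Rightarrow> complex \<Rightarrow> real \<Rightarrow> complex" where
  "phi0 q z = (SOME u. is_solution q z u \<and> at0 u = 0 \<and> at0 (D u) = 1)"

definition weyl_m :: "(real \<Rightarrow> real) \<Rightarrow> complex \<Rightarrow> complex" where
  "weyl_m q z = (THE m. \<forall>x>0. psi0 q z x = theta0 q z x + m * phi0 q z x)"

definition dom_Hmin :: "(real \<Rightarrow> real) \<Rightarrow> (real \<Rightarrow> complex) set" where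
  "dom_Hmin q = {g. L2 {0..} g \<and> AC2 g \<and> at0 g = 0 \<and> at0 (D g) = 0 \<and> L2 {0..} (schroed q g)}"

definition u_plus :: "(real \<Rightarrow> real) \<Rightarrow> real \<Rightarrow> complex" where
  "u_plus q x = psi0 q \<i> x / of_real (L2_norm_half_line (psi0 q \<i>))"

definition u_minus :: "(real \<Rightarrow> real) \<Rightarrow> real \<Rightarrow> complex" where
  "u_minus q x = psi0 q (- \<i>) x / of_real (L2_norm_half_line (psi0 q (- \<i>)))"

definition dom_H :: "(real \<Rightarrow> real) \<Rightarrow> real \<Rightarrow> (real \<Rightarrow> complex) set" where
  "dom_H q \<alpha> = {\<lambda>x. g x + c * (u_plus q x + exp (2 * \<i> * of_real \<alpha>) * u_minus q x) | g c.
     g \<in> dom_Hmin q}"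

text \<open>The decomposition of an element of \<^term>\<open>dom_H q \<alpha>\<close> is unique, so the description below
  determines the function.\<close>

definition H :: "(real \<Rightarrow> real) \<Rightarrow> real \<Rightarrow> (real \<Rightarrow> complex) \<Rightarrow> real \<Rightarrow> complex" where
  "H q \<alpha> f = (THE h. \<exists>g\<in>dom_Hmin q. \<exists>c.
     f = (\<lambda>x. g x + c * (u_plus q x + exp (2 * \<i> * of_real \<alpha>) * u_minus q x)) \<and>
     h = (\<lambda>x. schroed q g x
            + c * (\<i> * u_plus q x - \<i> * exp (2 * \<i> * of_real \<alpha>) * u_minus q x)))"

text \<open>Nonzero as an element of \<open>L\<^sup>2([0,\<infinity>))\<close>.\<close>

definition nonzero_L2 :: "(real \<Rightarrow> complex) \<Rightarrow> bool" where
  "nonzero_L2 f \<longleftrightarrow> \<not> (AE x in lebesgue. x \<ge> 0 \<longrightarrow> f x = 0)"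

end

theory Submission
  imports Defs
begin

text \<open>
  Write \<open>\<tau> = -d\<^sup>2/dx\<^sup>2 + q\<close>, \<open>\<psi> = \<psi>\<^sub>0(\<i>,\<cdot>)\<close>, \<open>m = \<psi>'(0)\<close>, which is the value of the Weyl-Titchmarsh function
  at \<open>\<i>\<close>, and \<open>N\<close> for the norm of \<open>\<psi>\<close>. Since \<open>q\<close> is real, \<open>u\<^sub>-\<close> is the complex conjugate of \<open>u\<^sub>+ = \<psi> / N\<close>.

  An element of the domain of \<open>H\<^sub>\<alpha>\<close> is \<open>f = g + c (u\<^sub>+ + e u\<^sub>-)\<close> with \<open>e = exp (2 \<i> \<alpha>)\<close> and \<open>g\<close> in the
  minimal domain. The three parts are orthogonal in the graph inner product, so the denominator
  in the theorem is \<open>\<bar>g\<bar>\<^sup>2 + \<bar>\<tau> g\<bar>\<^sup>2 + 4 \<bar>c\<bar>\<^sup>2\<close>, with \<open>L\<^sup>2\<close>-norms of \<open>g\<close> and \<open>\<tau> g\<close>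
  (\<open>graph_norm\<close>). The initial values of \<open>g\<close> vanish, hence
  \<open>f(0) = c (1 + e) / N\<close> and \<open>f'(0) = c (m + e cnj m) / N\<close>. Both quotients are therefore
  largest at \<open>g = 0\<close> (\<open>supremum_of_functional\<close>), where they equal \<open>\<bar>1 + e\<bar>\<^sup>2 / (4 N\<^sup>2) = cos\<^sup>2 \<alpha> / N\<^sup>2\<close>
  and, for \<open>\<alpha> = \<pi>/2\<close>, \<open>\<bar>m - cnj m\<bar>\<^sup>2 / (4 N\<^sup>2) = (Im m)\<^sup>2 / N\<^sup>2\<close>. The theorem follows from \<open>N\<^sup>2 = Im m\<close>
  (\<open>norm_psi_square\<close>).

  The orthogonality and the identity \<open>N\<^sup>2 = Im m\<close> both come from Green's formula on \<open>[0,b]\<close>, provided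
  that the Wronskian of \<open>\<psi>\<close> with a function in the maximal domain that vanishes at \<open>0\<close> tends to
  zero at infinity. This is what the limit point hypothesis gives (\<open>wronskian_tendsto_0\<close>), by
  comparison with functions that vanish at \<open>b\<close>. The existence of \<open>\<psi>\<close> is Weyl's compactness argument (\<open>Weyl_solution_exists\<close>).

  As \<open>q\<close> is merely locally integrable, second derivatives exist only almost everywhere, and all
  of this rests on two facts from real analysis: an absolutely continuous function is
  differentiable almost everywhere and is the integral of its derivative
  (\<open>fundamental_theorem_abs_cont\<close>, by way of the variation, the Radon-Nikodym theorem and Lebesgue
  differentiation), and initial value problems for linear systems with locally integrable
  coefficients are uniquely solvable (\<open>linear_system.existence\<close>, \<open>linear_system.uniqueness\<close>).
\<close>

section \<open>Absolutely continuous functions\<close>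


text \<open>
  The families of intervals that the definition of absolute continuity ranges over; naming them
  lets absolute continuity and variation refer to the same families.
\<close>

definition interval_family :: "real \<Rightarrow> real \<Rightarrow> (real \<times> real) set \<Rightarrow> bool" where
  "interval_family a b P \<longleftrightarrow> finite P \<and> (\<forall>(s,t)\<in>P. a \<le> s \<and> s < t \<and> t \<le> b) \<and>
     disjoint_family_on (\<lambda>(s,t). {s<..<t}) P"

definition increments :: "(real \<Rightarrow> complex) \<Rightarrow> (real \<times> real) set \<Rightarrow> real" where
  "increments f P = (\<Sum>(s,t)\<in>P. cmod (f t - f s))"

definition total_length :: "(real \<times> real) set \<Rightarrow> real" where
  "total_length P = (\<Sum>(s,t)\<in>P. t - s)"

lemma abs_cont_on_iff:
  "abs_cont_on a b f \<longleftrightarrow> (\<forall>\<epsilon>>0. \<exists>\<delta>>0. \<forall>P. interval_family a b P \<and> total_length P < \<delta>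
     \<longrightarrow> increments f P < \<epsilon>)"
  unfolding abs_cont_on_def interval_family_def increments_def total_length_def by simp

lemma abs_cont_onE:
  assumes "abs_cont_on a b f" "\<epsilon> > 0"
  obtains \<delta> where "\<delta> > 0" "\<And>P. interval_family a b P \<Longrightarrow> total_length P < \<delta> \<Longrightarrow> increments f P < \<epsilon>"
  using assms unfolding abs_cont_on_iff by blast

lemma interval_familyD:
  assumes "interval_family a b P" "(s,t) \<in> P"
  shows "a \<le> s" "s < t" "t \<le> b"
  using assms by (auto simp: interval_family_def)

lemma interval_family_disjoint:
  assumes "interval_family a b P" "(s,t) \<in> P" "(s',t') \<in> P" "(s,t) \<noteq> (s',t')"
  shows "t \<le> s' \<or> t' \<le> s"
proof (rule ccontr)
  assume n: "\<not> ?thesis"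
  have st: "s < t" "s' < t'" using assms interval_familyD by blast+
  have "{s<..<t} \<inter> {s'<..<t'} = {}"
    using assms unfolding interval_family_def disjoint_family_on_def by fastforce
  moreover have "(max s s' + min t t') / 2 \<in> {s<..<t} \<inter> {s'<..<t'}"
    using n st by (auto simp: max_def min_def)
  ultimately show False by blast
qed

lemma interval_family_pair:
  assumes P: "interval_family a b P" and p: "p \<in> P"
  shows "a \<le> fst p" "fst p < snd p" "snd p \<le> b"
    "p' \<in> P \<Longrightarrow> p \<noteq> p' \<Longrightarrow> snd p \<le> fst p' \<or> snd p' \<le> fst p"
  using interval_familyD[OF P, of "fst p" "snd p"] p
    interval_family_disjoint[OF P, of "fst p" "snd p" "fst p'" "snd p'"] by auto

lemma interval_familyI:
  assumes "finite P" "\<And>s t. (s,t) \<in> P \<Longrightarrow> a \<le> s \<and> s < t \<and> t \<le> b"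
    and "\<And>s t s' t'. (s,t) \<in> P \<Longrightarrow> (s',t') \<in> P \<Longrightarrow> (s,t) \<noteq> (s',t') \<Longrightarrow> t \<le> s' \<or> t' \<le> s"
  shows "interval_family a b P"
  unfolding interval_family_def disjoint_family_on_def
proof (intro conjI ballI impI)
  fix p p' assume "p \<in> P" "p' \<in> P" "p \<noteq> p'"
  then show "(case p of (s,t) \<Rightarrow> {s<..<t}) \<inter> (case p' of (s,t) \<Rightarrow> {s<..<t}) = {}"
    using assms(3)[of "fst p" "snd p" "fst p'" "snd p'"] by (cases p; cases p') fastforce
qed (use assms in auto)

lemma interval_family_mono:
  "interval_family a b P \<Longrightarrow> a' \<le> a \<Longrightarrow> b \<le> b' \<Longrightarrow> interval_family a' b' P"
  by (fastforce simp: interval_family_def)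

lemma interval_family_singleton: "a \<le> s \<Longrightarrow> s < t \<Longrightarrow> t \<le> b \<Longrightarrow> interval_family a b {(s,t)}"
  by (auto intro!: interval_familyI)

lemma abs_cont_on_subset:
  "abs_cont_on a b f \<Longrightarrow> a \<le> a' \<Longrightarrow> b' \<le> b \<Longrightarrow> abs_cont_on a' b' f"
  unfolding abs_cont_on_iff by (meson interval_family_mono)

text \<open>
  The closure properties of absolute continuity below are instances of this comparison of
  increments.
\<close>

lemma abs_cont_on_dominated:
  assumes f: "abs_cont_on a b f" and g: "abs_cont_on a b g"
    and h: "\<And>s t. a \<le> s \<Longrightarrow> s < t \<Longrightarrow> t \<le> b \<Longrightarrow>
      cmod (h t - h s) \<le> K * (cmod (f t - f s) + cmod (g t - g s))"
  shows "abs_cont_on a b h"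
  unfolding abs_cont_on_iff
proof (intro allI impI)
  fix e :: real assume "e > 0"
  define K' where "K' = max K 1"
  have K': "K' > 0" "K \<le> K'" by (auto simp: K'_def)
  have e': "e / (2 * K') > 0" using \<open>e > 0\<close> K' by simp
  obtain d1 where d1: "d1 > 0" "\<And>P. interval_family a b P \<Longrightarrow> total_length P < d1 \<Longrightarrow> increments f P < e / (2 * K')"
    using abs_cont_onE[OF f e'] by blast
  obtain d2 where d2: "d2 > 0" "\<And>P. interval_family a b P \<Longrightarrow> total_length P < d2 \<Longrightarrow> increments g P < e / (2 * K')"
    using abs_cont_onE[OF g e'] by blast
  show "\<exists>\<delta>>0. \<forall>P. interval_family a b P \<and> total_length P < \<delta> \<longrightarrow> increments h P < e"
  proof (intro exI[of _ "min d1 d2"] conjI allI impI)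
    fix P assume P: "interval_family a b P \<and> total_length P < min d1 d2"
    have "increments h P \<le> (\<Sum>(s,t)\<in>P. K' * (cmod (f t - f s) + cmod (g t - g s)))"
      unfolding increments_def
    proof (rule sum_mono, clarify)
      fix s t assume "(s,t) \<in> P"
      then have "cmod (h t - h s) \<le> K * (cmod (f t - f s) + cmod (g t - g s))"
        using h interval_familyD P by blast
      also have "\<dots> \<le> K' * (cmod (f t - f s) + cmod (g t - g s))"
        using K' by (intro mult_right_mono) auto
      finally show "cmod (h t - h s) \<le> K' * (cmod (f t - f s) + cmod (g t - g s))" .
    qed
    also have "\<dots> = K' * (increments f P + increments g P)"
      by (simp add: increments_def sum.distrib sum_distrib_left case_prod_beta distrib_left)
    also have "\<dots> < K' * (e / (2 * K') + e / (2 * K'))"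
      using d1(2)[of P] d2(2)[of P] P K' by (intro mult_strict_left_mono add_strict_mono) auto
    also have "\<dots> = e" using K' by simp
    finally show "increments h P < e" .
  qed (use d1 d2 in auto)
qed

lemma abs_cont_on_of_real: "abs_cont_on a b of_real"
  unfolding abs_cont_on_iff
proof (intro allI impI)
  fix e :: real assume "e > 0"
  have "increments complex_of_real P = total_length P" if "interval_family a b P" for P
    unfolding increments_def total_length_def
    by (rule sum.cong) (use that in \<open>auto simp: interval_family_def norm_of_real simp flip: of_real_diff\<close>)
  then show "\<exists>\<delta>>0. \<forall>P. interval_family a b P \<and> total_length P < \<delta> \<longrightarrow> increments of_real P < e"
    using \<open>e > 0\<close> by auto
qed

lemma abs_cont_on_lipschitz:
  assumes "\<And>s t. a \<le> s \<Longrightarrow> s < t \<Longrightarrow> t \<le> b \<Longrightarrow> cmod (h t - h s) \<le> L * (t - s)"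
  shows "abs_cont_on a b h"
proof (rule abs_cont_on_dominated[OF abs_cont_on_of_real abs_cont_on_of_real, where K = "L/2"])
  fix s t assume st: "a \<le> s" "s < t" "t \<le> b"
  then have eq: "cmod (of_real t - of_real s) = t - s"
    by (simp flip: of_real_diff)
  show "cmod (h t - h s) \<le> L / 2 * (cmod (of_real t - of_real s) + cmod (of_real t - of_real s))"
    unfolding eq by (rule order_trans[OF assms[OF st]]) (simp add: field_simps)
qed

lemma abs_cont_on_imp_continuous_on:
  assumes "abs_cont_on a b f"
  shows "continuous_on {a..b} f"
  unfolding continuous_on_iff
proof (intro ballI allI impI)
  fix x e :: real assume x: "x \<in> {a..b}" and "e > 0"
  then obtain d where d: "d > 0" "\<And>P. interval_family a b P \<Longrightarrow> total_length P < d \<Longrightarrow> increments f P < e"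
    using assms unfolding abs_cont_on_iff by blast
  have *: "dist (f t) (f s) < e" if "a \<le> s" "s < t" "t \<le> b" "t - s < d" for s t
    using d(2)[OF interval_family_singleton[OF that(1-3)]] that
    by (simp add: total_length_def increments_def dist_norm)
  have "dist (f y) (f x) < e" if "y \<in> {a..b}" "dist y x < d" for y
  proof (cases y x rule: linorder_cases)
    case less
    then show ?thesis using *[of y x] that x by (auto simp: dist_commute dist_real_def)
  next
    case greater
    then show ?thesis using *[of x y] that x by (auto simp: dist_real_def)
  qed (use \<open>e > 0\<close> in simp)
  then show "\<exists>d>0. \<forall>x'\<in>{a..b}. dist x' x < d \<longrightarrow> dist (f x') (f x) < e"
    using d(1) by blast
qed

lemma abs_cont_on_add:
  "abs_cont_on a b f \<Longrightarrow> abs_cont_on a b g \<Longrightarrow> abs_cont_on a b (\<lambda>x. f x + g x)"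
  by (erule (1) abs_cont_on_dominated[where K = 1])
     (metis add_diff_add mult_1 norm_triangle_ineq)

lemma abs_cont_on_bounded:
  assumes "abs_cont_on a b f"
  obtains B where "B > 0" "\<And>x. x \<in> {a..b} \<Longrightarrow> cmod (f x) \<le> B"
proof -
  have "bounded (f ` {a..b})"
    by (intro compact_imp_bounded compact_continuous_image abs_cont_on_imp_continuous_on assms compact_Icc)
  then show ?thesis using that unfolding bounded_pos by auto
qed

lemma abs_cont_on_mult:
  assumes f: "abs_cont_on a b f" and g: "abs_cont_on a b g"
  shows "abs_cont_on a b (\<lambda>x. f x * g x)"
proof -
  obtain F where F: "\<And>x. x \<in> {a..b} \<Longrightarrow> cmod (f x) \<le> F" using abs_cont_on_bounded[OF f] by metis
  obtain G where G: "\<And>x. x \<in> {a..b} \<Longrightarrow> cmod (g x) \<le> G" using abs_cont_on_bounded[OF g] by metis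
  show ?thesis
  proof (rule abs_cont_on_dominated[OF f g, where K = "max F G"])
    fix s t assume st: "a \<le> s" "s < t" "t \<le> b"
    have "f t * g t - f s * g s = (f t - f s) * g t + f s * (g t - g s)"
      by (simp add: algebra_simps)
    then have "cmod (f t * g t - f s * g s) \<le> cmod (f t - f s) * cmod (g t) + cmod (f s) * cmod (g t - g s)"
      by (metis norm_mult norm_triangle_ineq)
    also have "\<dots> \<le> cmod (f t - f s) * max F G + max F G * cmod (g t - g s)"
      using F[of s] G[of t] st by (intro add_mono mult_left_mono mult_right_mono) auto
    finally show "cmod (f t * g t - f s * g s) \<le> max F G * (cmod (f t - f s) + cmod (g t - g s))"
      by (simp add: algebra_simps)
  qed
qed

lemma abs_cont_on_const: "abs_cont_on a b (\<lambda>x. c)"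
  by (rule abs_cont_on_lipschitz[where L = 0]) auto

lemma abs_cont_on_compose_lipschitz:
  assumes "abs_cont_on a b f"
    and "\<And>x y. x \<in> {a..b} \<Longrightarrow> y \<in> {a..b} \<Longrightarrow> cmod (h (f x) - h (f y)) \<le> L * cmod (f x - f y)"
  shows "abs_cont_on a b (\<lambda>x. h (f x))"
  by (rule abs_cont_on_dominated[OF assms(1) assms(1), where K = "L/2"]) (use assms(2) in auto)

lemma abs_cont_on_cnj: "abs_cont_on a b f \<Longrightarrow> abs_cont_on a b (\<lambda>x. cnj (f x))"
  by (rule abs_cont_on_compose_lipschitz[where L = 1])
     (simp_all add: complex_cnj_diff[symmetric] del: complex_cnj_diff)

text \<open>
  The indicator functions of disjoint intervals add up to at most \<open>1\<close>.
\<close>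

lemma sum_integral_interval_family_le:
  fixes h :: "real \<Rightarrow> real"
  assumes P: "interval_family a b P" and h: "h integrable_on {a..b}" "\<And>x. x \<in> {a..b} \<Longrightarrow> 0 \<le> h x"
  shows "(\<Sum>(s,t)\<in>P. integral {s..t} h) \<le> integral {a..b} h"
proof -
  let ?g = "\<lambda>p x. if x \<in> {fst p<..<snd p} then h x else 0"
  have fin: "finite P" using P by (simp add: interval_family_def)
  have sub: "{fst p..snd p} \<subseteq> {a..b}" if "p \<in> P" for p
    using interval_familyD[OF P, of "fst p" "snd p"] that by auto
  have hi: "(?g p has_integral integral {fst p..snd p} h) {a..b}" if "p \<in> P" for p
  proof -
    have "h integrable_on {fst p..snd p}" using h(1) sub[OF that] integrable_on_subinterval by blast
    then have "(h has_integral integral {fst p..snd p} h) {fst p<..<snd p}"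
      by (simp add: has_integral_Icc_iff_Ioo[symmetric] integrable_integral)
    then show ?thesis
      using has_integral_restrict[of "{fst p<..<snd p}" "{a..b}" h] sub[OF that]
      by (auto simp: subset_iff)
  qed
  have "((\<lambda>x. \<Sum>p\<in>P. ?g p x) has_integral (\<Sum>p\<in>P. integral {fst p..snd p} h)) {a..b}"
    by (intro has_integral_sum fin hi)
  moreover have "(\<Sum>p\<in>P. ?g p x) \<le> h x" if x: "x \<in> {a..b}" for x
  proof (cases "\<exists>p\<in>P. x \<in> {fst p<..<snd p}")
    case True
    then obtain p where p: "p \<in> P" "x \<in> {fst p<..<snd p}" by blast
    have "?g p' x = 0" if "p' \<in> P - {p}" for p'
      using interval_family_disjoint[OF P, of "fst p" "snd p" "fst p'" "snd p'"] p that
      by (cases p; cases p') auto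
    then have "(\<Sum>p\<in>P. ?g p x) = ?g p x"
      using sum.remove[OF fin p(1), of "\<lambda>p. ?g p x"] by (simp add: sum.neutral)
    then show ?thesis using p by simp
  next
    case False
    then have "(\<Sum>p\<in>P. ?g p x) = 0" by (intro sum.neutral) auto
    then show ?thesis using h(2) x by simp
  qed
  ultimately have "(\<Sum>p\<in>P. integral {fst p..snd p} h) \<le> integral {a..b} h"
    using has_integral_le h(1) integrable_integral by meson
  then show ?thesis by (simp add: case_prod_beta)
qed

lemma total_length_le:
  assumes "interval_family a b P" "a \<le> b"
  shows "total_length P \<le> b - a"
proof -
  have "(\<Sum>(s,t)\<in>P. integral {s..t} (\<lambda>_. 1::real)) \<le> integral {a..b} (\<lambda>_. 1)"
    by (rule sum_integral_interval_family_le[OF assms(1)]) auto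
  moreover have "(\<Sum>(s,t)\<in>P. integral {s..t} (\<lambda>_. 1::real)) = total_length P"
    unfolding total_length_def
    by (rule sum.cong) (use assms in \<open>auto simp: interval_family_def\<close>)
  ultimately show ?thesis using assms(2) by simp
qed

text \<open>
  Cut \<open>\<bar>f\<bar>\<close> off at height \<open>n\<close>: the part above contributes little in total by dominated
  convergence, and the part below at most \<open>n\<close> times the total length.
\<close>

lemma abs_cont_on_integral:
  fixes f :: "real \<Rightarrow> complex"
  assumes f: "f absolutely_integrable_on {a..b}"
  shows "abs_cont_on a b (\<lambda>x. integral {a..x} f)"
  unfolding abs_cont_on_iff
proof (intro allI impI)
  fix e :: real assume "e > 0"
  define k where "k = (\<lambda>x. cmod (f x))"
  define r where "r = (\<lambda>n x. k x - min (k x) (real n))"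
  have k: "k absolutely_integrable_on {a..b}" unfolding k_def using f by (rule absolutely_integrable_norm[unfolded o_def])
  have ki: "k integrable_on {a..b}" using k absolutely_integrable_on_def by blast
  have c: "(\<lambda>x. real n) absolutely_integrable_on {a..b}" for n
    by (rule absolutely_integrable_continuous_real) simp
  have mi: "(\<lambda>x. min (k x) (real n)) integrable_on {a..b}" for n
    using absolutely_integrable_min_1[OF k c] absolutely_integrable_on_def by blast
  have ri: "r n integrable_on {a..b}" for n
    unfolding r_def by (intro integrable_diff ki mi)
  have r0: "r n x \<ge> 0" for n x by (simp add: r_def)
  have "(\<lambda>n. integral {a..b} (r n)) \<longlonglongrightarrow> integral {a..b} (\<lambda>x. 0)"
  proof (rule dominated_convergence(2)[where h = k])
    fix x assume "x \<in> {a..b}"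
    have "eventually (\<lambda>n. r n x = 0) sequentially"
      using eventually_ge_at_top[of "nat \<lceil>k x\<rceil>"]
    proof eventually_elim
      case (elim n)
      then have "k x \<le> real n" by linarith
      then show ?case by (simp add: r_def)
    qed
    then show "(\<lambda>n. r n x) \<longlonglongrightarrow> 0" by (simp add: tendsto_eventually)
  next
    show "norm (r n x) \<le> k x" for n x by (simp add: r_def k_def)
  qed (use ri ki in auto)
  then have "eventually (\<lambda>n. integral {a..b} (r n) < e / 2) sequentially"
    using \<open>e > 0\<close> by (intro order_tendstoD(2)) auto
  then obtain n where n: "integral {a..b} (r n) < e / 2"
    by (auto simp: eventually_sequentially)
  show "\<exists>\<delta>>0. \<forall>P. interval_family a b P \<and> total_length P < \<delta> \<longrightarrow>
      increments (\<lambda>x. integral {a..x} f) P < e"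
  proof (intro exI[of _ "e / (2 * (real n + 1))"] conjI allI impI)
    fix P assume "interval_family a b P \<and> total_length P < e / (2 * (real n + 1))"
    then have P: "interval_family a b P" and L: "total_length P < e / (2 * (real n + 1))" by auto
    have tl0: "total_length P \<ge> 0"
      unfolding total_length_def using interval_familyD(2)[OF P] by (intro sum_nonneg) (auto intro: less_imp_le)
    have "cmod (integral {a..t} f - integral {a..s} f) \<le> integral {s..t} (r n) + real n * (t - s)"
      if "(s,t) \<in> P" for s t
    proof -
      note st = interval_familyD[OF P that]
      have fi: "f integrable_on {a..t}"
        using f st absolutely_integrable_on_def integrable_on_subinterval
        by (metis atLeastatMost_subset_iff order_refl)
      have "integral {a..t} f - integral {a..s} f = integral {s..t} f"
        using Henstock_Kurzweil_Integration.integral_combine[OF _ _ fi, of s] st by (simp add: algebra_simps)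
      also have "cmod \<dots> \<le> integral {s..t} (\<lambda>x. r n x + real n)"
      proof (rule integral_norm_bound_integral)
        show "f integrable_on {s..t}"
          using fi integrable_on_subinterval st by (metis atLeastatMost_subset_iff order_refl less_imp_le)
        show "(\<lambda>x. r n x + real n) integrable_on {s..t}"
          by (intro integrable_add integrable_on_subinterval[OF ri[of n]]) (use st in auto)
        show "norm (f x) \<le> r n x + real n" for x by (auto simp: r_def k_def)
      qed
      also have "\<dots> = integral {s..t} (r n) + real n * (t - s)"
        using ri[of n] st integrable_on_subinterval[of "r n" "{a..b}" s t]
        by (subst integral_add) auto
      finally show ?thesis .
    qed
    then have "increments (\<lambda>x. integral {a..x} f) P \<le> (\<Sum>(s,t)\<in>P. integral {s..t} (r n) + real n * (t - s))"
      unfolding increments_def by (intro sum_mono) auto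
    also have "\<dots> = (\<Sum>(s,t)\<in>P. integral {s..t} (r n)) + real n * total_length P"
      by (simp add: total_length_def case_prod_beta sum.distrib sum_distrib_left)
    also have "\<dots> < e / 2 + e / 2"
    proof (rule add_less_le_mono)
      show "(\<Sum>(s,t)\<in>P. integral {s..t} (r n)) < e / 2"
        using sum_integral_interval_family_le[OF P ri[of n] r0] n by linarith
      have "real n * total_length P \<le> (real n + 1) * total_length P"
        using tl0 by (simp add: mult_right_mono)
      also have "\<dots> \<le> (real n + 1) * (e / (2 * (real n + 1)))"
        using L by (intro mult_left_mono) auto
      also have "\<dots> = e / 2"
      proof -
        have "real n + 1 \<noteq> 0" by simp
        then show ?thesis by (simp add: field_simps)
      qed
      finally show "real n * total_length P \<le> e / 2" .
    qed
    finally show "increments (\<lambda>x. integral {a..x} f) P < e" by simp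
  qed (use \<open>e > 0\<close> in auto)
qed

section \<open>Lebesgue's differentiation theorem\<close>

text \<open>
  Averages over small intervals to the right of \<open>x\<close> tend to \<open>f x\<close> for almost every \<open>x\<close>;
  reflecting \<open>f\<close> gives the same for intervals to the left, and together these are the
  two-sided derivative.
\<close>

lemma Lebesgue_differentiation:
  fixes f :: "real \<Rightarrow> complex"
  assumes f: "f absolutely_integrable_on {a..b}"
  obtains N where "negligible N"
    "\<And>x. x \<in> {a<..<b} - N \<Longrightarrow> ((\<lambda>x. integral {a..x} f) has_vector_derivative f x) (at x)"
proof -
  define g where "g = (\<lambda>x. if x \<in> {a..b} then f x else 0)"
  have gU: "g integrable_on UNIV"
    unfolding g_def using f absolutely_integrable_on_def integrable_restrict_UNIV by blast
  have gi: "g integrable_on cbox c d" for c d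
    using integrable_on_subcbox[OF gU] by blast
  have gi': "(\<lambda>x. g (- x)) integrable_on cbox c d" for c d
    using gi[of "-d" "-c"] Henstock_Kurzweil_Integration.integrable_reflect_real[where f=g and a="-d" and b="-c"] by simp
  obtain N1 where N1: "negligible N1" "\<And>x e. \<lbrakk>x \<notin> N1; 0 < e\<rbrakk> \<Longrightarrow> \<exists>d>0. \<forall>h. 0 < h \<and> h < d \<longrightarrow>
      cmod (integral (cbox x (x + h *\<^sub>R One)) g /\<^sub>R h ^ DIM(real) - g x) < e"
    using integrable_ccontinuous_explicit[OF gi] by blast
  obtain N2 where N2: "negligible N2" "\<And>x e. \<lbrakk>x \<notin> N2; 0 < e\<rbrakk> \<Longrightarrow> \<exists>d>0. \<forall>h. 0 < h \<and> h < d \<longrightarrow>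
      cmod (integral (cbox x (x + h *\<^sub>R One)) (\<lambda>x. g (- x)) /\<^sub>R h ^ DIM(real) - g (- x)) < e"
    using integrable_ccontinuous_explicit[OF gi'] by blast
  show ?thesis
  proof (rule that)
    show "negligible (N1 \<union> uminus ` N2)"
      using N1(1) N2(1)
      by (intro negligible_Un negligible_differentiable_image_negligible)
         (auto intro!: derivative_intros simp: differentiable_on_def)
    fix x assume x: "x \<in> {a<..<b} - (N1 \<union> uminus ` N2)"
    then have x2: "- x \<notin> N2" by force
    have gf: "g x = f x" using x by (simp add: g_def)
    have Fg: "integral {c..d} f = integral {c..d} g" if "a \<le> c" "d \<le> b" for c d
      by (rule integral_cong) (use that in \<open>auto simp: g_def\<close>)
    have fi: "f integrable_on {a..b}" using f absolutely_integrable_on_def by blast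
    show "((\<lambda>x. integral {a..x} f) has_vector_derivative f x) (at x)"
      unfolding has_vector_derivative_def has_derivative_at_alt
    proof (intro conjI allI impI)
      fix e :: real assume "e > 0"
      obtain d1 where d1: "d1 > 0" "\<And>h. 0 < h \<Longrightarrow> h < d1 \<Longrightarrow>
          cmod (integral {x..x + h} g /\<^sub>R h - f x) < e"
        using N1(2)[of x e] x \<open>e > 0\<close> gf by auto
      obtain d2 where d2: "d2 > 0" "\<And>h. 0 < h \<Longrightarrow> h < d2 \<Longrightarrow>
          cmod (integral {- x..- x + h} (\<lambda>x. g (- x)) /\<^sub>R h - f x) < e"
        using N2(2)[of "- x" e] x2 \<open>e > 0\<close> gf by auto
      define d where "d = min (min d1 d2) (min (x - a) (b - x))"
      have scale: "cmod (I - h *\<^sub>R f x) \<le> e * h" if "h > 0" "cmod (I /\<^sub>R h - f x) < e" for I h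
      proof -
        have "I - h *\<^sub>R f x = h *\<^sub>R (I /\<^sub>R h - f x)" using that by (simp add: algebra_simps)
        then have "cmod (I - h *\<^sub>R f x) = h * cmod (I /\<^sub>R h - f x)" using that by simp
        also have "\<dots> \<le> h * e" using that by (intro mult_left_mono) auto
        finally show ?thesis by (simp add: mult.commute)
      qed
      show "\<exists>d>0. \<forall>y. norm (y - x) < d \<longrightarrow>
          cmod (integral {a..y} f - integral {a..x} f - (y - x) *\<^sub>R f x) \<le> e * norm (y - x)"
      proof (intro exI[of _ d] conjI allI impI)
        show "d > 0" using d1 d2 x by (auto simp: d_def)
        fix y assume y: "norm (y - x) < d"
        then have yab: "a \<le> y" "y \<le> b" using x by (auto simp: d_def)
        show "cmod (integral {a..y} f - integral {a..x} f - (y - x) *\<^sub>R f x) \<le> e * norm (y - x)"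
        proof (cases x y rule: linorder_cases)
          case less
          have "integral {a..x} f + integral {x..y} f = integral {a..y} f"
            by (rule Henstock_Kurzweil_Integration.integral_combine) (use less x yab in \<open>auto intro!: integrable_on_subinterval[OF fi]\<close>)
          moreover have "cmod (integral {x..y} g - (y - x) *\<^sub>R f x) \<le> e * (y - x)"
            using less y d1(2)[of "y - x"] by (intro scale) (auto simp: d_def)
          moreover have "integral {x..y} f = integral {x..y} g" using Fg[of x y] x yab by simp
          ultimately have "integral {a..y} f - integral {a..x} f = integral {x..y} g"
            by (metis add_diff_cancel_left')
          then show ?thesis
            using \<open>cmod (integral {x..y} g - (y - x) *\<^sub>R f x) \<le> e * (y - x)\<close> less by simp
        next
          case greater
          have "integral {a..y} f + integral {y..x} f = integral {a..x} f"
            by (rule Henstock_Kurzweil_Integration.integral_combine) (use greater x yab in \<open>auto intro!: integrable_on_subinterval[OF fi]\<close>)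
          moreover have "integral {- x..- x + (x - y)} (\<lambda>x. g (- x)) = integral {y..x} g"
            using Henstock_Kurzweil_Integration.integral_reflect_real[where f=g and a=y and b=x] by simp
          then have "cmod (integral {y..x} g - (x - y) *\<^sub>R f x) \<le> e * (x - y)"
            using greater y d2(2)[of "x - y"] by (intro scale) (auto simp: d_def)
          moreover have "integral {y..x} f = integral {y..x} g" using Fg[of y x] x yab by simp
          ultimately have "integral {a..y} f - integral {a..x} f - (y - x) *\<^sub>R f x =
              - (integral {y..x} g - (x - y) *\<^sub>R f x)"
            by (simp add: algebra_simps flip: \<open>integral {a..y} f + integral {y..x} f = integral {a..x} f\<close>)
          then have "cmod (integral {a..y} f - integral {a..x} f - (y - x) *\<^sub>R f x) =
              cmod (integral {y..x} g - (x - y) *\<^sub>R f x)"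
            by (metis norm_minus_cancel)
          then show ?thesis
            using \<open>cmod (integral {y..x} g - (x - y) *\<^sub>R f x) \<le> e * (x - y)\<close> greater by simp
        qed simp
      qed
    qed (auto simp: bounded_linear_scaleR_left)
  qed
qed

section \<open>The variation of an absolutely continuous function\<close>

definition variation :: "(real \<Rightarrow> complex) \<Rightarrow> real \<Rightarrow> real \<Rightarrow> real" where
  "variation f a b = (SUP P\<in>{P. interval_family a b P}. increments f P)"

lemma interval_family_empty: "interval_family a b {}"
  by (auto intro!: interval_familyI)

text \<open>
  Shrinking intervals keeps them from overlapping; as they stay nondegenerate, no two of them
  can become equal.
\<close>

lemma interval_family_shrink:
  assumes P: "interval_family a b P" and sub: "Q \<subseteq> P"
    and h: "\<And>p. p \<in> Q \<Longrightarrow> fst p \<le> fst (h p) \<and> snd (h p) \<le> snd p"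
    and lohi: "\<And>p. p \<in> Q \<Longrightarrow> lo \<le> fst (h p) \<and> fst (h p) < snd (h p) \<and> snd (h p) \<le> hi"
  shows "interval_family lo hi (h ` Q)" "inj_on h Q"
proof -
  have disj: "snd (h p) \<le> fst (h p') \<or> snd (h p') \<le> fst (h p)" if "p \<in> Q" "p' \<in> Q" "p \<noteq> p'" for p p'
  proof -
    have "p \<in> P" "p' \<in> P" using that sub by auto
    then show ?thesis using interval_family_pair(4)[of a b P p p'] P that(3) h[OF that(1)] h[OF that(2)] by linarith
  qed
  show "interval_family lo hi (h ` Q)"
  proof (rule interval_familyI)
    show "finite (h ` Q)" using P sub by (auto simp: interval_family_def intro: finite_subset)
    show "lo \<le> s \<and> s < t \<and> t \<le> hi" if st: "(s,t) \<in> h ` Q" for s t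
    proof -
      obtain p where "p \<in> Q" "h p = (s,t)" using st by auto
      then show ?thesis using lohi[of p] by simp
    qed
    show "t \<le> s' \<or> t' \<le> s" if st: "(s,t) \<in> h ` Q" "(s',t') \<in> h ` Q" "(s,t) \<noteq> (s',t')" for s t s' t'
    proof -
      obtain p where p: "p \<in> Q" "h p = (s,t)" using st(1) by auto
      obtain p' where p': "p' \<in> Q" "h p' = (s',t')" using st(2) by auto
      have "p \<noteq> p'" using p p' st(3) by auto
      then show ?thesis using disj[OF p(1) p'(1)] p p' by simp
    qed
  qed
  show "inj_on h Q"
  proof (rule inj_onI, rule ccontr)
    fix p p' assume "p \<in> Q" "p' \<in> Q" "h p = h p'" "p \<noteq> p'"
    then show False using disj[of p p'] lohi[of p] lohi[of p'] by auto
  qed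
qed

text \<open>
  An interval of the family that contains \<open>c\<close> is cut into two; by the triangle inequality this
  only increases the sum of increments.
\<close>

lemma interval_family_split:
  assumes P: "interval_family a b P" and c: "a \<le> c" "c \<le> b"
  obtains Q R where "interval_family a c Q" "interval_family c b R"
    "increments f P \<le> increments f Q + increments f R"
proof -
  define P1 where "P1 = {p\<in>P. fst p < c}"
  define P2 where "P2 = {p\<in>P. c < snd p}"
  define l where "l = (\<lambda>p. (fst p :: real, min (snd p) c))"
  define r where "r = (\<lambda>p. (max (fst p) c, snd p :: real))"
  have fin: "finite P" using P by (simp add: interval_family_def)
  note PD = interval_family_pair(1-3)[OF P]
  have l: "fst p \<le> fst (l p) \<and> snd (l p) \<le> snd p"
    "a \<le> fst (l p) \<and> fst (l p) < snd (l p) \<and> snd (l p) \<le> c" if "p \<in> P1" for p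
    using that PD[of p] by (auto simp: l_def P1_def)
  have r: "fst p \<le> fst (r p) \<and> snd (r p) \<le> snd p"
    "c \<le> fst (r p) \<and> fst (r p) < snd (r p) \<and> snd (r p) \<le> b" if "p \<in> P2" for p
    using that PD[of p] by (auto simp: r_def P2_def)
  have "P1 \<subseteq> P" "P2 \<subseteq> P" by (auto simp: P1_def P2_def)
  note L = interval_family_shrink[OF P \<open>P1 \<subseteq> P\<close> l] and R = interval_family_shrink[OF P \<open>P2 \<subseteq> P\<close> r]
  define i where "i = (\<lambda>p. cmod (f (snd p) - f (fst p)))"
  have "increments f P = (\<Sum>p\<in>P. i p)"
    by (simp add: increments_def case_prod_beta i_def)
  also have "\<dots> \<le> (\<Sum>p\<in>P. (if fst p < c then i (l p) else 0) + (if c < snd p then i (r p) else 0))"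
  proof (rule sum_mono)
    fix p assume "p \<in> P"
    show "i p \<le> (if fst p < c then i (l p) else 0) + (if c < snd p then i (r p) else 0)"
    proof (cases "fst p < c \<and> c < snd p")
      case True
      then have "l p = (fst p, c)" "r p = (c, snd p)" by (auto simp: l_def r_def)
      then show ?thesis using True norm_triangle_ineq[of "f (snd p) - f c" "f c - f (fst p)"]
        by (simp add: i_def)
    next
      case False
      then show ?thesis using PD[OF \<open>p \<in> P\<close>] by (auto simp: l_def r_def i_def min_def max_def)
    qed
  qed
  also have "\<dots> = (\<Sum>p\<in>P1. i (l p)) + (\<Sum>p\<in>P2. i (r p))"
    unfolding P1_def P2_def sum.distrib by (simp add: sum.inter_filter[OF fin])
  also have "\<dots> = increments f (l ` P1) + increments f (r ` P2)"
    by (simp add: increments_def case_prod_beta sum.reindex[OF L(2)] sum.reindex[OF R(2)] i_def)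
  finally show ?thesis using that L(1) R(1) by blast
qed

text \<open>
  On an interval shorter than the \<open>\<delta>\<close> that belongs to \<open>\<epsilon> = 1\<close> the increments sum to at most
  \<open>1\<close>, and finitely many such intervals cover \<open>[a,b]\<close>.
\<close>

lemma abs_cont_on_bounded_variation:
  assumes f: "abs_cont_on a b f"
  shows "bdd_above (increments f ` {P. interval_family a b P})"
proof (cases "a \<le> b")
  case False
  then have "{P. interval_family a b P} \<subseteq> {{}}"
    by (fastforce simp: interval_family_def)
  then show ?thesis by (meson bdd_above.unfold bdd_above_finite finite.simps finite_imageI finite_subset)
next
  case True
  obtain d where d: "d > 0" "\<And>P. interval_family a b P \<Longrightarrow> total_length P < d \<Longrightarrow> increments f P < 1"
    using abs_cont_onE[OF f zero_less_one] by blast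
  have *: "increments f P \<le> real n" if "interval_family a c P" "a \<le> c" "c \<le> b" "c - a < real n * d" for n c P
    using that
  proof (induction n arbitrary: c P)
    case 0
    then show ?case by simp
  next
    case (Suc n)
    show ?case
    proof (cases "c - a < d")
      case True
      then have "total_length P < d" using total_length_le[OF Suc.prems(1,2)] by simp
      then have "increments f P < 1"
        using d(2) Suc.prems interval_family_mono by blast
      then show ?thesis by simp
    next
      case False
      \<comment> \<open>The slack in the strict bound on \<open>c - a\<close> is shared evenly by the two parts.\<close>
      define c' where "c' = c - d + (real (Suc n) * d - (c - a)) / 2"
      have nd: "real (Suc n) * d = real n * d + d" by (simp add: algebra_simps)
      have c': "a \<le> c'" "c' - a < real n * d"
        using False Suc.prems(4) unfolding c'_def nd by (simp_all add: field_simps)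
      show ?thesis
      proof (cases "c' \<le> c")
        case True
        obtain Q R where QR: "interval_family a c' Q" "interval_family c' c R"
          "increments f P \<le> increments f Q + increments f R"
          using interval_family_split[OF Suc.prems(1) c'(1) True] by metis
        have "c - c' < d" using Suc.prems(4) unfolding c'_def by (simp add: field_simps)
        then have "total_length R < d" using total_length_le[OF QR(2) True] by simp
        then have "increments f R < 1"
          using d(2) interval_family_mono[OF QR(2)] c'(1) Suc.prems(3) by blast
        moreover have "increments f Q \<le> real n"
          using Suc.IH[OF QR(1)] c' True Suc.prems(3) by simp
        ultimately show ?thesis using QR(3) by simp
      next
        case False
        then have "c - a < real n * d" using c' by simp
        then have "increments f P \<le> real n" using Suc by simp
        then show ?thesis by simp
      qed
    qed
  qed
  obtain n where "b - a < real n * d" using reals_Archimedean3[OF d(1)] by blast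
  then show ?thesis using *[of b _ n] True by (auto intro!: bdd_aboveI2)
qed

lemma variation_upper:
  assumes "abs_cont_on a b f" "interval_family a b P"
  shows "increments f P \<le> variation f a b"
  unfolding variation_def by (rule cSUP_upper[OF _ abs_cont_on_bounded_variation]) (use assms in auto)

lemma variation_least:
  assumes "\<And>P. interval_family a b P \<Longrightarrow> increments f P \<le> B"
  shows "variation f a b \<le> B"
  unfolding variation_def by (rule cSUP_least) (use assms interval_family_empty in auto)

lemma variation_subadditive:
  assumes f: "abs_cont_on a b f" and c: "a \<le> c" "c \<le> b"
  shows "variation f a b \<le> variation f a c + variation f c b"
proof (rule variation_least)
  fix P assume "interval_family a b P"
  then obtain Q R where QR: "interval_family a c Q" "interval_family c b R"
    "increments f P \<le> increments f Q + increments f R"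
    using interval_family_split[OF _ c] by metis
  moreover have "increments f Q \<le> variation f a c" "increments f R \<le> variation f c b"
    by (rule variation_upper[OF abs_cont_on_subset[OF f]]; use QR c in simp)+
  ultimately show "increments f P \<le> variation f a c + variation f c b" by linarith
qed

lemma variation_increment:
  assumes f: "abs_cont_on a b f" and st: "a \<le> s" "s < t" "t \<le> b"
  shows "variation f a s + cmod (f t - f s) \<le> variation f a t"
proof -
  have "variation f a s \<le> variation f a t - cmod (f t - f s)"
  proof (rule variation_least)
    fix P assume P: "interval_family a s P"
    have nin: "(s,t) \<notin> P" using interval_familyD[OF P] st by force
    have "interval_family a t (insert (s,t) P)"
    proof (rule interval_familyI)
      show "finite (insert (s, t) P)" using P by (simp add: interval_family_def)
      show "a \<le> s' \<and> s' < t' \<and> t' \<le> t" if "(s',t') \<in> insert (s,t) P" for s' t'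
        using that interval_familyD[OF P] st by fastforce
      show "t1 \<le> s2 \<or> t2 \<le> s1" if st12: "(s1,t1) \<in> insert (s,t) P" "(s2,t2) \<in> insert (s,t) P" "(s1,t1) \<noteq> (s2,t2)"
        for s1 t1 s2 t2
      proof -
        consider "(s1,t1) = (s,t)" "(s2,t2) \<in> P" | "(s2,t2) = (s,t)" "(s1,t1) \<in> P"
          | "(s1,t1) \<in> P" "(s2,t2) \<in> P" using st12 by blast
        then show ?thesis
          using interval_familyD(3)[OF P] interval_family_disjoint[OF P _ _ st12(3)] by cases auto
      qed
    qed
    then have "increments f (insert (s,t) P) \<le> variation f a t"
      using variation_upper[OF abs_cont_on_subset[OF f]] st by simp
    moreover have "increments f (insert (s,t) P) = cmod (f t - f s) + increments f P"
      using P nin by (simp add: increments_def interval_family_def)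
    ultimately show "increments f P \<le> variation f a t - cmod (f t - f s)" by simp
  qed
  then show ?thesis by simp
qed

text \<open>
  By subadditivity an increment of the variation over \<open>[s,t]\<close> is nearly attained by a family
  inside \<open>[s,t]\<close>. The union of these families, one for each member of \<open>P\<close>, has no larger
  total length than \<open>P\<close>, so absolute continuity of \<open>f\<close> applies to it.
\<close>

lemma abs_cont_on_variation:
  assumes f: "abs_cont_on a b f"
  shows "abs_cont_on a b (\<lambda>x. of_real (variation f a x))"
  unfolding abs_cont_on_iff
proof (intro allI impI)
  fix e :: real assume "e > 0"
  obtain d where d: "d > 0" "\<And>P. interval_family a b P \<Longrightarrow> total_length P < d \<Longrightarrow> increments f P < e / 2"
    using abs_cont_onE[OF f half_gt_zero[OF \<open>e > 0\<close>]] by blast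
  show "\<exists>\<delta>>0. \<forall>P. interval_family a b P \<and> total_length P < \<delta> \<longrightarrow>
      increments (\<lambda>x. of_real (variation f a x)) P < e"
  proof (intro exI[of _ d] conjI allI impI)
    fix P assume "interval_family a b P \<and> total_length P < d"
    then have P: "interval_family a b P" and L: "total_length P < d" by auto
    have fin: "finite P" using P by (simp add: interval_family_def)
    define \<eta> where "\<eta> = e / (2 * (real (card P) + 1))"
    have \<eta>: "\<eta> > 0" using \<open>e > 0\<close> by (simp add: \<eta>_def)
    have "\<exists>Q. interval_family (fst p) (snd p) Q \<and> variation f (fst p) (snd p) - \<eta> < increments f Q" for p
    proof (rule ccontr)
      assume "\<not> ?thesis"
      then have "variation f (fst p) (snd p) \<le> variation f (fst p) (snd p) - \<eta>"
        by (intro variation_least) (simp add: not_less)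
      then show False using \<eta> by simp
    qed
    then obtain Q where Q: "\<And>p. interval_family (fst p) (snd p) (Q p)"
      "\<And>p. variation f (fst p) (snd p) - \<eta> < increments f (Q p)" by metis
    have finQ: "finite (Q p)" for p using Q(1) by (simp add: interval_family_def)
    note PD = interval_family_pair(1-3)[OF P] and disj = interval_family_pair(4)[OF P]
    have Qdisj: "t \<le> s' \<or> t' \<le> s" if "p \<in> P" "p' \<in> P" "p \<noteq> p'" "(s,t) \<in> Q p" "(s',t') \<in> Q p'" for p p' s t s' t'
      using disj[OF that(1,2,3)] interval_familyD[OF Q(1) that(4)] interval_familyD[OF Q(1) that(5)] by linarith
    have U: "interval_family a b (\<Union>(Q ` P))"
    proof (rule interval_familyI)
      show "finite (\<Union>(Q ` P))" using fin finQ by auto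
      show "a \<le> s \<and> s < t \<and> t \<le> b" if "(s,t) \<in> \<Union>(Q ` P)" for s t
      proof -
        obtain p where p: "p \<in> P" "(s,t) \<in> Q p" using \<open>(s,t) \<in> \<Union>(Q ` P)\<close> by blast
        then show ?thesis using interval_familyD[OF Q(1) p(2)] PD[OF p(1)] by linarith
      qed
      show "t \<le> s' \<or> t' \<le> s" if st: "(s,t) \<in> \<Union>(Q ` P)" "(s',t') \<in> \<Union>(Q ` P)" "(s,t) \<noteq> (s',t')" for s t s' t'
      proof -
        obtain p where p: "p \<in> P" "(s,t) \<in> Q p" using st(1) by blast
        obtain p' where "p' \<in> P" "(s',t') \<in> Q p'" using st(2) by blast
        with p show ?thesis
          using Qdisj[of p p'] interval_family_disjoint[OF Q(1)[of p]] st(3) by (cases "p = p'") auto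
      qed
    qed
    have QQ: "\<forall>p\<in>P. \<forall>p'\<in>P. p \<noteq> p' \<longrightarrow> Q p \<inter> Q p' = {}"
    proof (intro ballI impI)
      fix p p' assume pp: "p \<in> P" "p' \<in> P" "p \<noteq> p'"
      have "\<not> ((s,t) \<in> Q p \<and> (s,t) \<in> Q p')" for s t
        using Qdisj[OF pp, of s t s t] interval_familyD(2)[OF Q(1), of s t p] by auto
      then show "Q p \<inter> Q p' = {}" by auto
    qed
    have split: "(\<Sum>q\<in>\<Union>(Q ` P). h q) = (\<Sum>p\<in>P. \<Sum>q\<in>Q p. h q)" for h :: "_ \<Rightarrow> real"
      by (rule sum.UNION_disjoint) (use fin finQ QQ in auto)
    have "total_length (\<Union>(Q ` P)) = (\<Sum>p\<in>P. total_length (Q p))"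
      unfolding total_length_def by (rule split)
    also have "\<dots> \<le> (\<Sum>p\<in>P. snd p - fst p)"
      by (intro sum_mono total_length_le Q(1)) (use PD in \<open>auto intro: less_imp_le\<close>)
    also have "\<dots> = total_length P" by (simp add: total_length_def case_prod_beta)
    finally have incr: "increments f (\<Union>(Q ` P)) < e / 2" using d(2)[OF U] L by linarith
    have "increments (\<lambda>x. of_real (variation f a x)) P = (\<Sum>p\<in>P. variation f a (snd p) - variation f a (fst p))"
      unfolding increments_def case_prod_beta
    proof (rule sum.cong)
      fix p assume "p \<in> P"
      then have "variation f a (fst p) + cmod (f (snd p) - f (fst p)) \<le> variation f a (snd p)"
        using variation_increment[OF f] PD by blast
      then have "variation f a (fst p) \<le> variation f a (snd p)"
        by (smt (verit) norm_ge_zero)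
      then show "cmod (of_real (variation f a (snd p)) - of_real (variation f a (fst p))) =
          variation f a (snd p) - variation f a (fst p)"
        by (simp flip: of_real_diff)
    qed simp
    also have "\<dots> \<le> (\<Sum>p\<in>P. increments f (Q p) + \<eta>)"
    proof (rule sum_mono)
      fix p assume "p \<in> P"
      then have "variation f a (snd p) \<le> variation f a (fst p) + variation f (fst p) (snd p)"
        using variation_subadditive[OF abs_cont_on_subset[OF f]] PD by (simp add: less_imp_le)
      then show "variation f a (snd p) - variation f a (fst p) \<le> increments f (Q p) + \<eta>"
        using Q(2)[of p] by linarith
    qed
    also have "\<dots> = increments f (\<Union>(Q ` P)) + real (card P) * \<eta>"
      using split by (simp add: sum.distrib increments_def)
    also have "\<dots> < e / 2 + e / 2"
    proof (rule add_less_le_mono[OF incr])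
      have "real (card P) * \<eta> \<le> (real (card P) + 1) * \<eta>" using \<eta> by simp
      also have "\<dots> = e / 2" by (simp add: \<eta>_def field_simps)
      finally show "real (card P) * \<eta> \<le> e / 2" .
    qed
    finally show "increments (\<lambda>x. of_real (variation f a x)) P < e" by simp
  qed (use d in auto)
qed

section \<open>The fundamental theorem of calculus for absolutely continuous functions\<close>

text \<open>
  This turns the \<open>\<epsilon>\<close>-\<open>\<delta>\<close> notion for functions into the notion for measures, so that the
  Radon-Nikodym theorem becomes applicable. A null set lies in an open set of measure below
  \<open>\<delta>\<close>, which contains a countable family of non-overlapping intervals covering the null set;
  the Stieltjes measure of every finite subfamily is a sum of increments of \<open>G\<close>, hence below
  \<open>\<epsilon>\<close>.
\<close>

lemma mono_abs_cont_imp_absolutely_continuous: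
  fixes G :: "real \<Rightarrow> real"
  assumes ab: "a < b" and mono: "\<And>s t. s \<le> t \<Longrightarrow> G s \<le> G t" and cont: "continuous_on UNIV G"
    and ac: "abs_cont_on a b (\<lambda>x. of_real (G x))"
  shows "absolutely_continuous lborel (density (interval_measure G) (indicator {a<..<b}))"
  unfolding absolutely_continuous_def
proof
  let ?M = "interval_measure G"
  fix A :: "real set" assume A: "A \<in> null_sets lborel"
  have As: "A \<in> sets borel" using A by auto
  define B where "B = A \<inter> {a<..<b}"
  have Bb: "B \<in> sets borel" using As by (simp add: B_def)
  have nullB: "emeasure lebesgue B = 0"
  proof -
    have "B \<in> null_sets lborel" using A by (auto simp: B_def null_sets_def intro!: emeasure_eq_0[of A lborel])
    then show ?thesis using null_sets_completionI by fastforce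
  qed
  have "emeasure ?M B \<le> 0 + ennreal e" if "e > 0" for e
  proof -
    obtain d where d: "d > 0" "\<And>P. interval_family a b P \<Longrightarrow> total_length P < d \<Longrightarrow>
        increments (\<lambda>x. of_real (G x)) P < e"
      using abs_cont_onE[OF ac \<open>e > 0\<close>] by blast
    obtain T where T: "open T" "B \<subseteq> T" "T - B \<in> lmeasurable" "emeasure lebesgue (T - B) < ennreal d"
      using sets_lebesgue_outer_open[of B d] Bb d(1) by auto
    have "emeasure lebesgue T \<le> emeasure lebesgue (T - B) + emeasure lebesgue B"
      using emeasure_subadditive[of "T - B" lebesgue B] T Bb by (simp add: Un_absorb2 fmeasurableD)
    then have Td: "emeasure lebesgue T < ennreal d" using T(4) nullB by simp
    have Tm: "T \<in> lmeasurable"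
      using less_trans[OF Td ennreal_less_top] T(1) by (intro fmeasurableI) auto
    define \<gamma> where "\<gamma> = (\<lambda>x. if x \<in> T then T else UNIV)"
    have "gauge \<gamma>" using T(1) by (auto simp: gauge_def \<gamma>_def)
    moreover have "B \<subseteq> cbox a b" "box a b \<noteq> {}" using ab by (auto simp: B_def)
    ultimately obtain \<D> where \<D>: "countable \<D>" "\<Union>\<D> \<subseteq> cbox a b"
      "\<And>K. K \<in> \<D> \<Longrightarrow> interior K \<noteq> {} \<and> (\<exists>c d. K = cbox c d)"
      "pairwise (\<lambda>A B. interior A \<inter> interior B = {}) \<D>"
      "\<And>K. K \<in> \<D> \<Longrightarrow> \<exists>x \<in> B \<inter> K. K \<subseteq> \<gamma> x" "B \<subseteq> \<Union>\<D>"
      using covering_lemma[of B a b \<gamma>] by metis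
    have KT: "K \<subseteq> T" if "K \<in> \<D>" for K
      using \<D>(5)[OF that] T(2) by (auto simp: \<gamma>_def split: if_splits)
    have Ds: "K \<in> sets borel" if "K \<in> \<D>" for K using \<D>(3)[OF that] by auto
    have "\<exists>l r. K = {l..r} \<and> l < r" if "K \<in> \<D>" for K
      using \<D>(3)[OF that] by fastforce
    then obtain l r where lr: "\<And>K. K \<in> \<D> \<Longrightarrow> K = {l K..r K}" "\<And>K. K \<in> \<D> \<Longrightarrow> l K < r K"
      by metis
    have lrab: "a \<le> l K" "r K \<le> b" if "K \<in> \<D>" for K
    proof -
      have "{l K..r K} \<subseteq> {a..b}" using \<D>(2) lr(1)[OF that] that by auto
      then show "a \<le> l K" "r K \<le> b" using lr(2)[OF that] by auto
    qed
    have disj: "{l K<..<r K} \<inter> {l L<..<r L} = {}" if "K \<in> \<D>" "L \<in> \<D>" "K \<noteq> L" for K L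
    proof -
      have "interior K \<inter> interior L = {}" using \<D>(4) that by (auto simp: pairwise_def)
      moreover have "interior K = {l K<..<r K}" using lr(1)[OF that(1)] interior_atLeastAtMost_real by metis
      moreover have "interior L = {l L<..<r L}" using lr(1)[OF that(2)] interior_atLeastAtMost_real by metis
      ultimately show ?thesis by simp
    qed
    have fin: "emeasure ?M (\<Union>F) \<le> ennreal e" if F: "finite F" "F \<subseteq> \<D>" for F
    proof -
      define P where "P = (\<lambda>K. (l K, r K)) ` F"
      have inj: "inj_on (\<lambda>K. (l K, r K)) F"
      proof (rule inj_onI)
        fix K L assume KL: "K \<in> F" "L \<in> F" "(l K, r K) = (l L, r L)"
        then have "K = {l K..r K}" "L = {l L..r L}" using lr(1) F(2) by blast+
        with KL(3) show "K = L" by simp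
      qed
      have P: "interval_family a b P"
        unfolding interval_family_def
      proof (intro conjI)
        show "finite P" using F by (simp add: P_def)
        show "\<forall>(s,t)\<in>P. a \<le> s \<and> s < t \<and> t \<le> b" using F lr(2) lrab by (auto simp: P_def)
        show "disjoint_family_on (\<lambda>(s, t). {s<..<t}) P"
          unfolding disjoint_family_on_def
        proof (intro ballI impI)
          fix p p' assume "p \<in> P" "p' \<in> P" "p \<noteq> p'"
          then obtain K L where "K \<in> F" "L \<in> F" "p = (l K, r K)" "p' = (l L, r L)" "K \<noteq> L"
            by (auto simp: P_def)
          then show "(case p of (s, t) \<Rightarrow> {s<..<t}) \<inter> (case p' of (s, t) \<Rightarrow> {s<..<t}) = {}"
            using disj[of K L] F(2) by auto
        qed
      qed
      have "total_length P = (\<Sum>K\<in>F. r K - l K)"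
        by (simp add: total_length_def P_def sum.reindex[OF inj])
      also have "\<dots> = (\<Sum>K\<in>F. measure lebesgue {l K<..<r K})"
        using lr(2) F(2) by (intro sum.cong) (auto simp: subset_iff less_imp_le)
      also have "\<dots> = measure lebesgue (\<Union>K\<in>F. {l K<..<r K})"
      proof (rule measure_finite_Union[symmetric])
        show "disjoint_family_on (\<lambda>K. {l K<..<r K}) F"
          using disj F(2) unfolding disjoint_family_on_def by blast
        show "emeasure lebesgue {l K<..<r K} \<noteq> \<infinity>" if "K \<in> F" for K
        proof -
          have "l K \<le> r K" using lr(2)[of K] F(2) that by auto
          then show ?thesis by simp
        qed
      qed (use F in auto)
      also have "\<dots> \<le> measure lebesgue T"
      proof (rule measure_mono_fmeasurable[OF _ _ Tm])
        show "(\<Union>K\<in>F. {l K<..<r K}) \<subseteq> T"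
        proof
          fix x assume "x \<in> (\<Union>K\<in>F. {l K<..<r K})"
          then obtain K where K: "K \<in> F" "x \<in> {l K<..<r K}" by blast
          then have "K \<in> \<D>" using F by auto
          then have "{l K..r K} \<subseteq> T" using KT lr(1) by metis
          then show "x \<in> T" using K(2) by auto
        qed
      qed (use F in auto)
      also have "\<dots> < d"
        using Td Tm d(1) by (simp add: emeasure_eq_measure2 ennreal_less_iff)
      finally have incr: "increments (\<lambda>x. of_real (G x)) P < e" using d(2)[OF P] by simp
      have "emeasure ?M (\<Union>F) \<le> (\<Sum>K\<in>F. emeasure ?M K)"
        using emeasure_subadditive_finite[of F "\<lambda>K. K" ?M] F Ds by (simp add: image_subset_iff subset_iff)
      also have "\<dots> = (\<Sum>K\<in>F. ennreal (G (r K) - G (l K)))"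
      proof (rule sum.cong)
        fix K assume "K \<in> F"
        then have K: "K \<in> \<D>" using F by auto
        have "emeasure ?M {l K..r K} = G (r K) - G (l K)"
          by (rule emeasure_interval_measure_Icc) (use lr(2)[OF K] mono cont in auto)
        then show "emeasure ?M K = G (r K) - G (l K)" using lr(1)[OF K] by metis
      qed simp
      also have "\<dots> = ennreal (\<Sum>K\<in>F. G (r K) - G (l K))"
        using F lr(2) mono by (intro sum_ennreal) (auto simp: less_imp_le subset_iff)
      also have "(\<Sum>K\<in>F. G (r K) - G (l K)) = increments (\<lambda>x. of_real (G x)) P"
        unfolding increments_def P_def sum.reindex[OF inj]
        using F(2) lr(2) mono by (auto intro!: sum.cong simp: subset_iff less_imp_le simp flip: of_real_diff)
      finally show ?thesis using incr by (meson ennreal_leI less_imp_le order_trans)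
    qed
    have "emeasure ?M (\<Union>\<D>) \<le> ennreal e"
    proof (cases "\<D> = {}")
      case False
      define U where "U = (\<lambda>n::nat. \<Union>(from_nat_into \<D> ` {..<n}))"
      have "(\<Union>n. U n) = \<Union>\<D>"
      proof
        show "(\<Union>n. U n) \<subseteq> \<Union>\<D>" using from_nat_into[OF False] by (auto simp: U_def)
        show "\<Union>\<D> \<subseteq> (\<Union>n. U n)"
        proof
          fix x assume "x \<in> \<Union>\<D>"
          then obtain K n where "x \<in> K" "from_nat_into \<D> n = K"
            using from_nat_into_surj[OF \<D>(1)] by blast
          then have "x \<in> U (Suc n)" by (auto simp: U_def)
          then show "x \<in> (\<Union>n. U n)" by blast
        qed
      qed
      moreover have "(SUP n. emeasure ?M (U n)) = emeasure ?M (\<Union>n. U n)"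
      proof (rule SUP_emeasure_incseq)
        show "range U \<subseteq> sets ?M" using Ds from_nat_into[OF False] by (auto simp: U_def intro!: sets.finite_Union)
        show "incseq U" by (force simp: U_def incseq_def)
      qed
      moreover have "emeasure ?M (U n) \<le> ennreal e" for n
        unfolding U_def by (rule fin) (use from_nat_into[OF False] in auto)
      ultimately show ?thesis by (metis SUP_least)
    qed simp
    moreover have "\<Union>\<D> \<in> sets ?M"
      using \<D>(1) Ds by (auto intro!: sets.countable_Union)
    ultimately show ?thesis using emeasure_mono[OF \<D>(6), of ?M] by (simp add: order_trans)
  qed
  then have "emeasure ?M B = 0"
    using ennreal_le_epsilon[of 0 "emeasure ?M B"] by auto
  then have "emeasure (density ?M (indicator {a<..<b})) A = 0"
    using As by (subst emeasure_density) (auto simp: B_def Int_commute indicator_inter_arith[symmetric])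
  then show "A \<in> null_sets (density ?M (indicator {a<..<b}))"
    using As by (auto simp: null_sets_def)
qed

text \<open>
  The density is the Radon-Nikodym derivative of the Stieltjes measure of \<open>G\<close>. The measure
  is that of the extension of \<open>G\<close> to the real line by constants.
\<close>

lemma mono_abs_cont_density:
  fixes G :: "real \<Rightarrow> real"
  assumes ab: "a < b" and mono: "\<And>s t. a \<le> s \<Longrightarrow> s \<le> t \<Longrightarrow> t \<le> b \<Longrightarrow> G s \<le> G t"
    and ac: "abs_cont_on a b (\<lambda>x. of_real (G x))"
  obtains f where "f absolutely_integrable_on {a..b}"
    "\<And>x. x \<in> {a..b} \<Longrightarrow> (f has_integral (G x - G a)) {a..x}"
proof -
  define E where "E = (\<lambda>x. G (max a (min b x)))"
  have E: "E x = G x" if "x \<in> {a..b}" for x using that by (simp add: E_def)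
  have monoE: "E s \<le> E t" if "s \<le> t" for s t
    unfolding E_def using that ab by (intro mono) auto
  have "continuous_on {a..b} (\<lambda>x. Re (of_real (G x)))"
    by (intro continuous_on_Re abs_cont_on_imp_continuous_on ac)
  then have contG: "continuous_on {a..b} G" by simp
  have contE: "continuous_on UNIV E"
    unfolding E_def by (rule continuous_on_compose2[OF contG]) (use ab in \<open>auto intro!: continuous_intros\<close>)
  have acE: "abs_cont_on a b (\<lambda>x. of_real (E x))"
    by (rule abs_cont_on_dominated[OF ac ac, where K = 1]) (simp add: E)
  let ?M = "interval_measure E" and ?N = "density (interval_measure E) (indicator {a<..<b})"
  have NM: "emeasure ?N S = emeasure ?M (S \<inter> {a<..<b})" if "S \<in> sets borel" for S
    using that by (subst emeasure_density) (auto simp: Int_commute indicator_inter_arith[symmetric])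
  \<comment> \<open>The density selects the open interval, whereas the increments run up to \<open>b\<close>, which has no mass.\<close>
  have b0: "{b} \<in> null_sets ?M"
    using emeasure_interval_measure_Icc[of b b E] monoE contE by (auto simp: null_sets_def)
  have Nx: "emeasure ?N {a<..x} = ennreal (G x - G a)" if x: "x \<in> {a..b}" for x
  proof -
    have "emeasure ?N {a<..x} = emeasure ?M ({a<..x} - {b})"
      using x by (subst NM) (auto intro!: arg_cong[of _ _ "emeasure ?M"])
    also have "\<dots> = emeasure ?M {a<..x}" by (rule emeasure_Diff_null_set[OF b0]) simp
    also have "\<dots> = ennreal (E x - E a)"
      by (rule emeasure_interval_measure_Ioc)
         (use x monoE contE in \<open>auto intro: continuous_at_imp_continuous_at_within simp: continuous_on_eq_continuous_at\<close>)
    finally show ?thesis using x ab by (simp add: E)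
  qed
  have "absolutely_continuous lborel ?N"
    by (rule mono_abs_cont_imp_absolutely_continuous[OF ab monoE contE acE])
  then obtain h where h: "h \<in> borel_measurable lborel" "density lborel h = ?N"
    using sigma_finite_measure.Radon_Nikodym[OF sigma_finite_lborel, of ?N] by auto
  have hx: "(\<integral>\<^sup>+y. h y * indicator {a<..x} y \<partial>lborel) = ennreal (G x - G a)" if "x \<in> {a..b}" for x
    using Nx[OF that] h by (metis emeasure_density greaterThanAtMost_borel sets_lborel)
  define f where "f = (\<lambda>y. enn2real (h y) * indicator {a<..b} y)"
  have fb: "f \<in> borel_measurable borel" using h(1) by (simp add: f_def)
  have "AE y in lborel. h y * indicator {a<..b} y \<noteq> \<infinity>"
    using h(1) hx[of b] ab by (intro nn_integral_noteq_infinite) auto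
  then have AEf: "AE y in lborel. ennreal (f y) = h y * indicator {a<..b} y"
    by eventually_elim (auto simp: f_def indicator_def less_top)
  have fint: "(f has_integral (G x - G a)) {a..x}" if x: "x \<in> {a..b}" for x
  proof -
    have "((\<lambda>y. f y * indicator {a<..x} y) has_integral (G x - G a)) UNIV"
    proof (rule nn_integral_has_integral)
      show "(\<lambda>y. f y * indicator {a<..x} y) \<in> borel_measurable borel" using fb by simp
      show "0 \<le> f y * indicator {a<..x} y" for y by (simp add: f_def)
      have "(\<integral>\<^sup>+ y. ennreal (f y * indicator {a<..x} y) \<partial>lborel) = (\<integral>\<^sup>+y. h y * indicator {a<..x} y \<partial>lborel)"
      proof (rule nn_integral_cong_AE)
        show "AE y in lborel. ennreal (f y * indicator {a<..x} y) = h y * indicator {a<..x} y"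
          using AEf by eventually_elim (use x in \<open>auto simp: indicator_def f_def split: if_splits\<close>)
      qed
      then show "(\<integral>\<^sup>+ y. ennreal (f y * indicator {a<..x} y) \<partial>lborel) = ennreal (G x - G a)"
        using hx[OF x] by simp
      show "0 \<le> G x - G a" using mono[of a x] x by simp
    qed
    moreover have "(\<lambda>y. f y * indicator {a<..x} y) = (\<lambda>y. if y \<in> {a..x} then f y else 0)"
      by (auto simp: indicator_def f_def)
    ultimately show ?thesis using has_integral_restrict_UNIV by metis
  qed
  have "f absolutely_integrable_on {a..b}"
    by (rule nonnegative_absolutely_integrable_1) (use fint[of b] ab in \<open>auto simp: f_def integrable_on_def\<close>)
  then show ?thesis using that fint by blast
qed

text \<open>
  With \<open>V\<close> the variation, the functions \<open>V\<close>, \<open>V + Re F\<close> and \<open>V + Im F\<close> are increasing and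
  absolutely continuous, so the monotone case yields a density for each of them.
\<close>

lemma abs_cont_on_density:
  assumes ab: "a < b" and F: "abs_cont_on a b F"
  obtains f where "f absolutely_integrable_on {a..b}"
    "\<And>x. x \<in> {a..b} \<Longrightarrow> (f has_integral (F x - F a)) {a..x}"
proof -
  define V where "V = variation F a"
  have V: "abs_cont_on a b (\<lambda>x. of_real (V x))" unfolding V_def by (rule abs_cont_on_variation[OF F])
  have Vmono: "V s + cmod (F t - F s) \<le> V t" if "a \<le> s" "s \<le> t" "t \<le> b" for s t
    using variation_increment[OF F that(1) _ that(3)] that(2) unfolding V_def by (cases "s = t") auto
  have dens: "\<exists>g. g absolutely_integrable_on {a..b} \<and>
      (\<forall>x\<in>{a..b}. (g has_integral (V x + T (F x) - (V a + T (F a)))) {a..x})"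
    if T: "\<And>z w. T z - T w = T (z - w)" "\<And>z. \<bar>T z\<bar> \<le> cmod z" for T :: "complex \<Rightarrow> real"
  proof -
    have 1: "V s + T (F s) \<le> V t + T (F t)" if "a \<le> s" "s \<le> t" "t \<le> b" for s t
      using Vmono[OF that] T(1)[of "F s" "F t"] T(2)[of "F s - F t"] by (simp add: norm_minus_commute)
    have 2: "abs_cont_on a b (\<lambda>x. of_real (V x + T (F x)))"
    proof (rule abs_cont_on_dominated[OF V F, where K = 1])
      fix s t
      have "cmod (of_real (V t + T (F t)) - of_real (V s + T (F s))) = \<bar>(V t - V s) + T (F t - F s)\<bar>"
        unfolding of_real_diff[symmetric] norm_of_real T(1)[symmetric] by (simp add: algebra_simps)
      also have "\<dots> \<le> \<bar>V t - V s\<bar> + cmod (F t - F s)" using T(2)[of "F t - F s"] by linarith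
      finally show "cmod (of_real (V t + T (F t)) - of_real (V s + T (F s))) \<le>
          1 * (cmod (of_real (V t) - of_real (V s)) + cmod (F t - F s))"
        by (simp flip: of_real_diff)
    qed
    show ?thesis using mono_abs_cont_density[OF ab 1 2] by metis
  qed
  obtain g where g: "g absolutely_integrable_on {a..b}" "\<And>x. x \<in> {a..b} \<Longrightarrow> (g has_integral (V x - V a)) {a..x}"
    using dens[of "\<lambda>z. 0"] by auto
  obtain u where u: "u absolutely_integrable_on {a..b}"
    "\<And>x. x \<in> {a..b} \<Longrightarrow> (u has_integral (V x + Re (F x) - (V a + Re (F a)))) {a..x}"
    using dens[of Re] abs_Re_le_cmod by auto
  obtain v where v: "v absolutely_integrable_on {a..b}"
    "\<And>x. x \<in> {a..b} \<Longrightarrow> (v has_integral (V x + Im (F x) - (V a + Im (F a)))) {a..x}"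
    using dens[of Im] abs_Im_le_cmod by auto
  have bl: "bounded_linear (\<lambda>x. \<i> * complex_of_real x)"
    by (intro bounded_linear_const_mult bounded_linear_of_real)
  define f where "f = (\<lambda>x. complex_of_real (u x - g x) + \<i> * complex_of_real (v x - g x))"
  show ?thesis
  proof (rule that)
    have 1: "(\<lambda>x. u x - g x) absolutely_integrable_on {a..b}" "(\<lambda>x. v x - g x) absolutely_integrable_on {a..b}"
      using u g v by auto
    have "(\<lambda>x. complex_of_real (u x - g x)) absolutely_integrable_on {a..b}"
      "(\<lambda>x. \<i> * complex_of_real (v x - g x)) absolutely_integrable_on {a..b}"
      using absolutely_integrable_linear[OF 1(1) bounded_linear_of_real]
        absolutely_integrable_linear[OF 1(2) bl]
      unfolding o_def by blast+
    then show "f absolutely_integrable_on {a..b}" unfolding f_def by (rule set_integral_add(1))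
    fix x assume x: "x \<in> {a..b}"
    have 1: "((\<lambda>x. u x - g x) has_integral (Re (F x) - Re (F a))) {a..x}"
      "((\<lambda>x. v x - g x) has_integral (Im (F x) - Im (F a))) {a..x}"
      using has_integral_diff[OF u(2)[OF x] g(2)[OF x]] has_integral_diff[OF v(2)[OF x] g(2)[OF x]]
      by (simp_all add: algebra_simps)
    have "(f has_integral (of_real (Re (F x) - Re (F a)) + \<i> * of_real (Im (F x) - Im (F a)))) {a..x}"
      unfolding f_def
      using has_integral_linear[OF 1(1) bounded_linear_of_real] has_integral_linear[OF 1(2) bl]
      unfolding o_def by (rule has_integral_add)
    moreover have "of_real (Re (F x) - Re (F a)) + \<i> * of_real (Im (F x) - Im (F a)) = F x - F a"
      by (simp add: complex_eq_iff)
    ultimately show "(f has_integral (F x - F a)) {a..x}" by simp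
  qed
qed

lemma abs_cont_on_derivative:
  assumes ab: "a < b" and F: "abs_cont_on a b F"
  obtains f N where "f absolutely_integrable_on {a..b}" "negligible N"
    "\<And>x. x \<in> {a..b} \<Longrightarrow> (f has_integral (F x - F a)) {a..x}"
    "\<And>x. x \<in> {a<..<b} - N \<Longrightarrow> (F has_vector_derivative f x) (at x)"
proof -
  obtain f where f: "f absolutely_integrable_on {a..b}"
    "\<And>x. x \<in> {a..b} \<Longrightarrow> (f has_integral (F x - F a)) {a..x}"
    using abs_cont_on_density[OF ab F] by blast
  obtain N where N: "negligible N"
    "\<And>x. x \<in> {a<..<b} - N \<Longrightarrow> ((\<lambda>x. integral {a..x} f) has_vector_derivative f x) (at x)"
    using Lebesgue_differentiation[OF f(1)] by blast
  have "(F has_vector_derivative f x) (at x)" if x: "x \<in> {a<..<b} - N" for x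
  proof -
    have "((\<lambda>x. integral {a..x} f + F a) has_vector_derivative f x) (at x)"
      using has_vector_derivative_add[OF N(2)[OF x] has_vector_derivative_const[of "F a"]] by simp
    then show ?thesis
    proof (rule has_vector_derivative_transform_within_open)
      show "open {a<..<b}" "x \<in> {a<..<b}" using x by auto
      show "integral {a..y} f + F a = F y" if "y \<in> {a<..<b}" for y
      proof -
        have "integral {a..y} f = F y - F a" using that by (intro integral_unique f(2)) auto
        then show ?thesis by simp
      qed
    qed
  qed
  then show ?thesis using that f N by blast
qed

text \<open>
  The tool behind every integration by parts below: \<open>F\<close> is the indefinite integral of some
  density, which is the derivative of \<open>F\<close> almost everywhere.
\<close>

lemma fundamental_theorem_abs_cont:
  assumes ab: "a \<le> b" and F: "abs_cont_on a b F"
    and der: "AE x in lebesgue. a < x \<and> x < b \<longrightarrow> (F has_vector_derivative F' x) (at x)"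
  shows "F' absolutely_integrable_on {a..b}" "(F' has_integral (F b - F a)) {a..b}"
proof -
  have "F' absolutely_integrable_on {a..b} \<and> (F' has_integral (F b - F a)) {a..b}"
  proof (cases "a < b")
    case True
    obtain f N where f: "f absolutely_integrable_on {a..b}" "negligible N"
      "\<And>x. x \<in> {a..b} \<Longrightarrow> (f has_integral (F x - F a)) {a..x}"
      "\<And>x. x \<in> {a<..<b} - N \<Longrightarrow> (F has_vector_derivative f x) (at x)"
      using abs_cont_on_derivative[OF True F] by blast
    obtain N' where N': "negligible N'" "\<And>x. x \<notin> N' \<Longrightarrow> a < x \<Longrightarrow> x < b \<Longrightarrow> (F has_vector_derivative F' x) (at x)"
    proof -
      from der obtain N' where "N' \<in> null_sets lebesgue"
        "{x \<in> space lebesgue. \<not> (a < x \<and> x < b \<longrightarrow> (F has_vector_derivative F' x) (at x))} \<subseteq> N'"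
        unfolding eventually_ae_filter by auto
      then show ?thesis using that[of N'] unfolding negligible_iff_null_sets by auto
    qed
    define Z where "Z = N \<union> N' \<union> {a,b}"
    have Z: "negligible Z" using f(2) N'(1) by (simp add: Z_def)
    have eq: "F' x = f x" if "x \<in> {a..b} - Z" for x
      using that f(4)[of x] N'(2)[of x] vector_derivative_unique_at[of F "F' x" x "f x"]
      by (auto simp: Z_def)
    show ?thesis
    proof
      show "F' absolutely_integrable_on {a..b}" using absolutely_integrable_spike[OF f(1) Z eq] by simp
      show "(F' has_integral (F b - F a)) {a..b}"
        by (rule has_integral_spike[OF Z eq f(3)]) (use True in auto)
    qed
  next
    case False
    then have "a = b" using ab by simp
    then show ?thesis by (auto simp: has_integral_null_real absolutely_integrable_negligible)
  qed
  then show "F' absolutely_integrable_on {a..b}" "(F' has_integral (F b - F a)) {a..b}" by auto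
qed

section \<open>Calculus on the half-line\<close>

lemma at_within_half_line: "x > 0 \<Longrightarrow> at x within {0::real..} = at x"
  by (rule at_within_interior) (simp add: interior_real_atLeast)

lemma at_within_half_line_neq_bot: "x \<ge> 0 \<Longrightarrow> at x within {0::real..} \<noteq> bot"
proof (cases "x = 0")
  case True
  then show ?thesis using at_within_Ici_at_right[of "0::real"] trivial_limit_at_right_real by metis
qed (simp add: at_within_half_line)

lemma D_eqI:
  "(f has_vector_derivative d) (at x within {0..}) \<Longrightarrow> x \<ge> 0 \<Longrightarrow> D f x = d"
  unfolding D_def by (rule vector_derivative_within[OF at_within_half_line_neq_bot])

lemma has_vector_derivative_cong_half_line:
  assumes "(f has_vector_derivative d) (at x within {0..})" "x \<ge> 0" "\<And>y. y \<ge> 0 \<Longrightarrow> f y = g y"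
  shows "(g has_vector_derivative d) (at x within {0..})"
  using assms by (intro has_vector_derivative_transform[of x "{0..}" g f]) auto

lemma continuous_on_half_lineI:
  fixes f :: "real \<Rightarrow> 'a::topological_space"
  assumes "\<And>R. R > 0 \<Longrightarrow> continuous_on {0..R} f"
  shows "continuous_on {0..} f"
  unfolding continuous_on_eq_continuous_within
proof
  fix x :: real assume x: "x \<in> {0..}"
  have "continuous (at x within {0..x+1}) f"
    using assms[of "x+1"] x unfolding continuous_on_eq_continuous_within by auto
  moreover have "at x within {0..x+1} = at x within {0..}"
    by (rule at_within_nhd[of x "{..<x+1}"]) auto
  ultimately show "continuous (at x within {0..}) f" by simp
qed

lemma at0_eq: "continuous_on {0..} f \<Longrightarrow> at0 f = f 0"
  unfolding at0_def
proof (rule tendsto_Lim)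
  assume "continuous_on {0..} f"
  then show "(f \<longlongrightarrow> f 0) (at_right 0)"
    unfolding continuous_on_def at_within_Ici_at_right[symmetric] by auto
qed simp

lemma complex_of_real_integral:
  assumes "f integrable_on S"
  shows "integral S (\<lambda>x. complex_of_real (f x)) = complex_of_real (integral S f)"
  using has_integral_linear[OF integrable_integral[OF assms] bounded_linear_of_real]
  unfolding o_def by (rule integral_unique)

lemma abs_cont_on_cong:
  assumes "abs_cont_on a b f" "\<And>x. a \<le> x \<Longrightarrow> x \<le> b \<Longrightarrow> g x = f x"
  shows "abs_cont_on a b g"
  by (rule abs_cont_on_dominated[OF assms(1) assms(1), where K = "1/2"]) (use assms(2) in auto)

lemma AC2_has_derivative: "AC2 f \<Longrightarrow> x \<ge> 0 \<Longrightarrow> (f has_vector_derivative D f x) (at x within {0..})"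
  unfolding AC2_def D_def by (simp add: vector_derivative_works[symmetric])

lemma AC2_continuous:
  assumes "AC2 f"
  shows "continuous_on {0..} f" "continuous_on {0..} (D f)"
  using assms by (auto simp: AC2_def intro!: continuous_on_half_lineI abs_cont_on_imp_continuous_on)

lemma AC2_abs_cont:
  assumes "AC2 f" "0 \<le> a" "a \<le> b"
  shows "abs_cont_on a b f" "abs_cont_on a b (D f)"
proof -
  have "abs_cont_on 0 (b+1) f" "abs_cont_on 0 (b+1) (D f)" using assms by (auto simp: AC2_def)
  then show "abs_cont_on a b f" "abs_cont_on a b (D f)"
    by (auto intro: abs_cont_on_subset assms)
qed

lemma AE_half_lineI:
  assumes "\<And>n::nat. AE x in lebesgue. 0 < x \<and> x < real (Suc n) \<longrightarrow> P x"
  shows "AE x in lebesgue. x > 0 \<longrightarrow> P x"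
proof -
  have "AE x in lebesgue. \<forall>n::nat. 0 < x \<and> x < real (Suc n) \<longrightarrow> P x"
    unfolding AE_all_countable using assms by blast
  then show ?thesis
  proof eventually_elim
    case (elim x)
    obtain n :: nat where "x < real n" using reals_Archimedean2 by blast
    then have "x < real (Suc n)" by simp
    then show ?case using elim by blast
  qed
qed

lemma AE_notin_negligible: "negligible N \<Longrightarrow> AE x in lebesgue. x \<notin> N"
  by (simp add: negligible_iff_null_sets AE_not_in)

lemma AC2_AE_second_derivative:
  assumes "AC2 f"
  shows "AE x in lebesgue. x > 0 \<longrightarrow> (D f has_vector_derivative D (D f) x) (at x)"
proof (rule AE_half_lineI)
  fix n :: nat
  obtain g N where g: "negligible N"
    "\<And>x. x \<in> {0<..<real (Suc n)} - N \<Longrightarrow> (D f has_vector_derivative g x) (at x)"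
    using abs_cont_on_derivative[of 0 "real (Suc n)" "D f"] AC2_abs_cont(2)[OF assms, of 0 "real (Suc n)"]
    by (metis le_cases of_nat_0_less_iff zero_less_Suc order_refl less_imp_le)
  have "(D f has_vector_derivative D (D f) x) (at x)" if "x \<in> {0<..<real (Suc n)} - N" for x
  proof -
    have "D (D f) x = g x"
      using g(2)[OF that] that by (intro D_eqI) (auto simp: at_within_half_line)
    then show ?thesis using g(2)[OF that] by simp
  qed
  then show "AE x in lebesgue. 0 < x \<and> x < real (Suc n) \<longrightarrow> (D f has_vector_derivative D (D f) x) (at x)"
    using AE_notin_negligible[OF g(1)] by auto
qed

lemma AC2_has_integral:
  assumes "AC2 f" "0 \<le> s" "s \<le> t"
  shows "(D f has_integral (f t - f s)) {s..t}"
  using assms(3)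
proof (rule fundamental_theorem_of_calculus)
  fix x assume "x \<in> {s..t}"
  then show "(f has_vector_derivative D f x) (at x within {s..t})"
    using assms AC2_has_derivative[of f x] by (auto intro: has_vector_derivative_within_subset)
qed

lemma AC2_second_integral:
  assumes "AC2 f" "0 \<le> s" "s \<le> t"
  shows "D (D f) absolutely_integrable_on {s..t}" "(D (D f) has_integral (D f t - D f s)) {s..t}"
proof -
  have "AE x in lebesgue. s < x \<and> x < t \<longrightarrow> (D f has_vector_derivative D (D f) x) (at x)"
    using AC2_AE_second_derivative[OF assms(1)] by eventually_elim (use assms in auto)
  then show "D (D f) absolutely_integrable_on {s..t}" "(D (D f) has_integral (D f t - D f s)) {s..t}"
    using fundamental_theorem_abs_cont[OF assms(3) AC2_abs_cont(2)[OF assms]] by blast+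
qed

text \<open>
  It suffices to have a candidate for the first derivative everywhere and one for the second
  derivative almost everywhere.
\<close>

lemma AC2_intro:
  assumes der: "\<And>x. x \<ge> 0 \<Longrightarrow> (u has_vector_derivative w x) (at x within {0..})"
    and ac: "\<And>R. R > 0 \<Longrightarrow> abs_cont_on 0 R u" "\<And>R. R > 0 \<Longrightarrow> abs_cont_on 0 R w"
    and der2: "AE x in lebesgue. x > 0 \<longrightarrow> (w has_vector_derivative r x) (at x)"
  shows "AC2 u" "\<And>x. x \<ge> 0 \<Longrightarrow> D u x = w x"
    "AE x in lebesgue. x > 0 \<longrightarrow> D (D u) x = r x"
proof -
  show Du: "D u x = w x" if "x \<ge> 0" for x using D_eqI[OF der[OF that] that] .
  show "AC2 u"
    unfolding AC2_def
  proof (intro conjI allI impI)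
    show "u differentiable (at x within {0..})" if "x \<ge> 0" for x
      using der[OF that] by (auto simp: differentiable_def has_vector_derivative_def)
    fix R :: real assume R: "R > 0"
    show "abs_cont_on 0 R u" by (rule ac(1)[OF R])
    show "abs_cont_on 0 R (D u)" by (rule abs_cont_on_cong[OF ac(2)[OF R]]) (rule Du)
  qed
  show "AE x in lebesgue. x > 0 \<longrightarrow> D (D u) x = r x"
    using der2
  proof eventually_elim
    case (elim x)
    show ?case
    proof
      assume x: "x > 0"
      then have "(w has_vector_derivative r x) (at x within {0..})"
        using elim by (simp add: has_vector_derivative_at_within)
      then have "(D u has_vector_derivative r x) (at x within {0..})"
        by (rule has_vector_derivative_cong_half_line[OF _ less_imp_le[OF x] Du[symmetric]])
      then show "D (D u) x = r x" using D_eqI x by simp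
    qed
  qed
qed

lemma AC2_double_integral:
  assumes u: "\<And>x. x \<ge> 0 \<Longrightarrow> u x = a + integral {0..x} w"
    and w: "\<And>x. x \<ge> 0 \<Longrightarrow> w x = b + integral {0..x} r"
    and r: "\<And>R. R > 0 \<Longrightarrow> r absolutely_integrable_on {0..R}"
  shows "AC2 u" "\<And>x. x \<ge> 0 \<Longrightarrow> D u x = w x"
    "AE x in lebesgue. x > 0 \<longrightarrow> D (D u) x = r x"
proof -
  have acw: "abs_cont_on 0 R w" if "R > 0" for R
  proof (rule abs_cont_on_cong)
    show "abs_cont_on 0 R (\<lambda>x. b + integral {0..x} r)"
      by (intro abs_cont_on_add abs_cont_on_const abs_cont_on_integral r that)
  qed (rule w)
  have cw: "continuous_on {0..R} w" if "R > 0" for R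
    using abs_cont_on_imp_continuous_on[OF acw[OF that]] .
  have acu: "abs_cont_on 0 R u" if "R > 0" for R
  proof (rule abs_cont_on_cong)
    show "abs_cont_on 0 R (\<lambda>x. a + integral {0..x} w)"
      by (intro abs_cont_on_add abs_cont_on_const abs_cont_on_integral absolutely_integrable_continuous_real cw that)
  qed (rule u)
  have du: "(u has_vector_derivative w x) (at x within {0..})" if x: "x \<ge> 0" for x
  proof -
    have "((\<lambda>x. integral {0..x} w) has_vector_derivative w x) (at x within {0..x+1})"
      using integral_has_vector_derivative[OF cw[of "x+1"]] x by auto
    moreover have "at x within {0..x+1} = at x within {0..}"
      by (rule at_within_nhd[of x "{..<x+1}"]) auto
    ultimately have "((\<lambda>x. a + integral {0..x} w) has_vector_derivative 0 + w x) (at x within {0..})"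
      by (intro has_vector_derivative_add has_vector_derivative_const) simp
    then show ?thesis
      using has_vector_derivative_cong_half_line[OF _ x, of "\<lambda>x. a + integral {0..x} w" "w x" u] u by simp
  qed
  have dw: "AE x in lebesgue. x > 0 \<longrightarrow> (w has_vector_derivative r x) (at x)"
  proof (rule AE_half_lineI)
    fix n :: nat
    obtain N where N: "negligible N" "\<And>x. x \<in> {0<..<real (Suc n)} - N \<Longrightarrow>
        ((\<lambda>x. integral {0..x} r) has_vector_derivative r x) (at x)"
      using Lebesgue_differentiation[OF r[of "real (Suc n)"]] by auto
    have "(w has_vector_derivative r x) (at x)" if "x \<in> {0<..<real (Suc n)} - N" for x
    proof -
      have "((\<lambda>x. b + integral {0..x} r) has_vector_derivative 0 + r x) (at x)"
        by (intro has_vector_derivative_add has_vector_derivative_const N(2) that)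
      then have "((\<lambda>x. b + integral {0..x} r) has_vector_derivative r x) (at x within {0..})"
        by (simp add: has_vector_derivative_at_within)
      then have "(w has_vector_derivative r x) (at x within {0..})"
        using has_vector_derivative_cong_half_line[of _ "r x" x w] w that by simp
      then show ?thesis using that by (simp add: at_within_half_line)
    qed
    then show "AE x in lebesgue. 0 < x \<and> x < real (Suc n) \<longrightarrow> (w has_vector_derivative r x) (at x)"
      using AE_notin_negligible[OF N(1)] by auto
  qed
  show "AC2 u" "\<And>x. x \<ge> 0 \<Longrightarrow> D u x = w x" "AE x in lebesgue. x > 0 \<longrightarrow> D (D u) x = r x"
    by (rule AC2_intro[OF du acu acw dw]; assumption)+
qed

lemma AC2_linear:
  assumes f: "AC2 f" and g: "AC2 g"
  shows "AC2 (\<lambda>x. a * f x + b * g x)" (is "AC2 ?h")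
    "\<And>x. x \<ge> 0 \<Longrightarrow> D (\<lambda>x. a * f x + b * g x) x = a * D f x + b * D g x"
    "AE x in lebesgue. x > 0 \<longrightarrow> D (D (\<lambda>x. a * f x + b * g x)) x = a * D (D f) x + b * D (D g) x"
proof -
  have der: "(?h has_vector_derivative a * D f x + b * D g x) (at x within {0..})" if "x \<ge> 0" for x
    by (intro has_vector_derivative_add has_vector_derivative_mult_right AC2_has_derivative f g that)
  have ac: "abs_cont_on 0 R ?h" "abs_cont_on 0 R (\<lambda>x. a * D f x + b * D g x)" if "R > 0" for R
    by (intro abs_cont_on_add abs_cont_on_mult abs_cont_on_const AC2_abs_cont f g;
        use that in simp)+
  have der2: "AE x in lebesgue. x > 0 \<longrightarrow>
      ((\<lambda>x. a * D f x + b * D g x) has_vector_derivative a * D (D f) x + b * D (D g) x) (at x)"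
    using AC2_AE_second_derivative[OF f] AC2_AE_second_derivative[OF g]
    by eventually_elim (intro impI has_vector_derivative_add has_vector_derivative_mult_right; blast)
  show "AC2 ?h" "\<And>x. x \<ge> 0 \<Longrightarrow> D ?h x = a * D f x + b * D g x"
    "AE x in lebesgue. x > 0 \<longrightarrow> D (D ?h) x = a * D (D f) x + b * D (D g) x"
    by (rule AC2_intro[OF der ac der2]; assumption)+
qed

lemma AC2_cnj:
  assumes f: "AC2 f"
  shows "AC2 (\<lambda>x. cnj (f x))" (is "AC2 ?h")
    "\<And>x. x \<ge> 0 \<Longrightarrow> D (\<lambda>x. cnj (f x)) x = cnj (D f x)"
    "AE x in lebesgue. x > 0 \<longrightarrow> D (D (\<lambda>x. cnj (f x))) x = cnj (D (D f) x)"
proof -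
  have der: "(?h has_vector_derivative cnj (D f x)) (at x within {0..})" if "x \<ge> 0" for x
    by (intro has_vector_derivative_cnj AC2_has_derivative f that)
  have ac: "abs_cont_on 0 R ?h" "abs_cont_on 0 R (\<lambda>x. cnj (D f x))" if "R > 0" for R
    by (intro abs_cont_on_cnj AC2_abs_cont f; use that in simp)+
  have der2: "AE x in lebesgue. x > 0 \<longrightarrow> ((\<lambda>x. cnj (D f x)) has_vector_derivative cnj (D (D f) x)) (at x)"
    using AC2_AE_second_derivative[OF f]
    by eventually_elim (intro impI has_vector_derivative_cnj; blast)
  show "AC2 ?h" "\<And>x. x \<ge> 0 \<Longrightarrow> D ?h x = cnj (D f x)"
    "AE x in lebesgue. x > 0 \<longrightarrow> D (D ?h) x = cnj (D (D f) x)"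
    by (rule AC2_intro[OF der ac der2]; assumption)+
qed

section \<open>Linear systems with locally integrable coefficients\<close>

lemma absolutely_integrable_mult_continuous:
  fixes p u :: "real \<Rightarrow> complex"
  assumes p: "p absolutely_integrable_on {a..b}" and u: "continuous_on {a..b} u"
  shows "(\<lambda>t. p t * u t) absolutely_integrable_on {a..b}"
proof -
  have "bilinear ((*) :: complex \<Rightarrow> complex \<Rightarrow> complex)"
    by (simp add: bilinear_conv_bounded_bilinear bounded_bilinear_mult)
  then have "(\<lambda>t. u t * p t) absolutely_integrable_on {a..b}"
    by (rule absolutely_integrable_bounded_measurable_product)
       (auto intro!: p u continuous_imp_measurable_on_sets_lebesgue compact_imp_bounded compact_continuous_image)
  then show ?thesis by (simp add: mult.commute)
qed

text \<open>
  The system \<open>u' = w\<close>, \<open>w' = p u\<close> in integrated form. With \<open>rate = 1 + \<bar>p\<bar>\<close> a bound for the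
  coefficient matrix, the weight \<open>exp (4 \<integral> rate)\<close> satisfies \<open>\<integral> rate \<cdot> weight \<le> weight / 4\<close>.
  Measured relative to this weight the integral operator is therefore a contraction on the
  whole half-line at once, which gives existence and uniqueness without gluing local
  solutions.
\<close>

locale linear_system =
  fixes p :: "real \<Rightarrow> complex"
  assumes p: "\<And>R. R > 0 \<Longrightarrow> p absolutely_integrable_on {0..R}"
begin

definition rate :: "real \<Rightarrow> real" where "rate t = 1 + cmod (p t)"

definition weight :: "real \<Rightarrow> real" where "weight x = exp (4 * integral {0..x} rate)"

lemma p': "p absolutely_integrable_on {0..x}"
proof (cases "x > 0")
  case False
  then have "{0..x} = {} \<or> {0..x} = {0}" by auto
  then have "negligible {0..x}" by auto
  then show ?thesis by (rule absolutely_integrable_negligible)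
qed (rule p)

lemma rate_integrable: "rate absolutely_integrable_on {0..x}"
  unfolding rate_def
  by (intro set_integral_add absolutely_integrable_norm[unfolded o_def] p' absolutely_integrable_continuous_real continuous_on_const)

lemma rate_ge: "rate t \<ge> 1" "rate t \<ge> cmod (p t)" by (auto simp: rate_def)

lemma weight_pos: "weight x > 0" by (simp add: weight_def)

lemma weight_neq_0: "weight x \<noteq> 0" by (simp add: weight_def)

text \<open>
  Up to the factor \<open>4\<close> the integrand is the almost everywhere derivative of the weight, which
  is absolutely continuous but in general not differentiable everywhere.
\<close>

lemma weight_has_integral: 
  assumes "x \<ge> 0"
  shows "((\<lambda>t. rate t * weight t) has_integral (weight x - 1) / 4) {0..x}"
    and "continuous_on {0..x} weight"
proof -
  define Q where "Q = (\<lambda>x. integral {0..x} rate)"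
  define F where "F = (\<lambda>x. complex_of_real (weight x))"
  define kc where "kc = (\<lambda>t. complex_of_real (rate t))"
  have kc: "kc absolutely_integrable_on {0..x}"
    unfolding kc_def using absolutely_integrable_linear[OF rate_integrable bounded_linear_of_real] by (simp add: o_def)
  have ki: "rate integrable_on {0..y}" for y
    using rate_integrable absolutely_integrable_on_def by blast
  have Qc: "integral {0..y} kc = of_real (Q y)" for y
    unfolding kc_def Q_def by (rule complex_of_real_integral[OF ki])
  have Qmono: "Q s \<le> Q t" if "0 \<le> s" "s \<le> t" for s t
    unfolding Q_def by (rule integral_subset_le) (use that ki rate_ge(1) order_trans[OF zero_le_one] in auto)
  have acQ: "abs_cont_on 0 x (\<lambda>y. of_real (Q y))"
    using abs_cont_on_integral[OF kc] by (simp add: Qc)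
  have acF: "abs_cont_on 0 x F"
  proof (rule abs_cont_on_dominated[OF acQ acQ, where K = "2 * weight x"])
    fix s t assume st: "0 \<le> s" "s < t" "t \<le> x"
    have "1 - exp (- (4 * (Q t - Q s))) \<le> 4 * (Q t - Q s)"
      using exp_ge_add_one_self[of "- (4 * (Q t - Q s))"] by linarith
    then have "weight t * (1 - exp (- (4 * (Q t - Q s)))) \<le> weight t * (4 * (Q t - Q s))"
      using weight_pos[of t] by (intro mult_left_mono) auto
    moreover have "weight t * (1 - exp (- (4 * (Q t - Q s)))) = weight t - weight s"
      by (simp add: weight_def Q_def right_diff_distrib exp_add[symmetric] algebra_simps)
    moreover have "weight t * (4 * (Q t - Q s)) \<le> weight x * (4 * (Q t - Q s))"
      using Qmono[of s t] Qmono[of t x] st by (intro mult_right_mono) (auto simp: weight_def Q_def)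
    ultimately have "weight t - weight s \<le> weight x * (4 * (Q t - Q s))" by linarith
    moreover have "weight s \<le> weight t" using Qmono[of s t] st by (simp add: weight_def Q_def)
    moreover have "Q s \<le> Q t" using Qmono[of s t] st by simp
    ultimately show "cmod (F t - F s) \<le> 2 * weight x * (cmod (of_real (Q t) - of_real (Q s)) + cmod (of_real (Q t) - of_real (Q s)))"
      unfolding F_def of_real_diff[symmetric] norm_of_real by (simp add: algebra_simps)
  qed
  obtain N where N: "negligible N" "\<And>y. y \<in> {0<..<x} - N \<Longrightarrow> ((\<lambda>y. of_real (Q y)) has_vector_derivative kc y) (at y)"
    using Lebesgue_differentiation[OF kc] unfolding Qc by blast
  from AE_notin_negligible[OF N(1)] have "AE y in lebesgue. 0 < y \<and> y < x \<longrightarrow> (F has_vector_derivative 4 * of_real (rate y * weight y)) (at y)"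
  proof eventually_elim
    case (elim y)
    show ?case
    proof
      assume y: "0 < y \<and> y < x"
      have "((\<lambda>z. exp (4 * z)) has_field_derivative exp (4 * complex_of_real (Q y)) * 4) (at (of_real (Q y)))"
        by (auto intro!: derivative_eq_intros)
      from field_vector_diff_chain_at[OF N(2) this]
      have "((\<lambda>z. exp (4 * z)) \<circ> (\<lambda>y. of_real (Q y)) has_vector_derivative kc y * (exp (4 * complex_of_real (Q y)) * 4)) (at y)"
        using elim y by simp
      moreover have "(\<lambda>z. exp (4 * z)) \<circ> (\<lambda>y. of_real (Q y)) = F"
        by (auto simp: F_def weight_def Q_def exp_of_real[symmetric])
      moreover have "kc y * (exp (4 * complex_of_real (Q y)) * 4) = 4 * of_real (rate y * weight y)"
        by (simp add: kc_def weight_def Q_def exp_of_real[symmetric])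
      ultimately show "(F has_vector_derivative 4 * of_real (rate y * weight y)) (at y)" by simp
    qed
  qed
  from fundamental_theorem_abs_cont(2)[OF assms acF this]
  have "((\<lambda>y. 4 * of_real (rate y * weight y)) has_integral (F x - F 0)) {0..x}" .
  from has_integral_linear[OF this bounded_linear_Re]
  have "((\<lambda>y. 4 * (rate y * weight y)) has_integral (weight x - 1)) {0..x}"
    by (simp add: o_def F_def weight_def)
  from has_integral_mult_right[OF this, of "1/4"]
  show "((\<lambda>t. rate t * weight t) has_integral (weight x - 1) / 4) {0..x}" by simp
  have "continuous_on {0..x} (\<lambda>y. Re (F y))"
    by (intro continuous_on_Re abs_cont_on_imp_continuous_on acF)
  then show "continuous_on {0..x} weight" by (simp add: F_def)
qed

lemma rate_weight_integral_le:
  assumes "x \<ge> 0"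
  shows "integral {0..x} (\<lambda>t. rate t * weight t) \<le> weight x / 4"
  using integral_unique[OF weight_has_integral(1)[OF assms]] weight_pos[of x] by simp

lemma weighted_integral_bound:
  fixes g :: "real \<Rightarrow> 'a::euclidean_space"
  assumes x: "x \<ge> 0" and g: "g integrable_on {0..x}"
    and le: "\<And>t. 0 \<le> t \<Longrightarrow> t \<le> x \<Longrightarrow> norm (g t) \<le> B * (rate t * weight t)" and B: "B \<ge> 0"
  shows "norm (integral {0..x} g) \<le> B * (weight x / 4)"
proof -
  have i: "(\<lambda>t. B * (rate t * weight t)) integrable_on {0..x}"
    using has_integral_mult_right[OF weight_has_integral(1)[OF x], of B] by (auto simp: integrable_on_def)
  have "norm (integral {0..x} g) \<le> integral {0..x} (\<lambda>t. B * (rate t * weight t))"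
    by (rule integral_norm_bound_integral[OF g i]) (use le in auto)
  also have "\<dots> = B * integral {0..x} (\<lambda>t. rate t * weight t)" by simp
  also have "\<dots> \<le> B * (weight x / 4)" using rate_weight_integral_le[OF x] B by (intro mult_left_mono)
  finally show ?thesis .
qed

text \<open>
  At a maximum point of \<open>(\<bar>u\<bar> + \<bar>w\<bar>) / weight\<close> the weighted bound shows that the maximum is at
  most a quarter of itself.
\<close>

lemma uniqueness:
  fixes u w :: "real \<Rightarrow> complex"
  assumes c: "continuous_on {0..} u" "continuous_on {0..} w"
    and u: "\<And>x. x \<ge> 0 \<Longrightarrow> u x = integral {0..x} w"
    and w: "\<And>x. x \<ge> 0 \<Longrightarrow> w x = integral {0..x} (\<lambda>t. p t * u t)"
    and x: "x \<ge> 0"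
  shows "u x = 0" "w x = 0"
proof -
  have cx: "continuous_on {0..y} u" "continuous_on {0..y} w" for y
    using c continuous_on_subset by (metis Icc_subset_Ici_iff order_refl)+
  define g where "g = (\<lambda>y. (cmod (u y) + cmod (w y)) / weight y)"
  have "continuous_on {0..x} g"
    unfolding g_def using weight_has_integral(2)[OF x] weight_neq_0
    by (intro continuous_intros cx) auto
  then obtain m where m: "m \<in> {0..x}" "\<And>y. y \<in> {0..x} \<Longrightarrow> g y \<le> g m"
    using continuous_attains_sup[of "{0..x}" g] x by auto
  have gm: "g m \<ge> 0" using weight_pos[of m] by (simp add: g_def)
  have le: "cmod (u t) + cmod (w t) \<le> g m * weight t" if "t \<in> {0..m}" for t
  proof -
    have "g t \<le> g m" using m that by auto
    then show ?thesis using weight_pos[of t] by (simp add: g_def pos_divide_le_eq)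
  qed
  have wi: "w integrable_on {0..m}" by (rule integrable_continuous_real[OF cx(2)])
  have pi: "(\<lambda>t. p t * u t) absolutely_integrable_on {0..m}"
    by (rule absolutely_integrable_mult_continuous[OF p' cx(1)])
  have ni: "(\<lambda>t. cmod (w t)) integrable_on {0..m}" "(\<lambda>t. cmod (p t * u t)) integrable_on {0..m}"
    using pi[unfolded absolutely_integrable_on_def]
    by (blast intro: integrable_continuous_real continuous_intros cx)+
  have m0: "m \<ge> 0" using m by simp
  have "cmod (u m) + cmod (w m) \<le> integral {0..m} (\<lambda>t. cmod (w t)) + integral {0..m} (\<lambda>t. cmod (p t * u t))"
    unfolding u[OF m0] w[OF m0]
    using pi absolutely_integrable_on_def
    by (intro add_mono integral_norm_bound_integral ni wi) auto
  also have "\<dots> = integral {0..m} (\<lambda>t. cmod (w t) + cmod (p t * u t))"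
    by (rule integral_add[symmetric, OF ni])
  also have "\<dots> \<le> norm (integral {0..m} (\<lambda>t. cmod (w t) + cmod (p t * u t)))" by simp
  also have "\<dots> \<le> g m * (weight m / 4)"
  proof (rule weighted_integral_bound[OF m0 integrable_add[OF ni] _ gm])
    fix t assume t: "0 \<le> t" "t \<le> m"
    have "cmod (w t) + cmod (p t * u t) \<le> rate t * cmod (w t) + rate t * cmod (u t)"
      using rate_ge[of t] by (intro add_mono) (auto simp: norm_mult mult_right_mono intro: mult_right_mono[of 1 _ "cmod (w t)", simplified])
    also have "\<dots> = rate t * (cmod (u t) + cmod (w t))" by (simp add: algebra_simps)
    also have "\<dots> \<le> rate t * (g m * weight t)"
      using rate_ge(1)[of t] le[of t] t by (intro mult_left_mono) auto
    finally show "norm (cmod (w t) + cmod (p t * u t)) \<le> g m * (rate t * weight t)" by (simp add: algebra_simps)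
  qed
  finally have "cmod (u m) + cmod (w m) \<le> g m * (weight m / 4)" .
  then have "g m \<le> g m / 4" using weight_pos[of m] by (simp add: g_def pos_divide_le_eq field_simps)
  then have "g m = 0" using gm by simp
  then have "g x \<le> 0" using m(2)[of x] x by simp
  then have "cmod (u x) + cmod (w x) \<le> 0" using weight_pos[of x] by (simp add: g_def divide_le_0_iff)
  then show "u x = 0" "w x = 0"
    by (smt (verit) norm_ge_zero norm_eq_zero)+
qed

lemma norm_fst: "norm (fst z) \<le> norm z" and norm_snd: "norm (snd z) \<le> norm z"
  by (metis norm_fst_le prod.collapse, metis norm_snd_le prod.collapse)

text \<open>
  The fixed point \<open>v\<close> is the pair \<open>(u, w)\<close> divided by the weight. Dividing makes it a bounded
  function, so that Banach's theorem applies in the space of bounded continuous functions;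
  these are defined on the real line, hence the constant continuation by \<open>max 0 x\<close>. Each of
  the two components contributes a quarter, so the contraction constant is \<open>1/2\<close>.
\<close>

lemma existence:
  obtains u w :: "real \<Rightarrow> complex"
  where "continuous_on {0..} u" "continuous_on {0..} w"
    "\<And>x. x \<ge> 0 \<Longrightarrow> u x = a + integral {0..x} w"
    "\<And>x. x \<ge> 0 \<Longrightarrow> w x = b + integral {0..x} (\<lambda>t. p t * u t)"
proof -
  define I where "I = (\<lambda>(v :: real \<Rightarrow>\<^sub>C (complex \<times> complex)) x. integral {0..x} (\<lambda>t. weight t *\<^sub>R snd (v t)))"
  define J where "J = (\<lambda>(v :: real \<Rightarrow>\<^sub>C (complex \<times> complex)) x. integral {0..x} (\<lambda>t. p t * (weight t *\<^sub>R fst (v t))))"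
  define S where "S = (\<lambda>v x. inverse (weight (max 0 x)) *\<^sub>R (a + I v (max 0 x), b + J v (max 0 x)))"
  have Ec: "continuous_on {0..x} weight" for x
    using weight_has_integral(2)[of x] by (cases "x \<ge> 0") auto
  have c1: "continuous_on {0..x} (\<lambda>t. weight t *\<^sub>R snd (apply_bcontfun v t))"
    and c2: "continuous_on {0..x} (\<lambda>t. weight t *\<^sub>R fst (apply_bcontfun v t))" for x and v :: "real \<Rightarrow>\<^sub>C (complex \<times> complex)"
    by (intro continuous_intros Ec; simp)+
  have i1: "(\<lambda>t. weight t *\<^sub>R snd (apply_bcontfun v t)) integrable_on {0..x}" for x and v :: "real \<Rightarrow>\<^sub>C (complex \<times> complex)"
    by (rule integrable_continuous_real[OF c1])
  have i2: "(\<lambda>t. p t * (weight t *\<^sub>R fst (apply_bcontfun v t))) integrable_on {0..x}" for x and v :: "real \<Rightarrow>\<^sub>C (complex \<times> complex)"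
    using absolutely_integrable_mult_continuous[OF p' c2] absolutely_integrable_on_def by blast
  have cI: "continuous_on {0..} (I v)" for v
    unfolding I_def by (intro continuous_on_half_lineI indefinite_integral_continuous_1 i1)
  have cJ: "continuous_on {0..} (J v)" for v
    unfolding J_def by (intro continuous_on_half_lineI indefinite_integral_continuous_1 i2)
  have cE: "continuous_on {0..} weight" by (intro continuous_on_half_lineI Ec)
  have cS: "continuous_on UNIV (S v)" for v
    unfolding S_def
    by (intro continuous_intros continuous_on_compose2[OF cI] continuous_on_compose2[OF cJ] continuous_on_compose2[OF cE])
       (auto simp: weight_neq_0)
  have diff: "norm (I v x - I v' x) \<le> dist v v' * (weight x / 4)" "norm (J v x - J v' x) \<le> dist v v' * (weight x / 4)"
    if x: "x \<ge> 0" for v v' x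
  proof -
    have eqI: "I v x - I v' x = integral {0..x} (\<lambda>t. weight t *\<^sub>R snd (v t) - weight t *\<^sub>R snd (v' t))"
      unfolding I_def by (rule integral_diff[symmetric, OF i1 i1])
    have eqJ: "J v x - J v' x = integral {0..x} (\<lambda>t. p t * (weight t *\<^sub>R fst (v t)) - p t * (weight t *\<^sub>R fst (v' t)))"
      unfolding J_def by (rule integral_diff[symmetric, OF i2 i2])
    show "norm (I v x - I v' x) \<le> dist v v' * (weight x / 4)"
      unfolding eqI
    proof (rule weighted_integral_bound[OF x integrable_diff[OF i1 i1]])
      fix t
      have "cmod (weight t *\<^sub>R snd (v t) - weight t *\<^sub>R snd (v' t)) = weight t * cmod (snd (v t - v' t))"
        using weight_pos[of t] by (simp add: scaleR_diff_right[symmetric])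
      also have "\<dots> \<le> weight t * dist v v'"
        using weight_pos[of t] norm_snd[of "v t - v' t"] dist_bounded[of v t v', unfolded dist_norm[of "v t"]]
        by (intro mult_left_mono) (auto intro: order_trans)
      also have "\<dots> \<le> (rate t * weight t) * dist v v'"
        using rate_ge(1)[of t] weight_pos[of t] by (intro mult_right_mono) (auto intro: mult_right_mono[of 1 _ "weight t", simplified])
      finally show "cmod (weight t *\<^sub>R snd (v t) - weight t *\<^sub>R snd (v' t)) \<le> dist v v' * (rate t * weight t)" by (simp add: mult.commute)
    qed simp
    show "norm (J v x - J v' x) \<le> dist v v' * (weight x / 4)"
      unfolding eqJ
    proof (rule weighted_integral_bound[OF x integrable_diff[OF i2 i2]])
      fix t
      have "p t * (weight t *\<^sub>R fst (v t)) - p t * (weight t *\<^sub>R fst (v' t)) = p t * (weight t *\<^sub>R fst (v t - v' t))"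
        by (simp add: algebra_simps)
      then have "cmod (p t * (weight t *\<^sub>R fst (v t)) - p t * (weight t *\<^sub>R fst (v' t))) = (cmod (p t) * weight t) * cmod (fst (v t - v' t))"
        using weight_pos[of t] by (simp add: norm_mult)
      also have "\<dots> \<le> (rate t * weight t) * dist v v'"
        using weight_pos[of t] rate_ge[of t]
        by (intro mult_mono order_trans[OF norm_fst dist_bounded[of v t v', unfolded dist_norm[of "v t"]]]) auto
      finally show "cmod (p t * (weight t *\<^sub>R fst (v t)) - p t * (weight t *\<^sub>R fst (v' t))) \<le> dist v v' * (rate t * weight t)" by (simp add: mult.commute)
    qed simp
  qed
  have contr: "norm (S v x - S v' x) \<le> dist v v' / 2" for v v' x
  proof -
    define y where "y = max 0 x"
    have y: "y \<ge> 0" by (simp add: y_def)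
    have "S v x - S v' x = inverse (weight y) *\<^sub>R (I v y - I v' y, J v y - J v' y)"
      by (simp add: S_def y_def[symmetric] algebra_simps)
    then have "norm (S v x - S v' x) = inverse (weight y) * norm (I v y - I v' y, J v y - J v' y)"
      using weight_pos[of y] by (simp del: scaleR_Pair)
    also have "\<dots> \<le> inverse (weight y) * (dist v v' * (weight y / 2))"
      using weight_pos[of y] norm_Pair_le[of "I v y - I v' y" "J v y - J v' y"] diff[OF y, of v v']
      by (intro mult_left_mono) auto
    also have "\<dots> = dist v v' / 2" using weight_pos[of y] by simp
    finally show ?thesis .
  qed
  have bS: "bounded (range (S v))" for v
  proof -
    have 0: "norm (S v x) \<le> dist v 0 / 2 + norm (S 0 x)" for x
      using contr[of v x 0] norm_triangle_sub[of "S v x" "S 0 x"] by linarith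
    have "norm (S 0 x) \<le> norm (a, b)" for x
    proof -
      define y where "y = max 0 x"
      have "integral {0..y} rate \<ge> 0"
        using rate_ge(1) order_trans[OF zero_le_one]
        by (intro integral_nonneg) (use rate_integrable absolutely_integrable_on_def in blast)+
      then have "weight y \<ge> 1" by (simp add: weight_def)
      then have "inverse (weight y) \<le> 1" by (simp add: inverse_le_1_iff)
      have "S 0 x = inverse (weight y) *\<^sub>R (a, b)" by (simp add: S_def y_def I_def J_def)
      then have "norm (S 0 x) = inverse (weight y) * norm (a, b)" using weight_pos[of y] by (simp del: scaleR_Pair)
      also have "\<dots> \<le> 1 * norm (a, b)" by (rule mult_right_mono[OF \<open>inverse (weight y) \<le> 1\<close>]) simp
      finally show ?thesis by simp
    qed
    then have "norm (S v x) \<le> dist v 0 / 2 + norm (a, b)" for x using 0[of x] by (meson add_left_mono order_trans)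
    then show ?thesis by (auto simp: bounded_iff)
  qed
  define T where "T = (\<lambda>v. Bcontfun (S v))"
  have T: "apply_bcontfun (T v) = S v" for v
    unfolding T_def by (rule Bcontfun_inverse) (use cS bS in \<open>auto simp: bcontfun_def\<close>)
  have "dist (T v) (T v') \<le> 1/2 * dist v v'" for v v'
    by (rule dist_bound) (use contr in \<open>simp add: T dist_norm\<close>)
  then obtain v where v: "T v = v" using banach_fix_type[of "1/2" T] by auto
  show ?thesis
  proof (rule that[of "\<lambda>t. weight t *\<^sub>R fst (v t)" "\<lambda>t. weight t *\<^sub>R snd (v t)"])
    show "continuous_on {0..} (\<lambda>t. weight t *\<^sub>R fst (v t))" "continuous_on {0..} (\<lambda>t. weight t *\<^sub>R snd (v t))"
      by (intro continuous_on_half_lineI c1 c2)+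
    fix x :: real assume x: "x \<ge> 0"
    have "v x = S v x" using T[of v] v by simp
    also have "\<dots> = inverse (weight x) *\<^sub>R (a + I v x, b + J v x)" using x by (simp add: S_def max_def)
    finally have vx: "v x = inverse (weight x) *\<^sub>R (a + I v x, b + J v x)" .
    show "weight x *\<^sub>R fst (v x) = a + integral {0..x} (\<lambda>t. weight t *\<^sub>R snd (v t))"
      unfolding vx by (simp add: I_def weight_neq_0)
    show "weight x *\<^sub>R snd (v x) = b + integral {0..x} (\<lambda>t. p t * (weight t *\<^sub>R fst (v t)))"
      unfolding vx by (simp add: J_def weight_neq_0)
  qed
qed

end

section \<open>Square integrable functions\<close>

lemma has_integral_cong_AE_half_line:
  fixes f g :: "real \<Rightarrow> 'a::real_normed_vector"
  assumes "(f has_integral I) S" "S \<subseteq> {0..}" "AE x in lebesgue. x > 0 \<longrightarrow> g x = f x"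
  shows "(g has_integral I) S"
proof -
  from assms(3) obtain N where N: "N \<in> null_sets lebesgue"
    "{x \<in> space lebesgue. \<not> (x > 0 \<longrightarrow> g x = f x)} \<subseteq> N"
    unfolding eventually_ae_filter by auto
  have "negligible (N \<union> {0})" using N(1) by (simp add: negligible_iff_null_sets)
  then show ?thesis
  proof (rule has_integral_spike[OF _ _ assms(1)])
    fix x assume x: "x \<in> S - (N \<union> {0})"
    then have "x \<ge> 0" "x \<noteq> 0" "x \<notin> N" using assms(2) by auto
    then have "x > 0" "x \<notin> N" by auto
    then show "g x = f x" using N(2) by auto
  qed
qed

lemma L2_cong: "L2 S f \<Longrightarrow> (\<And>x. x \<in> S \<Longrightarrow> g x = f x) \<Longrightarrow> L2 S g"
proof -
  assume f: "L2 S f" and eq: "\<And>x. x \<in> S \<Longrightarrow> g x = f x"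
  have "(\<lambda>x. indicator S x *\<^sub>R g x) = (\<lambda>x. indicator S x *\<^sub>R f x)"
    "(\<lambda>x. indicator S x *\<^sub>R (cmod (g x))\<^sup>2) = (\<lambda>x. indicator S x *\<^sub>R (cmod (f x))\<^sup>2)"
    using eq by (auto simp: indicator_def fun_eq_iff)
  then show ?thesis using f by (simp add: L2_def set_borel_measurable_def set_integrable_def)
qed

lemma L2_measurable: "L2 S f \<Longrightarrow> (\<lambda>x. indicator S x *\<^sub>R f x) \<in> borel_measurable lebesgue"
  by (simp add: L2_def set_borel_measurable_def)

lemma L2_square_integrable: "L2 S f \<Longrightarrow> (\<lambda>x. (cmod (f x))\<^sup>2) absolutely_integrable_on S"
  by (simp add: L2_def)

lemma cmod_add_square_le: "(cmod (z + w))\<^sup>2 \<le> 2 * (cmod z)\<^sup>2 + 2 * (cmod w)\<^sup>2"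
proof -
  have "(cmod (z + w))\<^sup>2 \<le> (cmod z + cmod w)\<^sup>2"
    by (intro power_mono norm_triangle_ineq) simp
  also have "\<dots> \<le> 2 * (cmod z)\<^sup>2 + 2 * (cmod w)\<^sup>2"
    using zero_le_power2[of "cmod z - cmod w"] by (simp add: power2_eq_square algebra_simps)
  finally show ?thesis .
qed

lemma L2_linear:
  assumes f: "L2 S f" and g: "L2 S g"
  shows "L2 S (\<lambda>x. a * f x + b * g x)"
proof -
  have m: "(\<lambda>x. indicator S x *\<^sub>R (a * f x + b * g x)) \<in> borel_measurable lebesgue"
  proof -
    have "(\<lambda>x. a * (indicator S x *\<^sub>R f x) + b * (indicator S x *\<^sub>R g x)) \<in> borel_measurable lebesgue"
      by (intro borel_measurable_add borel_measurable_times borel_measurable_const L2_measurable f g)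
    moreover have "(\<lambda>x. a * (indicator S x *\<^sub>R f x) + b * (indicator S x *\<^sub>R g x)) =
        (\<lambda>x. indicator S x *\<^sub>R (a * f x + b * g x))"
      by (auto simp: indicator_def)
    ultimately show ?thesis by simp
  qed
  have m2: "(\<lambda>x. indicator S x *\<^sub>R (cmod (a * f x + b * g x))\<^sup>2) \<in> borel_measurable lebesgue"
  proof -
    have "(\<lambda>x. (cmod (indicator S x *\<^sub>R (a * f x + b * g x)))\<^sup>2) \<in> borel_measurable lebesgue"
      by (rule borel_measurable_continuous_on[OF _ m]) (intro continuous_intros)
    moreover have "(\<lambda>x. (cmod (indicator S x *\<^sub>R (a * f x + b * g x)))\<^sup>2) =
        (\<lambda>x. indicator S x *\<^sub>R (cmod (a * f x + b * g x))\<^sup>2)"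
      by (auto simp: indicator_def)
    ultimately show ?thesis by simp
  qed
  have "set_integrable lebesgue S (\<lambda>x. (cmod (a * f x + b * g x))\<^sup>2)"
  proof (rule set_integrable_bound)
    show "set_integrable lebesgue S (\<lambda>x. (2 * (cmod a)\<^sup>2) * (cmod (f x))\<^sup>2 + (2 * (cmod b)\<^sup>2) * (cmod (g x))\<^sup>2)"
      by (intro set_integral_add set_integrable_mult_right L2_square_integrable f g)
    show "set_borel_measurable lebesgue S (\<lambda>x. (cmod (a * f x + b * g x))\<^sup>2)"
      using m2 by (simp add: set_borel_measurable_def)
    show "AE x in lebesgue. x \<in> S \<longrightarrow> norm ((cmod (a * f x + b * g x))\<^sup>2) \<le>
        norm ((2 * (cmod a)\<^sup>2) * (cmod (f x))\<^sup>2 + (2 * (cmod b)\<^sup>2) * (cmod (g x))\<^sup>2)"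
    proof (intro AE_I2 impI)
      fix x
      have "(cmod (a * f x + b * g x))\<^sup>2 \<le> 2 * (cmod (a * f x))\<^sup>2 + 2 * (cmod (b * g x))\<^sup>2"
        by (rule cmod_add_square_le)
      then show "norm ((cmod (a * f x + b * g x))\<^sup>2) \<le>
          norm ((2 * (cmod a)\<^sup>2) * (cmod (f x))\<^sup>2 + (2 * (cmod b)\<^sup>2) * (cmod (g x))\<^sup>2)"
        by (simp add: norm_mult power_mult_distrib)
    qed
  qed
  then show ?thesis using m by (simp add: L2_def set_borel_measurable_def)
qed

lemma L2_cnj:
  assumes "L2 S f"
  shows "L2 S (\<lambda>x. cnj (f x))"
proof -
  have "(\<lambda>x. cnj (indicator S x *\<^sub>R f x)) \<in> borel_measurable lebesgue"
    using L2_measurable[OF assms] by (rule borel_measurable_continuous_on[rotated]) (intro continuous_intros)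
  then show ?thesis using assms by (simp add: L2_def set_borel_measurable_def)
qed

lemma L2_subset:
  assumes "L2 S f" "T \<subseteq> S" "T \<in> sets lebesgue"
  shows "L2 T f"
proof -
  have "(\<lambda>x. indicator T x *\<^sub>R (indicator S x *\<^sub>R f x)) \<in> borel_measurable lebesgue"
    by (rule borel_measurable_scaleR[OF borel_measurable_indicator[OF assms(3)] L2_measurable[OF assms(1)]])
  moreover have "(\<lambda>x. indicator T x *\<^sub>R (indicator S x *\<^sub>R f x)) = (\<lambda>x. indicator T x *\<^sub>R f x)"
    using assms(2) by (auto simp: indicator_def fun_eq_iff)
  ultimately have "set_borel_measurable lebesgue T f" by (simp add: set_borel_measurable_def)
  then show ?thesis
    using assms set_integrable_subset[OF L2_square_integrable[OF assms(1)] assms(3,2)] by (simp add: L2_def)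
qed

lemma L2_mult_integrable:
  assumes f: "L2 S f" and g: "L2 S g"
  shows "(\<lambda>x. f x * g x) absolutely_integrable_on S"
proof (rule set_integrable_bound)
  show "set_integrable lebesgue S (\<lambda>x. (cmod (f x))\<^sup>2 + (cmod (g x))\<^sup>2)"
    by (intro set_integral_add L2_square_integrable f g)
  have "(\<lambda>x. (indicator S x *\<^sub>R f x) * (indicator S x *\<^sub>R g x)) \<in> borel_measurable lebesgue"
    by (rule borel_measurable_times[OF L2_measurable[OF f] L2_measurable[OF g]])
  moreover have "(\<lambda>x. (indicator S x *\<^sub>R f x) * (indicator S x *\<^sub>R g x)) = (\<lambda>x. indicator S x *\<^sub>R (f x * g x))"
    by (auto simp: indicator_def)
  ultimately show "set_borel_measurable lebesgue S (\<lambda>x. f x * g x)" by (simp add: set_borel_measurable_def)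
  show "AE x in lebesgue. x \<in> S \<longrightarrow> norm (f x * g x) \<le> norm ((cmod (f x))\<^sup>2 + (cmod (g x))\<^sup>2)"
  proof (intro AE_I2 impI)
    fix x
    have "0 \<le> (cmod (f x) - cmod (g x))\<^sup>2" by simp
    then have "2 * (cmod (f x) * cmod (g x)) \<le> (cmod (f x))\<^sup>2 + (cmod (g x))\<^sup>2"
      by (simp add: power2_eq_square algebra_simps)
    moreover have "0 \<le> cmod (f x) * cmod (g x)" by simp
    ultimately have "cmod (f x) * cmod (g x) \<le> (cmod (f x))\<^sup>2 + (cmod (g x))\<^sup>2" by linarith
    then show "norm (f x * g x) \<le> norm ((cmod (f x))\<^sup>2 + (cmod (g x))\<^sup>2)"
      unfolding norm_mult by simp
  qed
qed

definition sq_int :: "(real \<Rightarrow> complex) \<Rightarrow> real \<Rightarrow> real" where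
  "sq_int f b = integral {0..b} (\<lambda>x. (cmod (f x))\<^sup>2)"

lemma L2_continuous:
  assumes "continuous_on {a..b} f"
  shows "L2 {a..b} f"
proof -
  have "continuous_on {a..b} (\<lambda>x. (cmod (f x))\<^sup>2)" by (intro continuous_intros assms)
  moreover have "f absolutely_integrable_on {a..b}"
    by (rule absolutely_integrable_continuous_real[OF assms])
  ultimately show ?thesis
    by (auto simp: L2_def set_borel_measurable_def set_integrable_def[of lebesgue "{a..b}" f]
        intro!: absolutely_integrable_continuous_real)
qed

lemma L2_sq_integrable:
  assumes "L2 {a..b} f"
  shows "(\<lambda>x. (cmod (f x))\<^sup>2) integrable_on {a..b}"
  using L2_square_integrable[OF assms] absolutely_integrable_on_def by blast

lemma continuous_on_half_line_L2: "continuous_on {0..} f \<Longrightarrow> 0 \<le> a \<Longrightarrow> L2 {a..b} f"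
  by (rule L2_continuous, erule continuous_on_subset) auto

lemma sq_int_nonneg: "sq_int f b \<ge> 0"
  unfolding sq_int_def
  by (cases "(\<lambda>x. (cmod (f x))\<^sup>2) integrable_on {0..b}")
     (auto intro: integral_nonneg simp: not_integrable_integral)

lemma sq_int_mono:
  assumes "continuous_on {0..} f" "a \<le> b"
  shows "sq_int f a \<le> sq_int f b"
  unfolding sq_int_def
  by (rule integral_subset_le)
     (use assms L2_sq_integrable[OF continuous_on_half_line_L2[OF assms(1)]] in auto)

text \<open>
  If the integral vanished then \<open>f\<close> would vanish on \<open>[0,b]\<close>, and so would its derivative at
  \<open>0\<close>.
\<close>

lemma sq_int_pos:
  assumes f: "AC2 f" and nz: "f 0 \<noteq> 0 \<or> D f 0 \<noteq> 0" and b: "b > 0"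
  shows "sq_int f b > 0"
proof (rule ccontr)
  assume "\<not> ?thesis"
  then have "sq_int f b = 0" using sq_int_nonneg[of f b] by simp
  moreover have c: "continuous_on {0..b} (\<lambda>x. (cmod (f x))\<^sup>2)"
    by (intro continuous_intros continuous_on_subset[OF AC2_continuous(1)[OF f]]) auto
  ultimately have z: "\<forall>x\<in>{0..b}. f x = 0"
    using integral_eq_0_iff[OF c b] by (simp add: sq_int_def)
  have "((\<lambda>_. 0) has_vector_derivative D f 0) (at 0 within {0..b})"
  proof (rule has_vector_derivative_transform[of 0 "{0..b}" "\<lambda>_. 0" f])
    show "(f has_vector_derivative D f 0) (at 0 within {0..b})"
      using AC2_has_derivative[OF f, of 0] by (auto intro: has_vector_derivative_within_subset)
  qed (use z b in auto)
  moreover have "((\<lambda>_. 0) has_vector_derivative 0) (at 0 within {0..b})" by simp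
  ultimately have "D f 0 = 0"
    using vector_derivative_unique_within[of 0 "{0..b}" "\<lambda>_. 0"] b
    by (metis vector_derivative_within_closed_interval atLeastAtMost_iff order_refl less_imp_le)
  then show False using z nz b by auto
qed

text \<open>
  Monotone convergence along \<open>[0,n]\<close>.
\<close>

lemma L2_half_lineI:
  assumes c: "continuous_on {0..} f" and K: "\<And>b. b \<ge> 0 \<Longrightarrow> sq_int f b \<le> K"
  shows "L2 {0..} f"
proof -
  define h where "h = (\<lambda>(n::nat) x. if x \<in> {0..real n} then (cmod (f x))\<^sup>2 else 0)"
  have hi: "(h n has_integral sq_int f (real n)) {0..}" for n
  proof -
    have "((\<lambda>x. (cmod (f x))\<^sup>2) has_integral sq_int f (real n)) {0..real n}"
      unfolding sq_int_def
      using L2_sq_integrable[OF continuous_on_half_line_L2[OF c]] by (simp add: integrable_integral)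
    then show ?thesis unfolding h_def
      using has_integral_restrict[of "{0..real n}" "{0..}" "\<lambda>x. (cmod (f x))\<^sup>2"] by auto
  qed
  have "(\<lambda>x. (cmod (f x))\<^sup>2) integrable_on {0..}"
  proof (rule conjunct1[OF monotone_convergence_increasing])
    show "h n integrable_on {0..}" for n using hi by (auto simp: integrable_on_def)
    show "h n x \<le> h (Suc n) x" for n x by (auto simp: h_def)
    show "(\<lambda>n. h n x) \<longlonglongrightarrow> (cmod (f x))\<^sup>2" if "x \<in> {0..}" for x
    proof (rule tendsto_eventually)
      show "eventually (\<lambda>n. h n x = (cmod (f x))\<^sup>2) sequentially"
        using eventually_ge_at_top[of "nat \<lceil>x\<rceil>"]
      proof eventually_elim
        case (elim n)
        then have "x \<le> real n" by linarith
        then show ?case using that by (simp add: h_def)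
      qed
    qed
    show "bounded (range (\<lambda>n. integral {0..} (h n)))"
      using K sq_int_nonneg[of f] integral_unique[OF hi] by (auto intro!: boundedI[of _ K])
  qed
  then have "(\<lambda>x. (cmod (f x))\<^sup>2) absolutely_integrable_on {0..}"
    by (rule nonnegative_absolutely_integrable_1) simp
  moreover have "set_borel_measurable lebesgue {0..} f"
  proof -
    have "(\<lambda>x. indicator {0..} x *\<^sub>R f x) \<in> borel_measurable borel"
      by (rule borel_measurable_continuous_on_indicator[OF _ c]) simp
    then show ?thesis unfolding set_borel_measurable_def by (simp add: measurable_completion)
  qed
  ultimately show ?thesis by (simp add: L2_def)
qed

lemma sq_int_le_norm:
  assumes "L2 {0..} f"
  shows "sq_int f b \<le> (L2_norm_half_line f)\<^sup>2"
proof -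
  have i: "(\<lambda>x. (cmod (f x))\<^sup>2) integrable_on {0..}"
    using L2_square_integrable[OF assms] absolutely_integrable_on_def by blast
  have "sq_int f b \<le> integral {0..} (\<lambda>x. (cmod (f x))\<^sup>2)"
    unfolding sq_int_def
    using i L2_sq_integrable[OF L2_subset[OF assms]] by (intro integral_subset_le) auto
  also have "\<dots> = (LINT x:{0..}|lebesgue. (cmod (f x))\<^sup>2)"
    using set_lebesgue_integral_eq_integral(2)[OF L2_square_integrable[OF assms]] by simp
  also have "\<dots> = (L2_norm_half_line f)\<^sup>2"
    unfolding L2_norm_half_line_def
    by (subst real_sqrt_pow2) (auto simp: set_lebesgue_integral_def)
  finally show ?thesis .
qed

lemma L2_tail:
  assumes f: "L2 {0..} f" and e: "e > 0"
  obtains R where "R \<ge> 0" "\<And>b. b \<ge> R \<Longrightarrow> integral {R..b} (\<lambda>x. (cmod (f x))\<^sup>2) \<le> e"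
proof -
  let ?s = "SUP b\<in>{0..}. sq_int f b"
  have bdd: "bdd_above (sq_int f ` {0..})"
    using sq_int_le_norm[OF f] by (auto intro!: bdd_aboveI2)
  have "\<exists>R\<in>{0..}. ?s - e < sq_int f R"
    using less_cSUP_iff[OF _ bdd, of "?s - e"] e by auto
  then obtain R where R: "R \<ge> 0" "?s - e < sq_int f R" by auto
  show ?thesis
  proof (rule that[OF R(1)])
    fix b assume b: "b \<ge> R"
    have "sq_int f b \<le> ?s" using b R by (intro cSUP_upper bdd) auto
    moreover have "sq_int f R + integral {R..b} (\<lambda>x. (cmod (f x))\<^sup>2) = sq_int f b"
      unfolding sq_int_def
      by (rule Henstock_Kurzweil_Integration.integral_combine[OF R(1) b L2_sq_integrable[OF L2_subset[OF f]]]) auto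
    ultimately show "integral {R..b} (\<lambda>x. (cmod (f x))\<^sup>2) \<le> e" using R(2) by linarith
  qed
qed

section \<open>Green's formula\<close>

definition wronskian :: "(real \<Rightarrow> complex) \<Rightarrow> (real \<Rightarrow> complex) \<Rightarrow> real \<Rightarrow> complex" where
  "wronskian f g x = f x * D g x - D f x * g x"

text \<open>
  The Wronskian is absolutely continuous with derivative \<open>f g'' - f'' g\<close> almost everywhere, and
  the potential cancels from the right-hand side.
\<close>

lemma Green_formula:
  assumes f: "AC2 f" and g: "AC2 g" and ab: "0 \<le> a" "a \<le> b"
  shows "((\<lambda>x. schroed q f x * g x - f x * schroed q g x) has_integral
           (wronskian f g b - wronskian f g a)) {a..b}"
proof (rule fundamental_theorem_abs_cont(2)[OF ab(2)])
  have "abs_cont_on a b (\<lambda>x. f x * D g x + (-1) * (D f x * g x))"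
    by (intro abs_cont_on_add abs_cont_on_mult abs_cont_on_const AC2_abs_cont f g ab)
  then show "abs_cont_on a b (wronskian f g)"
    by (rule abs_cont_on_cong) (simp add: wronskian_def)
  show "AE x in lebesgue. a < x \<and> x < b \<longrightarrow>
      (wronskian f g has_vector_derivative schroed q f x * g x - f x * schroed q g x) (at x)"
    using AC2_AE_second_derivative[OF f] AC2_AE_second_derivative[OF g]
  proof eventually_elim
    case (elim x)
    show ?case
    proof
      assume x: "a < x \<and> x < b"
      then have x0: "x > 0" using ab by simp
      have d: "(f has_vector_derivative D f x) (at x)" "(g has_vector_derivative D g x) (at x)"
        using AC2_has_derivative[OF f, of x] AC2_has_derivative[OF g, of x] x0
        by (simp_all add: at_within_half_line)
      have d2: "(D f has_vector_derivative D (D f) x) (at x)" "(D g has_vector_derivative D (D g) x) (at x)"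
        using elim x0 by blast+
      have "((\<lambda>x. f x * D g x - D f x * g x) has_vector_derivative
          (f x * D (D g) x + D f x * D g x) - (D f x * D g x + D (D f) x * g x)) (at x)"
        by (intro has_vector_derivative_diff has_vector_derivative_mult d d2)
      moreover have "(\<lambda>x. f x * D g x - D f x * g x) = wronskian f g" by (simp add: wronskian_def fun_eq_iff)
      ultimately show "(wronskian f g has_vector_derivative schroed q f x * g x - f x * schroed q g x) (at x)"
        by (simp add: schroed_def algebra_simps)
    qed
  qed
qed

lemma schroed_linear:
  assumes f: "AC2 f" and g: "AC2 g"
  shows "AE x in lebesgue. x > 0 \<longrightarrow>
    schroed q (\<lambda>x. a * f x + b * g x) x = a * schroed q f x + b * schroed q g x"
  using AC2_linear(3)[OF f g, of a b]
  by eventually_elim (auto simp: schroed_def algebra_simps)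

lemma schroed_cnj:
  assumes f: "AC2 f"
  shows "AE x in lebesgue. x > 0 \<longrightarrow> schroed q (\<lambda>x. cnj (f x)) x = cnj (schroed q f x)"
  using AC2_cnj(3)[OF f] by eventually_elim (auto simp: schroed_def)

text \<open>
  Green's formula for the pair \<open>cnj y\<close>, \<open>y\<close>, divided by \<open>- 2 \<i>\<close>. It is the source of all norm
  estimates below, and expresses that \<open>q\<close> is real.
\<close>

lemma energy_identity:
  assumes y: "AC2 y" and b: "0 \<le> b"
  shows "((\<lambda>x. Im (cnj (y x) * schroed q y x)) has_integral
           (Im (cnj (y 0) * D y 0) - Im (cnj (y b) * D y b))) {0..b}"
proof -
  have W: "wronskian (\<lambda>x. cnj (y x)) y x = 2 * \<i> * of_real (Im (cnj (y x) * D y x))" if "x \<ge> 0" for x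
    unfolding wronskian_def AC2_cnj(2)[OF y that] by (simp add: complex_eq_iff)
  have "((\<lambda>x. schroed q (\<lambda>x. cnj (y x)) x * y x - cnj (y x) * schroed q y x) has_integral
      (wronskian (\<lambda>x. cnj (y x)) y b - wronskian (\<lambda>x. cnj (y x)) y 0)) {0..b}"
    by (rule Green_formula[OF AC2_cnj(1)[OF y] y order_refl b])
  then have "((\<lambda>x. - (2 * \<i> * of_real (Im (cnj (y x) * schroed q y x)))) has_integral
      (wronskian (\<lambda>x. cnj (y x)) y b - wronskian (\<lambda>x. cnj (y x)) y 0)) {0..b}"
  proof (rule has_integral_cong_AE_half_line)
    show "AE x in lebesgue. x > 0 \<longrightarrow> - (2 * \<i> * of_real (Im (cnj (y x) * schroed q y x))) =
        schroed q (\<lambda>x. cnj (y x)) x * y x - cnj (y x) * schroed q y x"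
      using schroed_cnj[OF y, of q] by eventually_elim (auto simp: complex_eq_iff)
  qed auto
  from has_integral_linear[OF this bounded_linear_Im]
  have "((\<lambda>x. - 2 * Im (cnj (y x) * schroed q y x)) has_integral
      (2 * Im (cnj (y b) * D y b) - 2 * Im (cnj (y 0) * D y 0))) {0..b}"
    using b by (simp add: o_def W)
  from has_integral_mult_right[OF this, of "-1/2"]
  show ?thesis by (simp add: algebra_simps)
qed

section \<open>Solutions of the Schroedinger equation\<close>

lemma is_solutionD:
  assumes "is_solution q z u"
  shows "AC2 u" "AE x in lebesgue. x > 0 \<longrightarrow> schroed q u x = z * u x"
  using assms by (auto simp: is_solution_def)

lemma is_solution_linear:
  assumes u: "is_solution q z u" and v: "is_solution q z v"
  shows "is_solution q z (\<lambda>x. a * u x + b * v x)"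
  unfolding is_solution_def
proof
  show "AC2 (\<lambda>x. a * u x + b * v x)" by (rule AC2_linear(1)[OF is_solutionD(1)[OF u] is_solutionD(1)[OF v]])
  show "AE x in lebesgue. x > 0 \<longrightarrow> schroed q (\<lambda>x. a * u x + b * v x) x = z * (a * u x + b * v x)"
    using schroed_linear[OF is_solutionD(1)[OF u] is_solutionD(1)[OF v], of q a b] is_solutionD(2)[OF u] is_solutionD(2)[OF v]
    by eventually_elim (auto simp: algebra_simps)
qed

lemma is_solution_cnj:
  assumes u: "is_solution q z u"
  shows "is_solution q (cnj z) (\<lambda>x. cnj (u x))"
  unfolding is_solution_def
proof
  show "AC2 (\<lambda>x. cnj (u x))" by (rule AC2_cnj(1)[OF is_solutionD(1)[OF u]])
  show "AE x in lebesgue. x > 0 \<longrightarrow> schroed q (\<lambda>x. cnj (u x)) x = cnj z * cnj (u x)"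
    using schroed_cnj[OF is_solutionD(1)[OF u], of q] is_solutionD(2)[OF u]
    by eventually_elim auto
qed

text \<open>
  Pairing with a solution \<open>u\<close> for the parameter \<open>z\<close> replaces the differential expression on
  \<open>g\<close> by its inhomogeneity \<open>f = (\<tau> - z) g\<close>.
\<close>

lemma Green_formula_solution:
  assumes u: "is_solution q z u" and g: "AC2 g" and ab: "0 \<le> a" "a \<le> b"
    and f: "AE x in lebesgue. x > 0 \<longrightarrow> schroed q g x - z * g x = f x"
  shows "((\<lambda>x. f x * u x) has_integral (wronskian g u b - wronskian g u a)) {a..b}"
proof (rule has_integral_cong_AE_half_line[OF Green_formula[OF g is_solutionD(1)[OF u] ab, of q]])
  show "AE x in lebesgue. x > 0 \<longrightarrow> f x * u x = schroed q g x * u x - g x * schroed q u x"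
    using f is_solutionD(2)[OF u]
  proof eventually_elim
    case (elim x)
    show ?case
    proof
      assume "x > 0"
      then have eq: "f x = schroed q g x - z * g x" "schroed q u x = z * u x" using elim by auto
      show "f x * u x = schroed q g x * u x - g x * schroed q u x" unfolding eq by (simp add: algebra_simps)
    qed
  qed
qed (use ab in auto)

lemma wronskian_const:
  assumes u: "is_solution q z u" and v: "is_solution q z v" and b: "b \<ge> 0"
  shows "wronskian u v b = wronskian u v 0"
proof -
  have "AE x in lebesgue. x > 0 \<longrightarrow> schroed q u x - z * u x = 0"
    using is_solutionD(2)[OF u] by eventually_elim auto
  from Green_formula_solution[OF v is_solutionD(1)[OF u] order_refl b this]
  have "((\<lambda>x. 0) has_integral (wronskian u v b - wronskian u v 0)) {0..b}" by simp
  from has_integral_unique[OF this has_integral_0] show ?thesis by simp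
qed

lemma solution_energy:
  assumes u: "is_solution q z u" and b: "b \<ge> 0"
  shows "Im z * sq_int u b = Im (cnj (u 0) * D u 0) - Im (cnj (u b) * D u b)"
proof -
  have "((\<lambda>x. Im z * (cmod (u x))\<^sup>2) has_integral (Im (cnj (u 0) * D u 0) - Im (cnj (u b) * D u b))) {0..b}"
  proof (rule has_integral_cong_AE_half_line[OF energy_identity[OF is_solutionD(1)[OF u] b, of q]])
    show "AE x in lebesgue. x > 0 \<longrightarrow> Im z * (cmod (u x))\<^sup>2 = Im (cnj (u x) * schroed q u x)"
      using is_solutionD(2)[OF u]
    proof eventually_elim
      case (elim x)
      have "Im (cnj (u x) * (z * u x)) = Im z * (cmod (u x))\<^sup>2"
        unfolding cmod_power2 by (simp add: power2_eq_square algebra_simps)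
      then show ?case using elim by metis
    qed
  qed auto
  moreover have "((\<lambda>x. Im z * (cmod (u x))\<^sup>2) has_integral (Im z * sq_int u b)) {0..b}"
    unfolding sq_int_def
    by (intro has_integral_mult_right integrable_integral L2_sq_integrable continuous_on_half_line_L2
        AC2_continuous is_solutionD(1)[OF u] order_refl)
  ultimately show ?thesis using has_integral_unique by metis
qed

locale schroedinger =
  fixes q :: "real \<Rightarrow> real"
  assumes q_loc: "\<And>R. R > 0 \<Longrightarrow> set_integrable lebesgue {0..R} q"
begin

lemma linear_system: "linear_system (\<lambda>t. of_real (q t) - z)"
proof
  fix R :: real assume "R > 0"
  have "(\<lambda>t. complex_of_real (q t)) absolutely_integrable_on {0..R}"
    using absolutely_integrable_linear[OF q_loc[OF \<open>R > 0\<close>] bounded_linear_of_real] by (simp add: o_def)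
  then show "(\<lambda>t. of_real (q t) - z) absolutely_integrable_on {0..R}"
    by (rule set_integral_diff(1)) (rule absolutely_integrable_continuous_real[OF continuous_on_const])
qed

lemma solution_exists:
  obtains u where "is_solution q z u" "u 0 = a" "D u 0 = b"
proof -
  interpret linear_system "\<lambda>t. of_real (q t) - z" by (rule linear_system)
  let ?p = "\<lambda>t. complex_of_real (q t) - z"
  obtain u w where uw: "continuous_on {0..} u" "continuous_on {0..} w"
    "\<And>x. x \<ge> 0 \<Longrightarrow> u x = a + integral {0..x} w"
    "\<And>x. x \<ge> 0 \<Longrightarrow> w x = b + integral {0..x} (\<lambda>t. ?p t * u t)"
  proof (rule existence[of a b])
    fix u w assume "continuous_on {0..} u" "continuous_on {0..} w"
      "\<And>x. x \<ge> 0 \<Longrightarrow> u x = a + integral {0..x} w"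
      "\<And>x. x \<ge> 0 \<Longrightarrow> w x = b + integral {0..x} (\<lambda>t. ?p t * u t)"
    then show thesis by (rule that)
  qed
  have i: "(\<lambda>t. ?p t * u t) absolutely_integrable_on {0..R}" if "R > 0" for R
    by (rule absolutely_integrable_mult_continuous[OF p[OF that] continuous_on_subset[OF uw(1)]]) auto
  have A: "AC2 u" "\<And>x. x \<ge> 0 \<Longrightarrow> D u x = w x" "AE x in lebesgue. x > 0 \<longrightarrow> D (D u) x = ?p x * u x"
    by (rule AC2_double_integral[OF uw(3,4) i]; assumption)+
  have "is_solution q z u"
    unfolding is_solution_def
  proof
    show "AC2 u" by (rule A(1))
    show "AE x in lebesgue. x > 0 \<longrightarrow> schroed q u x = z * u x"
      using A(3) by eventually_elim (auto simp: schroed_def algebra_simps)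
  qed
  moreover have "u 0 = a" using uw(3)[of 0] by simp
  moreover have "D u 0 = b" using A(2)[of 0] uw(4)[of 0] by simp
  ultimately show ?thesis using that by blast
qed

lemma solution_integral:
  assumes u: "is_solution q z u" and x: "x \<ge> 0"
  shows "((\<lambda>t. (of_real (q t) - z) * u t) has_integral (D u x - D u 0)) {0..x}"
proof (rule has_integral_cong_AE_half_line[OF AC2_second_integral(2)[OF is_solutionD(1)[OF u] order_refl x]])
  show "AE x in lebesgue. x > 0 \<longrightarrow> (of_real (q x) - z) * u x = D (D u) x"
    using is_solutionD(2)[OF u] by eventually_elim (auto simp: schroed_def algebra_simps)
qed auto

lemma solution_unique:
  assumes u: "is_solution q z u" and v: "is_solution q z v"
    and eq: "u 0 = v 0" "D u 0 = D v 0" and x: "x \<ge> 0"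
  shows "u x = v x"
proof -
  interpret linear_system "\<lambda>t. of_real (q t) - z" by (rule linear_system)
  note U = is_solutionD(1)[OF u] and V = is_solutionD(1)[OF v]
  have "u x - v x = 0"
  proof (rule uniqueness(1)[of "\<lambda>x. u x - v x" "\<lambda>x. D u x - D v x"])
    show "continuous_on {0..} (\<lambda>x. u x - v x)" "continuous_on {0..} (\<lambda>x. D u x - D v x)"
      by (intro continuous_intros AC2_continuous U V)+
    fix y :: real assume y: "0 \<le> y"
    show "u y - v y = integral {0..y} (\<lambda>x. D u x - D v x)"
      using has_integral_diff[OF AC2_has_integral[OF U order_refl y] AC2_has_integral[OF V order_refl y]] eq
      by (simp add: integral_unique)
    have "((\<lambda>t. (of_real (q t) - z) * u t - (of_real (q t) - z) * v t) has_integral (D u y - D v y)) {0..y}"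
      using has_integral_diff[OF solution_integral[OF u y] solution_integral[OF v y]] eq by simp
    then show "D u y - D v y = integral {0..y} (\<lambda>t. (of_real (q t) - z) * (u t - v t))"
      by (simp add: integral_unique right_diff_distrib)
  qed (rule x)
  then show ?thesis by simp
qed

end

section \<open>Weyl's square integrable solution\<close>

lemma sq_int_linear_le:
  assumes f: "L2 {0..b} f" and g: "L2 {0..b} g"
  shows "sq_int (\<lambda>x. s * f x + t * g x) b \<le> 2 * (cmod s)\<^sup>2 * sq_int f b + 2 * (cmod t)\<^sup>2 * sq_int g b"
proof -
  have i: "((\<lambda>x. 2 * (cmod s)\<^sup>2 * (cmod (f x))\<^sup>2 + 2 * (cmod t)\<^sup>2 * (cmod (g x))\<^sup>2) has_integral
      2 * (cmod s)\<^sup>2 * sq_int f b + 2 * (cmod t)\<^sup>2 * sq_int g b) {0..b}"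
    unfolding sq_int_def
    by (intro has_integral_add has_integral_mult_right integrable_integral L2_sq_integrable f g)
  have j: "((\<lambda>x. (cmod (s * f x + t * g x))\<^sup>2) has_integral sq_int (\<lambda>x. s * f x + t * g x) b) {0..b}"
    unfolding sq_int_def by (intro integrable_integral L2_sq_integrable L2_linear f g)
  show ?thesis
  proof (rule has_integral_le[OF j i])
    fix x
    show "(cmod (s * f x + t * g x))\<^sup>2 \<le> 2 * (cmod s)\<^sup>2 * (cmod (f x))\<^sup>2 + 2 * (cmod t)\<^sup>2 * (cmod (g x))\<^sup>2"
      using cmod_add_square_le[of "s * f x" "t * g x"] by (simp add: norm_mult power_mult_distrib)
  qed
qed

lemma sq_int_scale: "sq_int (\<lambda>x. c * f x) b = (cmod c)\<^sup>2 * sq_int f b"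
  by (simp add: sq_int_def norm_mult power_mult_distrib)

text \<open>
  Bounds the coefficient \<open>c\<close> once \<open>g\<close> and \<open>g - c f\<close> are under control. The combination is
  written with explicit factors so that it is literally an instance of the linearity lemmas.
\<close>

lemma sq_int_difference_le:
  assumes g: "L2 {0..b} g" and y: "L2 {0..b} (\<lambda>x. 1 * g x + (- c) * f x)"
  shows "(cmod c)\<^sup>2 * sq_int f b \<le> 2 * sq_int g b + 2 * sq_int (\<lambda>x. 1 * g x + (- c) * f x) b"
proof -
  have "(\<lambda>x. c * f x) = (\<lambda>x. 1 * g x + (-1) * (1 * g x + (- c) * f x))" by (simp add: algebra_simps)
  then have "(cmod c)\<^sup>2 * sq_int f b = sq_int (\<lambda>x. 1 * g x + (-1) * (1 * g x + (- c) * f x)) b"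
    unfolding sq_int_scale[symmetric] by simp
  also have "\<dots> \<le> 2 * (cmod 1)\<^sup>2 * sq_int g b + 2 * (cmod (-1))\<^sup>2 * sq_int (\<lambda>x. 1 * g x + (- c) * f x) b"
    by (rule sq_int_linear_le[OF g y])
  finally show ?thesis by simp
qed

text \<open>
  Otherwise \<open>u\<close> would be an eigenfunction, for the non-real \<open>z\<close>, of the symmetric Dirichlet
  problem on \<open>[0,b]\<close>.
\<close>

lemma solution_nonzero:
  assumes u: "is_solution q z u" and 0: "u 0 = 0" "D u 0 \<noteq> 0" and z: "Im z \<noteq> 0" and b: "b > 0"
  shows "u b \<noteq> 0"
proof
  assume "u b = 0"
  then have "Im z * sq_int u b = 0" using solution_energy[OF u, of b] 0 b by simp
  then show False using sq_int_pos[OF is_solutionD(1)[OF u] _ b] 0 z by auto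
qed

lemma solution_L2: "is_solution q z u \<Longrightarrow> L2 {0..b} u"
  by (rule continuous_on_half_line_L2[OF AC2_continuous(1)[OF is_solutionD(1)]]) auto

context schroedinger
begin

text \<open>
  For every \<open>b > 0\<close> some \<open>y = \<theta> - m \<phi>\<close> vanishes at \<open>b\<close>, and the energy identity turns this into
  \<open>Im z \<integral>\<^sub>0\<^sup>b \<bar>y\<bar>\<^sup>2 = - Im m\<close>. On \<open>[0,1]\<close> the left-hand side grows quadratically in \<open>m\<close>, so the
  numbers \<open>m\<close> stay bounded as \<open>b\<close> grows, and so do these integrals; a limit point \<open>\<mu>\<close> of the
  \<open>m\<close> yields the solution \<open>\<theta> - \<mu> \<phi>\<close>.
\<close>

lemma Weyl_solution_exists:
  assumes z: "Im z > 0"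
  obtains \<psi> where "is_solution q z \<psi>" "\<psi> 0 = 1" "L2 {0..} \<psi>"
proof -
  obtain \<theta> where \<theta>: "is_solution q z \<theta>" "\<theta> 0 = 1" "D \<theta> 0 = 0" by (rule solution_exists)
  obtain \<phi> where \<phi>: "is_solution q z \<phi>" "\<phi> 0 = 0" "D \<phi> 0 = 1" by (rule solution_exists)
  note AC = is_solutionD(1)[OF \<theta>(1)] is_solutionD(1)[OF \<phi>(1)]
  define y where "y = (\<lambda>m x. 1 * \<theta> x + (- m) * \<phi> x)"
  have ys: "is_solution q z (y m)" for m unfolding y_def by (rule is_solution_linear[OF \<theta>(1) \<phi>(1)])
  have y0: "y m 0 = 1" "D (y m) 0 = - m" for m
    unfolding y_def using AC2_linear(2)[OF AC, of 0 1 "- m"] \<theta> \<phi> by auto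
  define m where "m = (\<lambda>n::nat. \<theta> (real (Suc n)) / \<phi> (real (Suc n)))"
  have yb: "y (m n) (real (Suc n)) = 0" for n
    using solution_nonzero[OF \<phi>(1,2), of "real (Suc n)"] \<phi>(3) z by (simp add: y_def m_def)
  have en: "sq_int (y (m n)) b \<le> cmod (m n) / Im z" if "b \<le> real (Suc n)" for n b
  proof -
    have "sq_int (y (m n)) b \<le> sq_int (y (m n)) (real (Suc n))"
      by (rule sq_int_mono[OF AC2_continuous(1)[OF is_solutionD(1)[OF ys]] that])
    moreover have "Im z * sq_int (y (m n)) (real (Suc n)) = Im (- m n)"
      using solution_energy[OF ys, of "real (Suc n)" "m n"] y0 yb by simp
    then have "Im z * sq_int (y (m n)) (real (Suc n)) \<le> cmod (m n)"
      using abs_Im_le_cmod[of "m n"] by simp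
    then have "sq_int (y (m n)) (real (Suc n)) \<le> cmod (m n) / Im z"
      using z by (simp add: pos_le_divide_eq mult.commute)
    ultimately show ?thesis by linarith
  qed
  define A where "A = sq_int \<phi> 1"
  define T where "T = sq_int \<theta> 1"
  define B where "B = 1 + (2 / Im z + 2 * T) / A"
  have A: "A > 0" unfolding A_def using sq_int_pos[OF AC(2)] \<phi> by simp
  have T: "T \<ge> 0" unfolding T_def by (rule sq_int_nonneg)
  have mB: "cmod (m n) \<le> B" for n
  proof (cases "cmod (m n) \<le> 1")
    case True
    then show ?thesis using A T z by (simp add: B_def add_increasing2)
  next
    case False
    have "(cmod (m n))\<^sup>2 * A \<le> 2 * T + 2 * sq_int (y (m n)) 1"
      unfolding A_def T_def y_def by (rule sq_int_difference_le; use solution_L2 \<theta>(1) ys[unfolded y_def] in blast)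
    also have "\<dots> \<le> 2 * T + 2 * (cmod (m n) / Im z)"
      using en[of 1 n] by simp
    also have "\<dots> \<le> 2 * T * cmod (m n) + 2 * (cmod (m n) / Im z)"
      using False T mult_left_mono[of 1 "cmod (m n)" "2 * T"] by simp
    finally have "cmod (m n) * (cmod (m n) * A) \<le> cmod (m n) * (2 / Im z + 2 * T)"
      by (simp add: power2_eq_square algebra_simps)
    then have "cmod (m n) * A \<le> 2 / Im z + 2 * T" using False by (subst (asm) mult_le_cancel_left_pos) auto
    then have "cmod (m n) \<le> (2 / Im z + 2 * T) / A" using A by (simp add: pos_le_divide_eq)
    then show ?thesis by (simp add: B_def)
  qed
  then have "bounded (range m)" by (auto simp: bounded_iff)
  then obtain \<mu> r where r: "strict_mono r" "(m \<circ> r) \<longlonglongrightarrow> \<mu>"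
    using bounded_imp_convergent_subsequence by blast
  have "sq_int (y \<mu>) R \<le> 2 * (B / Im z) + 1" if R: "R \<ge> 0" for R
  proof -
    have "(\<lambda>n. 2 * (cmod (m (r n) - \<mu>))\<^sup>2 * sq_int \<phi> R) \<longlonglongrightarrow> 2 * (cmod (\<mu> - \<mu>))\<^sup>2 * sq_int \<phi> R"
      using r(2) unfolding o_def by (intro tendsto_intros)
    then have "eventually (\<lambda>n. 2 * (cmod (m (r n) - \<mu>))\<^sup>2 * sq_int \<phi> R < 1) sequentially"
      by (rule order_tendstoD(2)) simp
    then obtain n where n: "2 * (cmod (m (r n) - \<mu>))\<^sup>2 * sq_int \<phi> R < 1" "n \<ge> nat \<lceil>R\<rceil>"
      using eventually_conj[OF _ eventually_ge_at_top[of "nat \<lceil>R\<rceil>"]] eventually_happens sequentially_bot by blast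
    have Rn: "R \<le> real (Suc (r n))" using n(2) seq_suble[OF r(1), of n] by linarith
    have "y \<mu> = (\<lambda>x. 1 * y (m (r n)) x + (m (r n) - \<mu>) * \<phi> x)" by (auto simp: y_def algebra_simps)
    then have "sq_int (y \<mu>) R \<le> 2 * (cmod 1)\<^sup>2 * sq_int (y (m (r n))) R + 2 * (cmod (m (r n) - \<mu>))\<^sup>2 * sq_int \<phi> R"
      using sq_int_linear_le[OF solution_L2[OF ys] solution_L2[OF \<phi>(1)], where s = 1] by metis
    also have "\<dots> \<le> 2 * (cmod (m (r n)) / Im z) + 1"
      using en[OF Rn] n(1) by simp
    also have "\<dots> \<le> 2 * (B / Im z) + 1" using mB[of "r n"] z by (simp add: divide_right_mono)
    finally show ?thesis .
  qed
  then have "L2 {0..} (y \<mu>)"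
    by (rule L2_half_lineI[OF AC2_continuous(1)[OF is_solutionD(1)[OF ys]]])
  then show ?thesis using that ys y0 by blast
qed

lemma solution_combination:
  assumes u: "is_solution q z u" and v: "is_solution q z v" and w: "is_solution q z w"
    and i: "v 0 = 1" "w 0 = 0" "D w 0 = 1" and x: "x \<ge> 0"
  shows "u x = u 0 * v x + (D u 0 - u 0 * D v 0) * w x"
proof (rule solution_unique[OF u is_solution_linear[OF v w] _ _ x])
  show "u 0 = u 0 * v 0 + (D u 0 - u 0 * D v 0) * w 0" using i by simp
  show "D u 0 = D (\<lambda>x. u 0 * v x + (D u 0 - u 0 * D v 0) * w x) 0"
    using AC2_linear(2)[OF is_solutionD(1)[OF v] is_solutionD(1)[OF w], of 0] i by simp
qed

end

section \<open>The boundary form at infinity in the limit point case\<close>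

locale limit_point = schroedinger +
  assumes lp: "limit_point_at_infinity q"
begin

text \<open>
  Every solution is a combination of \<open>v\<close> and \<open>w\<close>, but the limit point condition provides one
  that is not square integrable.
\<close>

lemma not_both_L2:
  assumes v: "is_solution q z v" and w: "is_solution q z w"
    and i: "v 0 = 1" "w 0 = 0" "D w 0 = 1" and L: "L2 {0..} v" "L2 {0..} w"
  shows False
proof -
  have "\<exists>u. is_solution q z u \<and> (\<forall>R\<ge>0. \<not> L2 {R..} u)"
    using lp unfolding limit_point_at_infinity_def by (rule spec)
  then obtain u where u: "is_solution q z u" "\<not> L2 {0..} u" by auto
  have "L2 {0..} u"
    by (rule L2_cong[OF L2_linear[OF L]], rule solution_combination[OF u(1) v w i]) simp
  then show False using u(2) by simp
qed

text \<open>
  The normalised difference of two such solutions would be a square integrable solution with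
  initial values \<open>0\<close> and \<open>1\<close>.
\<close>

lemma L2_solution_unique:
  assumes u: "is_solution q z u" "u 0 = 1" "L2 {0..} u"
    and v: "is_solution q z v" "v 0 = 1" "L2 {0..} v" and x: "x \<ge> 0"
  shows "u x = v x"
proof (cases "D u 0 = D v 0")
  case True
  then show ?thesis using solution_unique[OF u(1) v(1)] u(2) v(2) x by simp
next
  case False
  define c where "c = inverse (D u 0 - D v 0)"
  let ?w = "\<lambda>x. c * u x + (- c) * v x"
  have "is_solution q z ?w" by (rule is_solution_linear[OF u(1) v(1)])
  moreover have "?w 0 = 0" using u v by simp
  moreover have "D ?w 0 = 1"
    using AC2_linear(2)[OF is_solutionD(1)[OF u(1)] is_solutionD(1)[OF v(1)], of 0 c "- c"] False
    by (simp add: c_def flip: right_diff_distrib)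
  moreover have "L2 {0..} ?w" by (rule L2_linear[OF u(3) v(3)])
  ultimately show ?thesis using not_both_L2[OF v(1) _ v(2) _ _ v(3)] by blast
qed

lemma sq_int_unbounded:
  assumes \<psi>: "is_solution q z \<psi>" "\<psi> 0 = 1" "L2 {0..} \<psi>"
    and \<phi>: "is_solution q z \<phi>" "\<phi> 0 = 0" "D \<phi> 0 = 1"
  obtains b0 where "b0 > 0" "\<And>b. b \<ge> b0 \<Longrightarrow> sq_int \<phi> b \<ge> K"
proof -
  have c: "continuous_on {0..} \<phi>" by (rule AC2_continuous(1)[OF is_solutionD(1)[OF \<phi>(1)]])
  have "\<exists>b\<ge>0. sq_int \<phi> b > K"
  proof (rule ccontr)
    assume "\<not> ?thesis"
    then have "L2 {0..} \<phi>" by (intro L2_half_lineI[OF c, of K]) force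
    then show False using not_both_L2[OF \<psi>(1) \<phi>(1) \<psi>(2) \<phi>(2,3) \<psi>(3)] by simp
  qed
  then obtain b where b: "b \<ge> 0" "sq_int \<phi> b > K" by blast
  show ?thesis
  proof (rule that[of "b + 1"])
    show "b + 1 > 0" using b by simp
    show "sq_int \<phi> b' \<ge> K" if "b' \<ge> b + 1" for b'
      using sq_int_mono[OF c, of b b'] that b by simp
  qed
qed

text \<open>
  The limit point case leaves no boundary values at infinity. Let \<open>\<phi>\<close> be the solution with
  \<open>\<phi> 0 = 0\<close>, \<open>\<phi>' 0 = 1\<close>, and put \<open>c = g b / \<phi> b\<close>, \<open>d = \<psi> b / \<phi> b\<close>. Since \<open>W(\<psi>,\<phi>) = 1\<close>, one has
  \<open>W(g,\<psi>) = d W(g,\<phi>) - c\<close> at \<open>b\<close>.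

  Both \<open>g - c \<phi>\<close> and \<open>\<psi> - d \<phi>\<close> vanish at \<open>b\<close>, so the energy identity on \<open>[0,b]\<close> bounds their
  norms independently of \<open>b\<close>, in the second case up to a term linear in \<open>\<bar>d\<bar>\<close>. Hence \<open>\<bar>c\<bar>\<^sup>2 \<Phi>\<close> and
  \<open>\<bar>d\<bar>\<^sup>2 \<Phi>\<close> are bounded once \<open>\<Phi> \<ge> 1\<close>, where \<open>\<Phi>\<close> is the integral of \<open>\<bar>\<phi>\<bar>\<^sup>2\<close> over \<open>[0,b]\<close>. As \<open>\<phi>\<close> is
  not square integrable, \<open>\<Phi>\<close> grows without bound as \<open>b\<close> does, so \<open>c\<close> and \<open>d\<close>
  tend to \<open>0\<close>. Finally \<open>W(g,\<phi>)\<close> at \<open>b\<close> is its value at a fixed \<open>R\<close>, which \<open>d\<close> makes small, plus the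
  integral of \<open>f \<phi>\<close> over \<open>[R,b]\<close>; the product of the latter with \<open>d\<close> is small by the bound on
  \<open>\<bar>d\<bar>\<^sup>2 \<Phi>\<close>, because \<open>f\<close> has a small tail.
\<close>

lemma wronskian_tendsto_0:
  assumes z: "Im z > 0" and \<psi>: "is_solution q z \<psi>" "\<psi> 0 = 1" "L2 {0..} \<psi>"
    and g: "AC2 g" "L2 {0..} g" "g 0 = 0"
    and f: "L2 {0..} f" "AE x in lebesgue. x > 0 \<longrightarrow> schroed q g x - z * g x = f x"
  shows "((\<lambda>b. wronskian g \<psi> b) \<longlongrightarrow> 0) at_top"
proof -
  obtain \<phi> where \<phi>: "is_solution q z \<phi>" "\<phi> 0 = 0" "D \<phi> 0 = 1" by (rule solution_exists)
  note AC\<phi> = is_solutionD(1)[OF \<phi>(1)] and AC\<psi> = is_solutionD(1)[OF \<psi>(1)]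
  define s where "s = Im z"
  have s: "s > 0" using z by (simp add: s_def)
  define c where "c = (\<lambda>b. g b / \<phi> b)"
  define d where "d = (\<lambda>b. \<psi> b / \<phi> b)"
  define C1 where "C1 = 2 * (L2_norm_half_line g)\<^sup>2 + 2 * ((L2_norm_half_line f)\<^sup>2 / s\<^sup>2)"
  define C2 where "C2 = 4 * (L2_norm_half_line \<psi>)\<^sup>2 + 4 * cmod (D \<psi> 0) / s + 4 / s\<^sup>2 + 1"
  have nz: "\<phi> b \<noteq> 0" if "b > 0" for b using solution_nonzero[OF \<phi>(1,2) _ _ that] \<phi>(3) z by simp
  have fL: "L2 {a..b} f" if "a \<ge> 0" for a b using L2_subset[OF f(1)] that by auto
  have gL: "L2 {a..b} g" if "a \<ge> 0" for a b using L2_subset[OF g(2)] that by auto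
  have c_bound: "(cmod (c b))\<^sup>2 * sq_int \<phi> b \<le> C1" if b: "b > 0" for b
  proof -
    define y where "y = (\<lambda>x. 1 * g x + (- c b) * \<phi> x)"
    have y: "AC2 y" unfolding y_def by (rule AC2_linear(1)[OF g(1) AC\<phi>])
    have yL: "L2 {0..b} y" unfolding y_def by (intro L2_linear gL solution_L2[OF \<phi>(1)] order_refl)
    have y0: "y 0 = 0" "y b = 0" using g(3) \<phi>(2) nz[OF b] by (auto simp: y_def c_def)
    have "((\<lambda>x. Im (cnj (y x) * (f x + z * y x))) has_integral
        (Im (cnj (y 0) * D y 0) - Im (cnj (y b) * D y b))) {0..b}"
    proof (rule has_integral_cong_AE_half_line[OF energy_identity[OF y less_imp_le[OF b], of q]])
      show "AE x in lebesgue. x > 0 \<longrightarrow> Im (cnj (y x) * (f x + z * y x)) = Im (cnj (y x) * schroed q y x)"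
        using f(2) is_solutionD(2)[OF \<phi>(1)] schroed_linear[OF g(1) AC\<phi>, of q 1 "- c b"]
      proof eventually_elim
        case (elim x)
        show ?case
        proof
          assume "x > 0"
          then have "schroed q y x = 1 * schroed q g x + (- c b) * schroed q \<phi> x"
            "schroed q g x - z * g x = f x" "schroed q \<phi> x = z * \<phi> x"
            using elim unfolding y_def by blast+
          then have "schroed q y x = f x + z * y x" by (simp add: y_def algebra_simps)
          then show "Im (cnj (y x) * (f x + z * y x)) = Im (cnj (y x) * schroed q y x)" by simp
        qed
      qed
    qed auto
    then have I: "((\<lambda>x. Im (cnj (y x) * (f x + z * y x))) has_integral 0) {0..b}"
      using y0 by simp
    have J: "((\<lambda>x. s / 2 * (cmod (y x))\<^sup>2 + (- (1 / (2 * s))) * (cmod (f x))\<^sup>2) has_integral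
        s / 2 * sq_int y b + (- (1 / (2 * s))) * sq_int f b) {0..b}"
      unfolding sq_int_def
      by (intro has_integral_add has_integral_mult_right integrable_integral L2_sq_integrable yL fL order_refl)
    \<comment> \<open>The energy of \<open>y\<close> vanishes as \<open>y\<close> is zero at both ends; complete the square.\<close>
    have "s / 2 * sq_int y b + (- (1 / (2 * s))) * sq_int f b \<le> 0"
    proof (rule has_integral_le[OF J I])
      fix x
      have "Im (cnj (y x) * (f x + z * y x)) = Im (cnj (y x) * f x) + s * (cmod (y x))\<^sup>2"
        unfolding s_def cmod_power2 by (simp add: power2_eq_square algebra_simps)
      moreover have "\<bar>Im (cnj (y x) * f x)\<bar> \<le> cmod (y x) * cmod (f x)"
        using abs_Im_le_cmod[of "cnj (y x) * f x"] by (simp add: norm_mult)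
      moreover have "cmod (y x) * cmod (f x) \<le> s / 2 * (cmod (y x))\<^sup>2 + 1 / (2 * s) * (cmod (f x))\<^sup>2"
      proof -
        have "0 \<le> (s * cmod (y x) - cmod (f x))\<^sup>2 / (2 * s)" using s by simp
        also have "\<dots> = s / 2 * (cmod (y x))\<^sup>2 + 1 / (2 * s) * (cmod (f x))\<^sup>2 - cmod (y x) * cmod (f x)"
          using s by (simp add: power2_eq_square field_simps)
        finally show ?thesis by simp
      qed
      ultimately show "s / 2 * (cmod (y x))\<^sup>2 + (- (1 / (2 * s))) * (cmod (f x))\<^sup>2 \<le> Im (cnj (y x) * (f x + z * y x))"
        by (simp add: abs_le_iff)
    qed
    then have "s / 2 * sq_int y b \<le> 1 / (2 * s) * sq_int f b" by simp
    then have "sq_int y b \<le> sq_int f b / s\<^sup>2"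
      using s by (simp add: field_simps power2_eq_square)
    also have "\<dots> \<le> (L2_norm_half_line f)\<^sup>2 / s\<^sup>2"
      by (intro divide_right_mono sq_int_le_norm f) simp
    finally have yb: "sq_int y b \<le> (L2_norm_half_line f)\<^sup>2 / s\<^sup>2" .
    have "(cmod (c b))\<^sup>2 * sq_int \<phi> b \<le> 2 * sq_int g b + 2 * sq_int y b"
      unfolding y_def by (rule sq_int_difference_le[OF gL[OF order_refl] yL[unfolded y_def]])
    then show ?thesis using yb sq_int_le_norm[OF g(2), of b] by (simp add: C1_def)
  qed
  have d_bound: "(cmod (d b))\<^sup>2 * sq_int \<phi> b \<le> C2" if b: "b > 0" and b1: "sq_int \<phi> b \<ge> 1" for b
  proof -
    define y where "y = (\<lambda>x. 1 * \<psi> x + (- d b) * \<phi> x)"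
    have y: "is_solution q z y" unfolding y_def by (rule is_solution_linear[OF \<psi>(1) \<phi>(1)])
    have y0: "y 0 = 1" "y b = 0" "D y 0 = D \<psi> 0 - d b"
      using \<psi>(2) \<phi>(2,3) nz[OF b] AC2_linear(2)[OF AC\<psi> AC\<phi>, of 0 1 "- d b"] by (auto simp: y_def d_def)
    have "s * sq_int y b = Im (D \<psi> 0 - d b)"
      using solution_energy[OF y, of b] y0 b by (simp add: s_def)
    also have "\<dots> \<le> cmod (D \<psi> 0) + cmod (d b)"
      using abs_Im_le_cmod[of "D \<psi> 0 - d b"] norm_triangle_ineq4[of "D \<psi> 0" "d b"] by linarith
    finally have sy: "sq_int y b \<le> (cmod (D \<psi> 0) + cmod (d b)) / s"
      using s by (simp add: pos_le_divide_eq mult.commute)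
    have "(cmod (d b))\<^sup>2 * sq_int \<phi> b \<le> 2 * sq_int \<psi> b + 2 * sq_int y b"
      unfolding y_def by (rule sq_int_difference_le[OF solution_L2[OF \<psi>(1)] solution_L2[OF y[unfolded y_def]]])
    also have "\<dots> \<le> 2 * (L2_norm_half_line \<psi>)\<^sup>2 + 2 * cmod (D \<psi> 0) / s + 2 * cmod (d b) / s"
      using sy sq_int_le_norm[OF \<psi>(3), of b] by (simp add: add_divide_distrib)
    also have "2 * cmod (d b) / s \<le> (cmod (d b))\<^sup>2 * sq_int \<phi> b / 2 + 2 / s\<^sup>2"
    proof -
      have "0 \<le> (cmod (d b) - 2 / s)\<^sup>2 / 2" by simp
      also have "\<dots> = (cmod (d b))\<^sup>2 / 2 - 2 * cmod (d b) / s + 2 / s\<^sup>2"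
        using s by (simp add: power2_eq_square field_simps)
      finally have "2 * cmod (d b) / s \<le> (cmod (d b))\<^sup>2 / 2 + 2 / s\<^sup>2" by simp
      moreover have "(cmod (d b))\<^sup>2 * 1 \<le> (cmod (d b))\<^sup>2 * sq_int \<phi> b"
        by (rule mult_left_mono[OF b1]) simp
      ultimately show ?thesis by linarith
    qed
    finally have "(cmod (d b))\<^sup>2 * sq_int \<phi> b \<le> 4 * (L2_norm_half_line \<psi>)\<^sup>2 + 4 * cmod (D \<psi> 0) / s + 4 / s\<^sup>2"
      by (simp add: field_simps)
    then show ?thesis by (simp add: C2_def)
  qed
  have C2: "C2 > 0" unfolding C2_def using s by (simp add: add_nonneg_pos)
  have W: "wronskian g \<psi> b = d b * wronskian g \<phi> b - c b" if b: "b > 0" for b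
  proof -
    have "wronskian \<psi> \<phi> b = 1"
      using wronskian_const[OF \<psi>(1) \<phi>(1), of b] b \<psi>(2) \<phi>(2,3) by (simp add: wronskian_def)
    moreover have "wronskian g \<psi> b * \<phi> b = \<psi> b * wronskian g \<phi> b - g b * wronskian \<psi> \<phi> b"
      by (simp add: wronskian_def algebra_simps)
    ultimately show ?thesis using nz[OF b] by (simp add: c_def d_def field_simps)
  qed
  have small: "\<exists>B. \<forall>b\<ge>B. cmod (wronskian g \<psi> b) \<le> \<eta>" if \<eta>: "\<eta> > 0" for \<eta>
  proof -
    \<comment> \<open>Weight of the arithmetic-geometric inequality for \<open>\<bar>d f \<phi>\<bar>\<close>: the \<open>\<phi>\<close>-part becomes \<open>\<eta> / 4\<close>.\<close>
    define \<epsilon> where "\<epsilon> = \<eta> / (2 * C2)"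
    have \<epsilon>: "\<epsilon> > 0" using \<eta> C2 by (simp add: \<epsilon>_def)
    obtain R where R: "R \<ge> 0" "\<And>b. b \<ge> R \<Longrightarrow> integral {R..b} (\<lambda>x. (cmod (f x))\<^sup>2) \<le> \<epsilon> * \<eta> / 2"
      using L2_tail[OF f(1), of "\<epsilon> * \<eta> / 2"] \<epsilon> \<eta> by auto
    define w where "w = cmod (wronskian g \<phi> R)"
    \<comment> \<open>Chosen so that \<open>t\<^sup>2 \<Phi> \<le> \<bar>C1\<bar> + C2 w\<^sup>2\<close> and \<open>\<Phi> \<ge> K\<close> force \<open>t \<le> \<eta> / 4\<close>.\<close>
    define K where "K = max 1 (16 * (\<bar>C1\<bar> + C2 * w\<^sup>2) / \<eta>\<^sup>2)"
    obtain b0 where b0: "b0 > 0" "\<And>b. b \<ge> b0 \<Longrightarrow> sq_int \<phi> b \<ge> K"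
      using sq_int_unbounded[OF \<psi> \<phi>, of K] by blast
    have "cmod (wronskian g \<psi> b) \<le> \<eta>" if bb: "b \<ge> max b0 R" for b
    proof -
      have b: "b > 0" "b \<ge> R" and \<Phi>: "sq_int \<phi> b \<ge> K" "sq_int \<phi> b \<ge> 1"
        using bb b0(1) b0(2)[of b] by (auto simp: K_def)
      have K0: "K > 0" by (simp add: K_def)
      have le: "t \<le> \<eta> / 4" if t: "t \<ge> 0" "t\<^sup>2 * sq_int \<phi> b \<le> X" "X \<le> \<bar>C1\<bar> + C2 * w\<^sup>2" for t X
      proof -
        have "t\<^sup>2 * K \<le> t\<^sup>2 * sq_int \<phi> b" by (rule mult_left_mono[OF \<Phi>(1)]) simp
        also have "\<dots> \<le> \<bar>C1\<bar> + C2 * w\<^sup>2" using t by simp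
        also have "\<dots> \<le> (\<eta> / 4)\<^sup>2 * K"
        proof -
          have "16 * (\<bar>C1\<bar> + C2 * w\<^sup>2) / \<eta>\<^sup>2 \<le> K" by (simp add: K_def)
          then show ?thesis using \<eta> by (simp add: field_simps)
        qed
        finally have "t\<^sup>2 \<le> (\<eta> / 4)\<^sup>2" using K0 by simp
        then show ?thesis by (rule power2_le_imp_le) (use \<eta> in simp)
      qed
      have 1: "cmod (c b) \<le> \<eta> / 4"
      proof (rule le[OF _ c_bound[OF b(1)]])
        have "0 \<le> C2 * w\<^sup>2" using C2 by simp
        then show "C1 \<le> \<bar>C1\<bar> + C2 * w\<^sup>2" by linarith
      qed simp
      have 2: "cmod (d b) * w \<le> \<eta> / 4"
      proof (rule le)
        show "0 \<le> cmod (d b) * w" by (simp add: w_def)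
        have "(cmod (d b))\<^sup>2 * sq_int \<phi> b * w\<^sup>2 \<le> C2 * w\<^sup>2"
          by (rule mult_right_mono[OF d_bound[OF b(1) \<Phi>(2)]]) simp
        then show "(cmod (d b) * w)\<^sup>2 * sq_int \<phi> b \<le> C2 * w\<^sup>2" by (simp add: power_mult_distrib algebra_simps)
      qed simp
      have fg: "((\<lambda>x. f x * \<phi> x) has_integral (wronskian g \<phi> b - wronskian g \<phi> R)) {R..b}"
        by (rule Green_formula_solution[OF \<phi>(1) g(1) R(1) b(2) f(2)])
      have \<phi>L: "L2 {R..b} \<phi>" by (rule continuous_on_half_line_L2[OF AC2_continuous(1)[OF AC\<phi>] R(1)])
      have 3: "cmod (d b * (wronskian g \<phi> b - wronskian g \<phi> R)) \<le> \<eta> / 2"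
      proof -
        let ?I = "\<epsilon> / 2 * (cmod (d b))\<^sup>2 * integral {R..b} (\<lambda>x. (cmod (\<phi> x))\<^sup>2) +
            1 / (2 * \<epsilon>) * integral {R..b} (\<lambda>x. (cmod (f x))\<^sup>2)"
        have i1: "((\<lambda>x. d b * (f x * \<phi> x)) has_integral (d b * (wronskian g \<phi> b - wronskian g \<phi> R))) {R..b}"
          by (rule has_integral_mult_right[OF fg])
        have i2: "((\<lambda>x. \<epsilon> / 2 * (cmod (d b))\<^sup>2 * (cmod (\<phi> x))\<^sup>2 + 1 / (2 * \<epsilon>) * (cmod (f x))\<^sup>2) has_integral ?I) {R..b}"
          by (intro has_integral_add has_integral_mult_right integrable_integral L2_sq_integrable \<phi>L fL R)
        have "cmod (integral {R..b} (\<lambda>x. d b * (f x * \<phi> x))) \<le>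
            integral {R..b} (\<lambda>x. \<epsilon> / 2 * (cmod (d b))\<^sup>2 * (cmod (\<phi> x))\<^sup>2 + 1 / (2 * \<epsilon>) * (cmod (f x))\<^sup>2)"
        proof (rule integral_norm_bound_integral)
          fix x
          have "0 \<le> (\<epsilon> * (cmod (d b) * cmod (\<phi> x)) - cmod (f x))\<^sup>2 / (2 * \<epsilon>)" using \<epsilon> by simp
          also have "\<dots> = \<epsilon> / 2 * (cmod (d b))\<^sup>2 * (cmod (\<phi> x))\<^sup>2 + 1 / (2 * \<epsilon>) * (cmod (f x))\<^sup>2 -
              cmod (d b) * (cmod (f x) * cmod (\<phi> x))"
            using \<epsilon> by (simp add: power2_eq_square field_simps)
          finally show "norm (d b * (f x * \<phi> x)) \<le> \<epsilon> / 2 * (cmod (d b))\<^sup>2 * (cmod (\<phi> x))\<^sup>2 + 1 / (2 * \<epsilon>) * (cmod (f x))\<^sup>2"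
            by (simp add: norm_mult)
        qed (use i1 i2 in \<open>auto simp: integrable_on_def\<close>)
        then have "cmod (d b * (wronskian g \<phi> b - wronskian g \<phi> R)) \<le> ?I"
          unfolding integral_unique[OF i1] integral_unique[OF i2] .
        also have "\<dots> \<le> \<epsilon> / 2 * C2 + 1 / (2 * \<epsilon>) * (\<epsilon> * \<eta> / 2)"
        proof (rule add_mono)
          have "integral {R..b} (\<lambda>x. (cmod (\<phi> x))\<^sup>2) \<le> sq_int \<phi> b"
            unfolding sq_int_def
            using R L2_sq_integrable[OF \<phi>L] L2_sq_integrable[OF solution_L2[OF \<phi>(1)]]
            by (intro integral_subset_le) auto
          then have "(cmod (d b))\<^sup>2 * integral {R..b} (\<lambda>x. (cmod (\<phi> x))\<^sup>2) \<le> (cmod (d b))\<^sup>2 * sq_int \<phi> b"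
            by (rule mult_left_mono) simp
          also have "\<dots> \<le> C2" by (rule d_bound[OF b(1) \<Phi>(2)])
          finally show "\<epsilon> / 2 * (cmod (d b))\<^sup>2 * integral {R..b} (\<lambda>x. (cmod (\<phi> x))\<^sup>2) \<le> \<epsilon> / 2 * C2"
            using \<epsilon> by (simp add: mult.assoc)
          show "1 / (2 * \<epsilon>) * integral {R..b} (\<lambda>x. (cmod (f x))\<^sup>2) \<le> 1 / (2 * \<epsilon>) * (\<epsilon> * \<eta> / 2)"
            using R(2)[OF b(2)] \<epsilon> by (intro mult_left_mono) auto
        qed
        also have "\<dots> = \<eta> / 2" using \<epsilon> C2 by (simp add: \<epsilon>_def field_simps)
        finally show ?thesis .
      qed
      have "wronskian g \<psi> b = d b * (wronskian g \<phi> b - wronskian g \<phi> R) + d b * wronskian g \<phi> R - c b"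
        using W[OF b(1)] by (simp add: algebra_simps)
      then have "cmod (wronskian g \<psi> b) \<le> cmod (d b * (wronskian g \<phi> b - wronskian g \<phi> R)) + cmod (d b * wronskian g \<phi> R) + cmod (c b)"
        using norm_triangle_ineq4[of "d b * (wronskian g \<phi> b - wronskian g \<phi> R) + d b * wronskian g \<phi> R" "c b"]
          norm_triangle_ineq[of "d b * (wronskian g \<phi> b - wronskian g \<phi> R)" "d b * wronskian g \<phi> R"]
        by simp
      also have "cmod (d b * wronskian g \<phi> R) = cmod (d b) * w" by (simp add: w_def norm_mult)
      finally show ?thesis using 1 2 3 by linarith
    qed
    then show ?thesis by blast
  qed
  show ?thesis
  proof (rule tendstoI)
    fix e :: real assume "e > 0"
    then obtain B where B: "\<And>b. b \<ge> B \<Longrightarrow> cmod (wronskian g \<psi> b) \<le> e / 2" using small[of "e/2"] by auto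
    show "eventually (\<lambda>b. dist (wronskian g \<psi> b) 0 < e) at_top"
      using eventually_ge_at_top[of B]
    proof eventually_elim
      case (elim b)
      then show ?case using B[OF elim] \<open>e > 0\<close> by simp
    qed
  qed
qed

text \<open>
  Let \<open>b \<rightarrow> \<infinity>\<close> in Green's formula on \<open>[0,b]\<close>; only the boundary term at \<open>0\<close> survives. The two
  applications are the orthogonality in the graph norm and the norm of the Weyl solution.
\<close>

lemma Weyl_integral:
  assumes z: "Im z > 0" and \<psi>: "is_solution q z \<psi>" "\<psi> 0 = 1" "L2 {0..} \<psi>"
    and g: "AC2 g" "L2 {0..} g" "g 0 = 0"
    and f: "L2 {0..} f" "AE x in lebesgue. x > 0 \<longrightarrow> schroed q g x - z * g x = f x"
  shows "(LINT x:{0..}|lebesgue. f x * \<psi> x) = D g 0"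
proof -
  have fi: "(\<lambda>x. f x * \<psi> x) absolutely_integrable_on {0..}" by (rule L2_mult_integrable[OF f(1) \<psi>(3)])
  have fin: "(LINT x:{0..b}|lebesgue. f x * \<psi> x) = wronskian g \<psi> b + D g 0" if b: "b \<ge> 0" for b
  proof -
    have "((\<lambda>x. f x * \<psi> x) has_integral (wronskian g \<psi> b - wronskian g \<psi> 0)) {0..b}"
      by (rule Green_formula_solution[OF \<psi>(1) g(1) order_refl b f(2)])
    moreover have "wronskian g \<psi> 0 = - D g 0" using g(3) \<psi>(2) by (simp add: wronskian_def)
    moreover have "(LINT x:{0..b}|lebesgue. f x * \<psi> x) = integral {0..b} (\<lambda>x. f x * \<psi> x)"
      by (rule set_lebesgue_integral_eq_integral(2)[OF set_integrable_subset[OF fi]]) auto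
    ultimately show ?thesis by (simp add: integral_unique)
  qed
  have "((\<lambda>b. LINT x:{0..b}|lebesgue. f x * \<psi> x) \<longlongrightarrow> (LINT x:{0..}|lebesgue. f x * \<psi> x)) at_top"
    by (rule tendsto_set_lebesgue_integral_at_top[OF _ fi]) simp
  moreover have "((\<lambda>b. wronskian g \<psi> b + D g 0) \<longlongrightarrow> 0 + D g 0) at_top"
    by (intro tendsto_add tendsto_const wronskian_tendsto_0[OF z \<psi> g f])
  then have "((\<lambda>b. LINT x:{0..b}|lebesgue. f x * \<psi> x) \<longlongrightarrow> 0 + D g 0) at_top"
    by (rule Lim_transform_eventually)
       (use eventually_ge_at_top[of 0] in \<open>eventually_elim, simp add: fin\<close>)
  ultimately show ?thesis using tendsto_unique[OF trivial_limit_at_top_linorder] by fastforce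
qed

end

section \<open>The self-adjoint extensions\<close>

lemma L2_norm_has_integral:
  assumes "L2 {0..} f"
  shows "((\<lambda>x. (cmod (f x))\<^sup>2) has_integral (L2_norm_half_line f)\<^sup>2) {0..}"
proof -
  have "(L2_norm_half_line f)\<^sup>2 = (LINT x:{0..}|lebesgue. (cmod (f x))\<^sup>2)"
    unfolding L2_norm_half_line_def
    by (subst real_sqrt_pow2) (auto simp: set_lebesgue_integral_def)
  then show ?thesis using has_integral_set_lebesgue[OF L2_square_integrable[OF assms]] by simp
qed

lemma L2_norm_half_line_cong:
  assumes "\<And>x. x \<ge> 0 \<Longrightarrow> f x = g x"
  shows "L2_norm_half_line f = L2_norm_half_line g"
proof -
  have "(LINT x:{0..}|lebesgue. (cmod (f x))\<^sup>2) = (LINT x:{0..}|lebesgue. (cmod (g x))\<^sup>2)"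
    by (rule set_lebesgue_integral_cong) (use assms in auto)
  then show ?thesis by (simp add: L2_norm_half_line_def)
qed

lemma AC2_at0:
  assumes "AC2 f"
  shows "at0 f = f 0" "at0 (D f) = D f 0"
  by (rule at0_eq[OF AC2_continuous(1)[OF assms]], rule at0_eq[OF AC2_continuous(2)[OF assms]])

text \<open>
  The cross terms between \<open>u\<close> and \<open>e cnj u\<close> cancel because their images carry opposite signs,
  and \<open>\<bar>e\<bar> = 1\<close> makes the two square terms equal. Read \<open>t\<close> as \<open>\<tau> g\<close>: the terms that couple \<open>g\<close> and
  \<open>t\<close> to \<open>u\<close> combine to \<open>\<tau> g + \<i> g\<close> times \<open>cnj u\<close> and \<open>\<tau> g - \<i> g\<close> times \<open>u\<close>, two products whose
  integrals vanish for \<open>g\<close> in the minimal domain.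
\<close>

lemma graph_norm_pointwise:
  fixes g t c e u :: complex
  assumes e: "cmod e = 1"
  shows "(cmod (g + c * (u + e * cnj u)))\<^sup>2 + (cmod (t + c * (\<i> * u - \<i> * e * cnj u)))\<^sup>2 =
    (cmod g)\<^sup>2 + (cmod t)\<^sup>2 + 4 * (cmod c)\<^sup>2 * (cmod u)\<^sup>2
     + 2 * Re ((- \<i> * cnj c) * ((t + \<i> * g) * cnj u)) + 2 * Re ((\<i> * cnj (c * e)) * ((t - \<i> * g) * u))"
proof -
  have ee: "e * cnj e = 1" using e complex_norm_square[of e] by simp
  have re: "complex_of_real (2 * Re z) = z + cnj z" for z by (simp add: complex_add_cnj)
  have ii: "\<i> * \<i> = -1" by simp
  have "complex_of_real ((cmod (g + c * (u + e * cnj u)))\<^sup>2 + (cmod (t + c * (\<i> * u - \<i> * e * cnj u)))\<^sup>2) =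
    complex_of_real ((cmod g)\<^sup>2 + (cmod t)\<^sup>2 + 4 * (cmod c)\<^sup>2 * (cmod u)\<^sup>2
     + 2 * Re ((- \<i> * cnj c) * ((t + \<i> * g) * cnj u)) + 2 * Re ((\<i> * cnj (c * e)) * ((t - \<i> * g) * u)))"
    unfolding of_real_add of_real_mult[of "4 * _"] of_real_mult[of 4] re complex_norm_square
    using ee ii
    apply (simp only: complex_cnj_add complex_cnj_mult complex_cnj_diff complex_cnj_minus complex_cnj_cnj complex_cnj_i of_real_numeral)
    apply algebra
    done
  then show ?thesis using of_real_eq_iff by blast
qed

context limit_point
begin

text \<open>
  In the lower half-plane the complex conjugate of the solution for \<open>cnj z\<close> serves.
\<close>

lemma psi0_solution:
  assumes "Im z \<noteq> 0"
  shows "is_solution q z (psi0 q z)" "psi0 q z 0 = 1" "L2 {0..} (psi0 q z)"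
proof -
  have "\<exists>u. is_solution q z u \<and> L2 {0..} u \<and> at0 u = 1"
  proof (cases "Im z > 0")
    case True
    then obtain \<psi> where "is_solution q z \<psi>" "\<psi> 0 = 1" "L2 {0..} \<psi>" by (rule Weyl_solution_exists)
    then show ?thesis using AC2_at0(1)[OF is_solutionD(1)] by auto
  next
    case False
    then have "Im (cnj z) > 0" using assms by simp
    then obtain \<psi> where "is_solution q (cnj z) \<psi>" "\<psi> 0 = 1" "L2 {0..} \<psi>" by (rule Weyl_solution_exists)
    then have "is_solution q z (\<lambda>x. cnj (\<psi> x))" "cnj (\<psi> 0) = 1" "L2 {0..} (\<lambda>x. cnj (\<psi> x))"
      using is_solution_cnj[of q "cnj z" \<psi>] L2_cnj by auto
    then show ?thesis using AC2_at0(1)[OF is_solutionD(1)] by fastforce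
  qed
  from someI_ex[OF this] have A: "is_solution q z (psi0 q z)" "L2 {0..} (psi0 q z)" "at0 (psi0 q z) = 1"
    unfolding psi0_def by blast+
  then show "is_solution q z (psi0 q z)" "psi0 q z 0 = 1" "L2 {0..} (psi0 q z)"
    using AC2_at0(1)[OF is_solutionD(1)[OF A(1)]] by auto
qed

lemma SOME_solution:
  assumes u: "u = (SOME u. is_solution q z u \<and> at0 u = a \<and> at0 (D u) = b)"
  shows "is_solution q z u" "u 0 = a" "D u 0 = b"
proof -
  obtain v where "is_solution q z v" "v 0 = a" "D v 0 = b" by (rule solution_exists)
  then have "\<exists>u. is_solution q z u \<and> at0 u = a \<and> at0 (D u) = b"
    using AC2_at0[OF is_solutionD(1)] by metis
  from someI_ex[OF this] have A: "is_solution q z u" "at0 u = a" "at0 (D u) = b"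
    unfolding u by blast+
  then show "is_solution q z u" "u 0 = a" "D u 0 = b"
    using AC2_at0[OF is_solutionD(1)[OF A(1)]] by auto
qed

lemmas theta0_solution = SOME_solution[OF theta0_def] and phi0_solution = SOME_solution[OF phi0_def]

lemma weyl_m_eq:
  assumes z: "Im z \<noteq> 0"
  shows "weyl_m q z = D (psi0 q z) 0"
  unfolding weyl_m_def
proof (rule the_equality)
  note \<psi> = psi0_solution[OF z] and \<theta> = theta0_solution[of z] and \<phi> = phi0_solution[of z]
  show eq: "\<forall>x>0. psi0 q z x = theta0 q z x + D (psi0 q z) 0 * phi0 q z x"
    using solution_combination[OF \<psi>(1) \<theta>(1) \<phi>(1) \<theta>(2) \<phi>(2,3)] \<psi>(2) \<theta>(3) by simp
  fix m assume m: "\<forall>x>0. psi0 q z x = theta0 q z x + m * phi0 q z x"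
  have "phi0 q z 1 \<noteq> 0" using solution_nonzero[OF \<phi>(1,2) _ z, of 1] \<phi>(3) by simp
  moreover have "theta0 q z 1 + m * phi0 q z 1 = theta0 q z 1 + D (psi0 q z) 0 * phi0 q z 1"
    using m[rule_format, of 1] eq[rule_format, of 1] by (metis zero_less_one)
  ultimately show "m = D (psi0 q z) 0" by auto
qed

abbreviation "\<psi> \<equiv> psi0 q \<i>"
abbreviation "N \<equiv> L2_norm_half_line (psi0 q \<i>)"
abbreviation "m \<equiv> D (psi0 q \<i>) 0"

lemma psi: "is_solution q \<i> \<psi>" "\<psi> 0 = 1" "L2 {0..} \<psi>"
  using psi0_solution[of \<i>] by auto

text \<open>
  The conjugate of \<open>\<psi>\<close> is a square integrable solution for \<open>- \<i>\<close> because \<open>q\<close> is real.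
\<close>

lemma psi_minus: "x \<ge> 0 \<Longrightarrow> psi0 q (- \<i>) x = cnj (\<psi> x)"
proof (rule L2_solution_unique)
  show "is_solution q (- \<i>) (psi0 q (- \<i>))" "psi0 q (- \<i>) 0 = 1" "L2 {0..} (psi0 q (- \<i>))"
    using psi0_solution[of "- \<i>"] by auto
  show "is_solution q (- \<i>) (\<lambda>x. cnj (\<psi> x))" using is_solution_cnj[OF psi(1)] by simp
  show "cnj (\<psi> 0) = 1" "L2 {0..} (\<lambda>x. cnj (\<psi> x))" using psi L2_cnj by auto
qed

lemma norm_psi_minus: "L2_norm_half_line (psi0 q (- \<i>)) = N"
proof -
  have "L2_norm_half_line (psi0 q (- \<i>)) = L2_norm_half_line (\<lambda>x. cnj (\<psi> x))"
    by (rule L2_norm_half_line_cong) (rule psi_minus)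
  also have "\<dots> = N" by (simp add: L2_norm_half_line_def)
  finally show ?thesis .
qed

text \<open>
  The Weyl integral with \<open>g = cnj \<psi> - \<psi>\<close>: here \<open>g 0 = 0\<close>, \<open>(\<tau> - \<i>) g = - 2 \<i> cnj \<psi>\<close>, and
  \<open>g' 0 = cnj m - m\<close>.
\<close>

lemma norm_psi_square: "N\<^sup>2 = Im m"
proof -
  note AC = is_solutionD(1)[OF psi(1)]
  define g where "g = (\<lambda>x. 1 * cnj (\<psi> x) + (-1) * \<psi> x)"
  have "(LINT x:{0..}|lebesgue. (-2 * \<i> * cnj (\<psi> x) + 0 * \<psi> x) * \<psi> x) = D g 0"
  proof (rule Weyl_integral[OF _ psi])
    show "AC2 g" unfolding g_def by (rule AC2_linear(1)[OF AC2_cnj(1)[OF AC] AC])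
    show "L2 {0..} g" unfolding g_def by (rule L2_linear[OF L2_cnj[OF psi(3)] psi(3)])
    show "g 0 = 0" using psi(2) by (simp add: g_def)
    show "L2 {0..} (\<lambda>x. -2 * \<i> * cnj (\<psi> x) + 0 * \<psi> x)" by (rule L2_linear[OF L2_cnj[OF psi(3)] psi(3)])
    show "AE x in lebesgue. x > 0 \<longrightarrow> schroed q g x - \<i> * g x = -2 * \<i> * cnj (\<psi> x) + 0 * \<psi> x"
      using schroed_linear[OF AC2_cnj(1)[OF AC] AC, of q 1 "-1"] schroed_cnj[OF AC, of q] is_solutionD(2)[OF psi(1)]
    proof eventually_elim
      case (elim x)
      show ?case
      proof
        assume "x > 0"
        then have 1: "schroed q g x = 1 * schroed q (\<lambda>x. cnj (\<psi> x)) x + (-1) * schroed q \<psi> x"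
          and 2: "schroed q (\<lambda>x. cnj (\<psi> x)) x = cnj (schroed q \<psi> x)" and 3: "schroed q \<psi> x = \<i> * \<psi> x"
          using elim unfolding g_def by blast+
        show "schroed q g x - \<i> * g x = -2 * \<i> * cnj (\<psi> x) + 0 * \<psi> x"
          unfolding 1 2 3 by (simp add: g_def algebra_simps)
      qed
    qed
  qed simp
  moreover have "D g 0 = cnj m - m"
    unfolding g_def using AC2_linear(2)[OF AC2_cnj(1)[OF AC] AC, of 0 1 "-1"] AC2_cnj(2)[OF AC, of 0] by simp
  moreover have "(LINT x:{0..}|lebesgue. (-2 * \<i> * cnj (\<psi> x) + 0 * \<psi> x) * \<psi> x) = -2 * \<i> * of_real (N\<^sup>2)"
  proof -
    have "((\<lambda>x. -2 * \<i> * of_real ((cmod (\<psi> x))\<^sup>2)) has_integral -2 * \<i> * of_real (N\<^sup>2)) {0..}"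
      by (rule has_integral_mult_right, rule has_integral_linear[OF L2_norm_has_integral[OF psi(3)] bounded_linear_of_real, unfolded o_def])
    moreover have eq: "-2 * \<i> * of_real ((cmod (\<psi> x))\<^sup>2) = (-2 * \<i> * cnj (\<psi> x) + 0 * \<psi> x) * \<psi> x" for x
      unfolding complex_norm_square by simp
    ultimately have "((\<lambda>x. (-2 * \<i> * cnj (\<psi> x) + 0 * \<psi> x) * \<psi> x) has_integral -2 * \<i> * of_real (N\<^sup>2)) {0..}"
      unfolding eq by blast
    moreover have "((\<lambda>x. (-2 * \<i> * cnj (\<psi> x) + 0 * \<psi> x) * \<psi> x) has_integral
        (LINT x:{0..}|lebesgue. (-2 * \<i> * cnj (\<psi> x) + 0 * \<psi> x) * \<psi> x)) {0..}"
      by (intro has_integral_set_lebesgue L2_mult_integrable L2_linear L2_cnj psi(3))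
    ultimately show ?thesis by (rule has_integral_unique[symmetric])
  qed
  ultimately have "cnj m - m = -2 * \<i> * of_real (N\<^sup>2)" by metis
  then have "Im (cnj m - m) = Im (-2 * \<i> * of_real (N\<^sup>2))" by (rule arg_cong)
  then show ?thesis by simp
qed

lemma norm_psi_pos: "N > 0"
proof -
  have "0 < sq_int \<psi> 1" using sq_int_pos[OF is_solutionD(1)[OF psi(1)]] psi(2) by simp
  then have "N\<^sup>2 > 0" using sq_int_le_norm[OF psi(3), of 1] by linarith
  moreover have "N \<ge> 0" by (auto simp: L2_norm_half_line_def set_lebesgue_integral_def)
  ultimately show ?thesis by (metis less_eq_real_def zero_eq_power2 less_irrefl)
qed

lemma dom_HminD:
  assumes "g \<in> dom_Hmin q"
  shows "L2 {0..} g" "AC2 g" "g 0 = 0" "D g 0 = 0" "L2 {0..} (schroed q g)"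
  using assms AC2_at0[of g] by (auto simp: dom_Hmin_def)

text \<open>
  On the minimal domain the derivative at \<open>0\<close> vanishes too, so the Weyl integral is \<open>0\<close>. The
  second identity is the conjugate of the first one for \<open>cnj g\<close>.
\<close>

lemma dom_Hmin_orthogonal:
  assumes g: "g \<in> dom_Hmin q"
  shows "((\<lambda>x. (schroed q g x - \<i> * g x) * \<psi> x) has_integral 0) {0..}"
    and "((\<lambda>x. (schroed q g x + \<i> * g x) * cnj (\<psi> x)) has_integral 0) {0..}"
proof -
  note G = dom_HminD[OF g]
  have f: "L2 {0..} (\<lambda>x. schroed q g x + s * g x)" for s
    using L2_linear[OF G(5) G(1), of 1 s] by simp
  have *: "((\<lambda>x. F x * \<psi> x) has_integral 0) {0..}"
    if F: "L2 {0..} F" "AE x in lebesgue. x > 0 \<longrightarrow> schroed q h x - \<i> * h x = F x"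
      and h: "AC2 h" "L2 {0..} h" "h 0 = 0" "D h 0 = 0" for F h
    using Weyl_integral[OF _ psi h(1-3) F] has_integral_set_lebesgue[OF L2_mult_integrable[OF F(1) psi(3)]] h(4)
    by simp
  show "((\<lambda>x. (schroed q g x - \<i> * g x) * \<psi> x) has_integral 0) {0..}"
    by (rule *[OF _ _ G(2,1,3,4)]) (use f[of "- \<i>"] in auto)
  have "((\<lambda>x. cnj (schroed q g x + \<i> * g x) * \<psi> x) has_integral 0) {0..}"
  proof (rule *)
    show "L2 {0..} (\<lambda>x. cnj (schroed q g x + \<i> * g x))" by (rule L2_cnj[OF f])
    show "AE x in lebesgue. x > 0 \<longrightarrow> schroed q (\<lambda>x. cnj (g x)) x - \<i> * cnj (g x) = cnj (schroed q g x + \<i> * g x)"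
      using schroed_cnj[OF G(2), of q] by eventually_elim auto
    show "D (\<lambda>x. cnj (g x)) 0 = 0" using AC2_cnj(2)[OF G(2), of 0] G(4) by simp
  qed (use G AC2_cnj L2_cnj in auto)
  from has_integral_linear[OF this bounded_linear_cnj]
  show "((\<lambda>x. (schroed q g x + \<i> * g x) * cnj (\<psi> x)) has_integral 0) {0..}"
    by (simp add: o_def)
qed

text \<open>
  The vector \<open>u\<^sub>+ + e u\<^sub>-\<close> that is added to the minimal domain, and below its image under the
  extension; \<open>e\<close> stands for \<open>exp (2 \<i> \<alpha>)\<close>.
\<close>

definition extension_vector :: "complex \<Rightarrow> real \<Rightarrow> complex" where
  "extension_vector e x = u_plus q x + e * u_minus q x"

definition extension_image :: "complex \<Rightarrow> real \<Rightarrow> complex" where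
  "extension_image e x = \<i> * u_plus q x - \<i> * e * u_minus q x"

lemma extension_vector_eq: "extension_vector e = (\<lambda>x. (1 / of_real N) * \<psi> x + (e / of_real N) * psi0 q (- \<i>) x)"
  by (simp add: extension_vector_def u_plus_def u_minus_def norm_psi_minus fun_eq_iff)

lemma extension_image_eq: "extension_image e = (\<lambda>x. (\<i> / of_real N) * \<psi> x + (- \<i> * e / of_real N) * psi0 q (- \<i>) x)"
  by (simp add: extension_image_def u_plus_def u_minus_def norm_psi_minus fun_eq_iff)

lemma psi_minus_properties: "AC2 (psi0 q (- \<i>))" "L2 {0..} (psi0 q (- \<i>))" "psi0 q (- \<i>) 0 = 1" "D (psi0 q (- \<i>)) 0 = cnj m"
proof -
  show "AC2 (psi0 q (- \<i>))" "L2 {0..} (psi0 q (- \<i>))" "psi0 q (- \<i>) 0 = 1"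
    using psi0_solution[of "- \<i>"] is_solutionD(1) by auto
  have "((\<lambda>x. cnj (\<psi> x)) has_vector_derivative cnj m) (at 0 within {0..})"
    by (intro has_vector_derivative_cnj AC2_has_derivative is_solutionD(1)[OF psi(1)] order_refl)
  then have "(psi0 q (- \<i>) has_vector_derivative cnj m) (at 0 within {0..})"
    by (rule has_vector_derivative_cong_half_line) (use psi_minus in auto)
  then show "D (psi0 q (- \<i>)) 0 = cnj m" by (rule D_eqI) simp
qed

lemma extension_vector_properties:
  "AC2 (extension_vector e)" "L2 {0..} (extension_vector e)" "L2 {0..} (extension_image e)"
  "extension_vector e 0 = (1 + e) / of_real N" "D (extension_vector e) 0 = (m + e * cnj m) / of_real N"
proof -
  note AC = is_solutionD(1)[OF psi(1)] psi_minus_properties(1)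
  show "AC2 (extension_vector e)" unfolding extension_vector_eq by (rule AC2_linear(1)[OF AC])
  show "L2 {0..} (extension_vector e)" unfolding extension_vector_eq by (rule L2_linear[OF psi(3) psi_minus_properties(2)])
  show "L2 {0..} (extension_image e)" unfolding extension_image_eq by (rule L2_linear[OF psi(3) psi_minus_properties(2)])
  show "extension_vector e 0 = (1 + e) / of_real N" using psi psi_minus_properties by (simp add: extension_vector_eq add_divide_distrib)
  show "D (extension_vector e) 0 = (m + e * cnj m) / of_real N"
    unfolding extension_vector_eq using AC2_linear(2)[OF AC, of 0 "1 / of_real N" "e / of_real N"] psi_minus_properties(4)
    by (simp add: add_divide_distrib)
qed

text \<open>
  If both initial values vanished then \<open>e = -1\<close> and \<open>m\<close> would be real, whereas
  \<open>Im m = N\<^sup>2 > 0\<close>.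
\<close>

lemma extension_vector_nontrivial: "extension_vector e 0 \<noteq> 0 \<or> D (extension_vector e) 0 \<noteq> 0"
proof (rule ccontr)
  assume "\<not> ?thesis"
  then have "1 + e = 0" "m + e * cnj m = 0" using extension_vector_properties(4,5)[of e] norm_psi_pos by auto
  then have "e = -1" by (simp add: add_eq_0_iff)
  then have "m = cnj m" using \<open>m + e * cnj m = 0\<close> by simp
  then have "Im m = 0" by (metis Reals_cnj_iff complex_is_Real_iff)
  then show False using norm_psi_square norm_psi_pos by simp
qed

lemma extension_initial_values:
  assumes g: "g \<in> dom_Hmin q"
  shows "at0 (\<lambda>x. g x + c * extension_vector e x) = c * extension_vector e 0"
    "at0 (D (\<lambda>x. g x + c * extension_vector e x)) = c * D (extension_vector e) 0"
proof -
  note G = dom_HminD[OF g] and E = extension_vector_properties(1)[of e]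
  have AC: "AC2 (\<lambda>x. g x + c * extension_vector e x)" using AC2_linear(1)[OF G(2) E, of 1 c] by simp
  show "at0 (\<lambda>x. g x + c * extension_vector e x) = c * extension_vector e 0"
    unfolding AC2_at0(1)[OF AC] using G(3) by simp
  show "at0 (D (\<lambda>x. g x + c * extension_vector e x)) = c * D (extension_vector e) 0"
    unfolding AC2_at0(2)[OF AC] using AC2_linear(2)[OF G(2) E, of 0 1 c] G(4) by simp
qed

text \<open>
  Functions in the minimal domain have zero initial values, so the initial values of the sum
  determine the coefficient.
\<close>

lemma decomposition_unique:
  assumes g: "g \<in> dom_Hmin q" "g' \<in> dom_Hmin q"
    and eq: "(\<lambda>x. g x + c * extension_vector e x) = (\<lambda>x. g' x + c' * extension_vector e x)"
  shows "g = g'" "c = c'"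
proof -
  have "c * extension_vector e 0 = c' * extension_vector e 0" "c * D (extension_vector e) 0 = c' * D (extension_vector e) 0"
    using extension_initial_values[OF g(1), of c e] extension_initial_values[OF g(2), of c' e] eq by metis+
  then show c: "c = c'" using extension_vector_nontrivial[of e] by auto
  show "g = g'"
  proof
    fix x
    have "g x + c * extension_vector e x = g' x + c' * extension_vector e x" using eq by (rule fun_cong)
    then show "g x = g' x" using c by simp
  qed
qed

lemma dom_H_eq: "dom_H q \<alpha> = {\<lambda>x. g x + c * extension_vector (exp (2 * \<i> * of_real \<alpha>)) x | g c. g \<in> dom_Hmin q}"
  by (simp add: dom_H_def extension_vector_def)

lemma H_eq:
  fixes \<alpha> :: real
  defines "e \<equiv> exp (2 * \<i> * complex_of_real \<alpha>)"
  assumes g: "g \<in> dom_Hmin q"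
  shows "H q \<alpha> (\<lambda>x. g x + c * extension_vector e x) = (\<lambda>x. schroed q g x + c * extension_image e x)"
  unfolding H_def extension_vector_def[symmetric] extension_image_def[symmetric] e_def[symmetric]
proof (rule the_equality)
  show "\<exists>g'\<in>dom_Hmin q. \<exists>c'. (\<lambda>x. g x + c * extension_vector e x) = (\<lambda>x. g' x + c' * extension_vector e x) \<and>
      (\<lambda>x. schroed q g x + c * extension_image e x) = (\<lambda>x. schroed q g' x + c' * extension_image e x)"
    using g by blast
  fix h assume "\<exists>g'\<in>dom_Hmin q. \<exists>c'. (\<lambda>x. g x + c * extension_vector e x) = (\<lambda>x. g' x + c' * extension_vector e x) \<and>
      h = (\<lambda>x. schroed q g' x + c' * extension_image e x)"
  then obtain g' c' where g': "g' \<in> dom_Hmin q"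
    "(\<lambda>x. g x + c * extension_vector e x) = (\<lambda>x. g' x + c' * extension_vector e x)"
    "h = (\<lambda>x. schroed q g' x + c' * extension_image e x)" by blast
  show "h = (\<lambda>x. schroed q g x + c * extension_image e x)"
    using decomposition_unique[OF g g'(1,2)] g'(3) by simp
qed

text \<open>
  The minimal domain is orthogonal, in the graph inner product, to the two deficiency vectors,
  which are themselves orthogonal and have squared graph norm \<open>2\<close> each.
\<close>

lemma graph_norm:
  assumes g: "g \<in> dom_Hmin q" and e: "cmod e = 1"
  shows "(L2_norm_half_line (\<lambda>x. g x + c * extension_vector e x))\<^sup>2 +
      (L2_norm_half_line (\<lambda>x. schroed q g x + c * extension_image e x))\<^sup>2 =
    (L2_norm_half_line g)\<^sup>2 + (L2_norm_half_line (schroed q g))\<^sup>2 + 4 * (cmod c)\<^sup>2"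
proof -
  note G = dom_HminD[OF g]
  define K where "K = 1 / complex_of_real N"
  have w: "L2 {0..} (\<lambda>x. g x + c * extension_vector e x)"
    using L2_linear[OF G(1) extension_vector_properties(2)[of e], of 1 c] by simp
  have v: "L2 {0..} (\<lambda>x. schroed q g x + c * extension_image e x)"
    using L2_linear[OF G(5) extension_vector_properties(3)[of e], of 1 c] by simp
  define A where "A = (\<lambda>x. (cmod (g x + c * extension_vector e x))\<^sup>2 + (cmod (schroed q g x + c * extension_image e x))\<^sup>2)"
  define B where "B = (\<lambda>x. (cmod (g x))\<^sup>2 + (cmod (schroed q g x))\<^sup>2 + 4 * (cmod c)\<^sup>2 * (cmod K)\<^sup>2 * (cmod (\<psi> x))\<^sup>2
     + 2 * Re ((- \<i> * cnj c * K) * ((schroed q g x + \<i> * g x) * cnj (\<psi> x)))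
     + 2 * Re ((\<i> * cnj (c * e) * K) * ((schroed q g x - \<i> * g x) * \<psi> x)))"
  have AB: "A x = B x" if x: "x \<ge> 0" for x
  proof -
    have u: "extension_vector e x = K * \<psi> x + e * cnj (K * \<psi> x)"
      "extension_image e x = \<i> * (K * \<psi> x) - \<i> * e * cnj (K * \<psi> x)"
      unfolding extension_vector_eq extension_image_eq psi_minus[OF x] K_def by simp_all
    have K: "cnj K = K" by (simp add: K_def)
    show ?thesis
      unfolding A_def B_def u graph_norm_pointwise[OF e]
      by (simp only: norm_mult power_mult_distrib complex_cnj_mult K mult_ac)
  qed
  have "(A has_integral (L2_norm_half_line (\<lambda>x. g x + c * extension_vector e x))\<^sup>2 +
      (L2_norm_half_line (\<lambda>x. schroed q g x + c * extension_image e x))\<^sup>2) {0..}"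
    unfolding A_def by (intro has_integral_add L2_norm_has_integral w v)
  then have 1: "(B has_integral (L2_norm_half_line (\<lambda>x. g x + c * extension_vector e x))\<^sup>2 +
      (L2_norm_half_line (\<lambda>x. schroed q g x + c * extension_image e x))\<^sup>2) {0..}"
    by (rule has_integral_eq[rotated]) (use AB in simp)
  have 2: "(B has_integral (L2_norm_half_line g)\<^sup>2 + (L2_norm_half_line (schroed q g))\<^sup>2
      + 4 * (cmod c)\<^sup>2 * (cmod K)\<^sup>2 * N\<^sup>2 + 2 * Re ((- \<i> * cnj c * K) * 0) + 2 * Re ((\<i> * cnj (c * e) * K) * 0)) {0..}"
    unfolding B_def
    by (intro has_integral_add L2_norm_has_integral G psi(3) has_integral_mult_right
        has_integral_linear[OF _ bounded_linear_Re, unfolded o_def] dom_Hmin_orthogonal[OF g])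
  have "(cmod K)\<^sup>2 * N\<^sup>2 = 1"
    using norm_psi_pos by (simp add: K_def norm_divide power_divide)
  then have "4 * (cmod c)\<^sup>2 * (cmod K)\<^sup>2 * N\<^sup>2 = 4 * (cmod c)\<^sup>2" by (simp add: mult.assoc)
  then show ?thesis using has_integral_unique[OF 1 2] by simp
qed

lemma zero_dom_Hmin: "(\<lambda>_. 0) \<in> dom_Hmin q" and norm_schroed_zero: "L2_norm_half_line (schroed q (\<lambda>_. 0)) = 0"
proof -
  have AC: "AC2 (\<lambda>_. 0)" using AC2_linear(1)[OF is_solutionD(1)[OF psi(1)] is_solutionD(1)[OF psi(1)], of 0 0] by simp
  have L: "L2 {0..} (\<lambda>_. 0)" using L2_linear[OF psi(3) psi(3), of 0 0] by simp
  have D0: "D (\<lambda>_. 0) x = 0" if "x \<ge> 0" for x by (rule D_eqI[OF _ that]) simp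
  have "D (D (\<lambda>_. 0)) x = 0" if "x \<ge> 0" for x
  proof (rule D_eqI[OF has_vector_derivative_cong_half_line[OF _ that] that])
    show "((\<lambda>_. 0) has_vector_derivative 0) (at x within {0..})" by simp
  qed (simp add: D0)
  then have S: "schroed q (\<lambda>_. 0) x = 0" if "x \<ge> 0" for x using that by (simp add: schroed_def)
  show "(\<lambda>_. 0) \<in> dom_Hmin q"
    unfolding dom_Hmin_def using AC L AC2_at0[OF AC] D0[of 0] L2_cong[OF L, of "schroed q (\<lambda>_. 0)"] S by auto
  have "L2_norm_half_line (schroed q (\<lambda>_. 0)) = L2_norm_half_line (\<lambda>_. 0)"
    by (rule L2_norm_half_line_cong) (rule S)
  then show "L2_norm_half_line (schroed q (\<lambda>_. 0)) = 0" by (simp add: L2_norm_half_line_def)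
qed

lemma extension_vector_nonzero_L2: "nonzero_L2 (extension_vector e)"
  unfolding nonzero_L2_def
proof
  assume ae: "AE x in lebesgue. 0 \<le> x \<longrightarrow> extension_vector e x = 0"
  have "((\<lambda>x. (cmod (extension_vector e x))\<^sup>2) has_integral 0) {0..1}"
  proof (rule has_integral_cong_AE_half_line[OF has_integral_0])
    show "AE x in lebesgue. 0 < x \<longrightarrow> (cmod (extension_vector e x))\<^sup>2 = 0"
      using ae by eventually_elim auto
  qed auto
  then have "sq_int (extension_vector e) 1 = 0" by (simp add: sq_int_def integral_unique)
  then show False using sq_int_pos[OF extension_vector_properties(1) extension_vector_nontrivial, of 1 e] by simp
qed

text \<open>
  A functional that vanishes on the minimal domain sees only the coefficient \<open>c\<close>, and its
  quotient with the squared graph norm is largest when the component in the minimal domain is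
  zero.
\<close>

lemma supremum_of_functional:
  fixes l :: "(real \<Rightarrow> complex) \<Rightarrow> complex" and \<alpha> :: real
  assumes l: "\<And>g c. g \<in> dom_Hmin q \<Longrightarrow> l (\<lambda>x. g x + c * extension_vector (exp (2 * \<i> * of_real \<alpha>)) x) = c * \<kappa>"
  shows "(SUP f \<in> {f \<in> dom_H q \<alpha>. nonzero_L2 f}. ereal ((cmod (l f))\<^sup>2 /
     ((L2_norm_half_line f)\<^sup>2 + (L2_norm_half_line (H q \<alpha> f))\<^sup>2))) = ereal ((cmod \<kappa>)\<^sup>2 / 4)"
    (is "(SUP f \<in> ?S. ereal (?r f)) = _")
proof -
  define e where "e = exp (2 * \<i> * complex_of_real \<alpha>)"
  have e: "cmod e = 1" by (simp add: e_def norm_exp_eq_Re)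
  have r: "?r (\<lambda>x. g x + c * extension_vector e x) = (cmod c)\<^sup>2 * (cmod \<kappa>)\<^sup>2 /
      ((L2_norm_half_line g)\<^sup>2 + (L2_norm_half_line (schroed q g))\<^sup>2 + 4 * (cmod c)\<^sup>2)"
    if "g \<in> dom_Hmin q" for g c
    unfolding H_eq[OF that, where \<alpha> = \<alpha>, folded e_def] graph_norm[OF that e] l[OF that, folded e_def]
    by (simp add: norm_mult power_mult_distrib)
  show ?thesis
  proof (rule antisym)
    show "(SUP f \<in> ?S. ereal (?r f)) \<le> ereal ((cmod \<kappa>)\<^sup>2 / 4)"
    proof (rule SUP_least)
      fix f assume "f \<in> ?S"
      then obtain g c where g: "g \<in> dom_Hmin q" and f: "f = (\<lambda>x. g x + c * extension_vector e x)"
        unfolding dom_H_eq e_def by blast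
      define G where "G = (L2_norm_half_line g)\<^sup>2 + (L2_norm_half_line (schroed q g))\<^sup>2"
      have G: "G \<ge> 0" by (simp add: G_def)
      have "(cmod c)\<^sup>2 * (cmod \<kappa>)\<^sup>2 / (G + 4 * (cmod c)\<^sup>2) \<le> (cmod \<kappa>)\<^sup>2 / 4"
      proof (cases "c = 0")
        case False
        then have "G + 4 * (cmod c)\<^sup>2 > 0" using G by (simp add: add_nonneg_pos)
        moreover have "0 \<le> (cmod \<kappa>)\<^sup>2 * G" using G by simp
        ultimately show ?thesis by (simp add: field_simps)
      qed simp
      then show "ereal (?r f) \<le> ereal ((cmod \<kappa>)\<^sup>2 / 4)" unfolding f r[OF g] G_def by simp
    qed
    have "extension_vector e \<in> ?S"
    proof -
      have "extension_vector e \<in> dom_H q \<alpha>"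
        unfolding dom_H_eq e_def
        by (rule CollectI, rule exI[of _ "\<lambda>_. 0"], rule exI[of _ 1]) (simp add: zero_dom_Hmin)
      then show ?thesis using extension_vector_nonzero_L2 by simp
    qed
    moreover have "?r (extension_vector e) = (cmod \<kappa>)\<^sup>2 / 4"
      using r[OF zero_dom_Hmin, of 1] norm_schroed_zero by (simp add: L2_norm_half_line_def)
    ultimately show "ereal ((cmod \<kappa>)\<^sup>2 / 4) \<le> (SUP f \<in> ?S. ereal (?r f))"
      by (metis (mono_tags, lifting) SUP_upper)
  qed
qed

end

theorem theorem5p8:
  fixes q :: "real \<Rightarrow> real" and \<alpha> :: real
  assumes q_loc: "\<And>R. R > 0 \<Longrightarrow> set_integrable lebesgue {0..R} q"
    and lp: "limit_point_at_infinity q"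
    and \<alpha>: "0 \<le> \<alpha>" "\<alpha> < pi"
  shows "(SUP f \<in> {f \<in> dom_H q (pi / 2). nonzero_L2 f}.
            ereal ((cmod (at0 (D f)))\<^sup>2 /
              ((L2_norm_half_line f)\<^sup>2 + (L2_norm_half_line (H q (pi / 2) f))\<^sup>2)))
          = ereal (Im (weyl_m q \<i>)) \<and>
         (SUP f \<in> {f \<in> dom_H q \<alpha>. nonzero_L2 f}.
            ereal ((cmod (at0 f))\<^sup>2 /
              ((L2_norm_half_line f)\<^sup>2 + (L2_norm_half_line (H q \<alpha> f))\<^sup>2)))
          = ereal ((cos \<alpha>)\<^sup>2 / Im (weyl_m q \<i>))"
proof -
  interpret limit_point q by unfold_locales (use q_loc lp in auto)
  have m: "weyl_m q \<i> = m" by (rule weyl_m_eq) simp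
  have N: "N \<noteq> 0" using norm_psi_pos by simp
  show ?thesis
  proof
    define e where "e = exp (2 * \<i> * complex_of_real (pi / 2))"
    have e: "e = -1" by (simp add: e_def mult.commute)
    have "m - cnj m = of_real (2 * Im m) * \<i>" by (simp add: complex_eq_iff)
    then have "(cmod (m - cnj m))\<^sup>2 = 4 * (Im m)\<^sup>2"
      by (simp add: norm_mult power_mult_distrib)
    then have "(cmod (D (extension_vector e) 0))\<^sup>2 / 4 = (Im m)\<^sup>2 / N\<^sup>2"
      unfolding extension_vector_properties(5) e by (simp add: norm_divide power_divide)
    also have "\<dots> = Im m" using N by (simp add: norm_psi_square[symmetric] power2_eq_square)
    finally have "(cmod (D (extension_vector e) 0))\<^sup>2 / 4 = Im m" .
    then show "(SUP f \<in> {f \<in> dom_H q (pi / 2). nonzero_L2 f}.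
            ereal ((cmod (at0 (D f)))\<^sup>2 /
              ((L2_norm_half_line f)\<^sup>2 + (L2_norm_half_line (H q (pi / 2) f))\<^sup>2)))
          = ereal (Im (weyl_m q \<i>))"
      using supremum_of_functional[of "\<lambda>f. at0 (D f)" "pi / 2" "D (extension_vector e) 0"] extension_initial_values(2)
      unfolding m e_def by simp
  next
    define e where "e = exp (2 * \<i> * complex_of_real \<alpha>)"
    have "e = cis (2 * \<alpha>)" by (simp add: e_def cis_conv_exp mult_ac)
    then have "(cmod (1 + e))\<^sup>2 = (1 + cos (2 * \<alpha>))\<^sup>2 + (sin (2 * \<alpha>))\<^sup>2"
      by (simp add: cmod_power2)
    also have "\<dots> = 4 * (cos \<alpha>)\<^sup>2"
    proof -
      have "(sin (2 * \<alpha>))\<^sup>2 = 1 - (cos (2 * \<alpha>))\<^sup>2" by (rule sin_squared_eq)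
      moreover have "(1 + cos (2 * \<alpha>))\<^sup>2 = 1 + 2 * cos (2 * \<alpha>) + (cos (2 * \<alpha>))\<^sup>2"
        by (simp add: power2_eq_square algebra_simps)
      moreover have "cos (2 * \<alpha>) = 2 * (cos \<alpha>)\<^sup>2 - 1" by (rule cos_double_cos)
      ultimately show ?thesis by linarith
    qed
    finally have "(cmod (extension_vector e 0))\<^sup>2 / 4 = (cos \<alpha>)\<^sup>2 / Im m"
      unfolding extension_vector_properties(4) by (simp add: norm_divide power_divide norm_psi_square)
    then show "(SUP f \<in> {f \<in> dom_H q \<alpha>. nonzero_L2 f}.
            ereal ((cmod (at0 f))\<^sup>2 /
              ((L2_norm_half_line f)\<^sup>2 + (L2_norm_half_line (H q \<alpha> f))\<^sup>2)))
          = ereal ((cos \<alpha>)\<^sup>2 / Im (weyl_m q \<i>))"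
      using supremum_of_functional[of at0 \<alpha> "extension_vector e 0"] extension_initial_values(1)
      unfolding m e_def by simp
  qed
qed

end
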